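(* Let $K$ be a field, $q\in K^\times$ with $q\ne 1$, $Q_1,\dots,Q_\ell\in K$, and suppose that the non-degenerate cyclotomic Hecke algebra $\mathscr H_{\ell,n}(q,\mathbf Q)$ over $K$ is semisimple. Let $\mu\in\mathscr P_{n-1}$, $\lambda\in\mathscr P_n$, $\mathfrak s,\mathfrak t\in\mathrm{Std}(\mu)$ and $\mathfrak u,\mathfrak v\in\mathrm{Std}(\lambda)$. Let $\beta^{\mathfrak s\mathfrak t}_{\mathfrak u\mathfrak v}\in K$ be the coefficients in the expansion $$\iota\big(\mathfrak f^{(n-1)}_{\mathfrak s\mathfrak t}\big)=\sum_{\lambda\in\mathscr P_n}\ \sum_{\mathfrak u,\mathfrak v\in\mathrm{Std}(\lambda)}\beta^{\mathfrak s\mathfrak t}_{\mathfrak u\mathfrak v}\,\mathfrak f^{(n)}_{\mathfrak u\mathfrak v}$$ under the natural embedding $\iota:\mathscr H_{\ell,n-1}(q,\mathbf Q)\hookrightarrow\mathscr H_{\ell,n}(q,\mathbf Q)$, $T_i\mapsto T_i$ ($0\le i<n-1$). Then $\beta^{\mathfrak s\mathfrak t}_{\mathfrak u\mathfrak v}\ne 0$ if and only if $\mathfrak u\downarrow_{n-1}=\mathfrak s$ and $\mathfrak v\downarrow_{n-1}=\mathfrak t$. In that case $$\beta^{\mathfrak s\mathfrak t}_{\mathfrak u\mathfrak v}=\frac{\gamma^{(n-1)}_{\mathfrak s}}{\gamma^{(n)}_{\mathfrak u}}=\frac{\gamma^{(n-1)}_{\mathfrak t}}{\gamma^{(n)}_{\mathfrak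 v}}.$$
   Context: **Combinatorics.** $\ell,n\ge 1$ are integers. A multipartition of $n$ is an $\ell$-tuple $\lambda=(\lambda^{(1)},\dots,\lambda^{(\ell)})$ of partitions whose sizes sum to $n$; $\mathscr P_n$ is the set of these. Its diagram is $[\lambda]=\{(i,j,c):1\le c\le \ell,\ 1\le j\le \lambda^{(c)}_i\}$. A $\lambda$-tableau is a bijection $\mathfrak t:[\lambda]\to\{1,\dots,n\}$, written $\mathfrak t=(\mathfrak t^{(1)},\dots,\mathfrak t^{(\ell)})$; it is standard if in every component entries increase along rows and down columns; $\mathrm{Std}(\lambda)$ is the set of standard $\lambda$-tableaux. $\mathfrak t\downarrow_{k}$ is the subtableau of $\mathfrak t$ with entries $1,\dots,k$. Dominance: $\lambda\unrhd\mu$ if $\sum_{t<s}|\lambda^{(t)}|+\sum_{j\le i}\lambda^{(s)}_j\ge\sum_{t<s}|\mu^{(t)}|+\sum_{j\le i}\mu^{(s)}_j$ for all $1\le s\le \ell$, $i\ge 1$; for standard tableaux $\mathfrak s\unrhd\mathfrak t$ if for every $k$ the shape of $\mathfrak s\downarrow_k$ dominates that of $\mathfrak t\downarrow_k$; $\rhd$ means $\unrhd$ and $\ne$. $\mathfrak t^\lambda$ is the standard $\lambda$-tableau with $1,\dots,n$ entered in order along the rows of component 1, then the rows of component 2, etc. $\mathfrak S_n$ acts from the right on tableaux by permuting entries (permutations are composed left to right); $s_i=(i,i+1)$; $d(\mathfrak t)\in\mathfrak S_n$ is defined by $\mathfrak t^\lambda d(\mathfrak t)=\mathfrak t$. $\mathfrak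 S_\lambda$ is the standard Young subgroup of $\lambda$ (the row stabiliser of $\mathfrak t^\lambda$). **Algebra.** $\mathscr H_{\ell,n}(q,\mathbf Q)$, $\mathbf Q=(Q_1,\dots,Q_\ell)$, is the unital associative $K$-algebra with generators $T_0,\dots,T_{n-1}$ and relations $(T_0-Q_1)\cdots(T_0-Q_\ell)=0$; $T_0T_1T_0T_1=T_1T_0T_1T_0$; $(T_i-q)(T_i+1)=0$ for $1\le i\le n-1$; $T_iT_j=T_jT_i$ for $|i-j|>1$; $T_iT_{i+1}T_i=T_{i+1}T_iT_{i+1}$ for $1\le i<n-1$. For a reduced expression $w=s_{i_1}\cdots s_{i_k}$, $T_w=T_{i_1}\cdots T_{i_k}$. $*$ is the $K$-linear anti-involution fixing each $T_i$. $\mathcal L_m=q^{1-m}T_{m-1}\cdots T_1T_0T_1\cdots T_{m-1}$, $1\le m\le n$. For $q\neq1$, semisimplicity is equivalent to $\prod_{i=1}^n(1+q+\cdots+q^{i-1})\prod_{1\le i<j\le \ell,\,|d|<n}(q^dQ_i-Q_j)\ne 0$. **Residues.** $\mathrm{res}_{\mathfrak t}(k)=q^{j-i}Q_c$ if $k$ is in row $i$, column $j$ of $\mathfrak t^{(c)}$. $R(k)=\{\mathrm{res}_{\mathfrak t}(k):\mathfrak t\in\mathrm{Std}(\lambda),\lambda\in\mathscr P_n\}$. **Seminormal basis.** For $\mathfrak s,\mathfrak t\in\mathrm{Std}(\lambda)$: $\mathfrak m_{\mathfrak s\mathfrak t}=T_{d(\mathfrak s)}^*\big(\sum_{w\in\mathfrak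 S_\lambda}T_w\big)\big(\prod_{s=2}^{\ell}\prod_{k=1}^{|\lambda^{(1)}|+\cdots+|\lambda^{(s-1)}|}(\mathcal L_k-Q_s)\big)T_{d(\mathfrak t)}$, $F_{\mathfrak t}=\prod_{k=1}^n\prod_{c\in R(k),\,c\ne\mathrm{res}_{\mathfrak t}(k)}\frac{\mathcal L_k-c}{\mathrm{res}_{\mathfrak t}(k)-c}$, and $\mathfrak f_{\mathfrak s\mathfrak t}=F_{\mathfrak s}\mathfrak m_{\mathfrak s\mathfrak t}F_{\mathfrak t}$. The $\mathfrak f_{\mathfrak s\mathfrak t}$ ($\mathfrak s,\mathfrak t\in\mathrm{Std}(\lambda)$, $\lambda\in\mathscr P_n$) form the seminormal basis, a $K$-basis of $\mathscr H_{\ell,n}(q,\mathbf Q)$. **$\gamma$-coefficients.** With $[k]_q=1+q+\cdots+q^{k-1}$, $[m]_q^!=[1]_q\cdots[m]_q$, $[\lambda]_q^!=\prod_{c}\prod_{i}[\lambda^{(c)}_i]_q^!$, the scalars $\gamma_{\mathfrak t}\in K^\times$ are uniquely determined by: (a) $\gamma_{\mathfrak t^\lambda}=[\lambda]^!_q\prod_{1\le s<t\le \ell}\prod_{(i,j):\,1\le j\le\lambda^{(s)}_i}(q^{j-i}Q_s-Q_t)$; (b) if $\mathfrak s=\mathfrak t(i,i+1)\rhd\mathfrak t$ then $\frac{\gamma_{\mathfrak t}}{\gamma_{\mathfrak s}}=\frac{(q\,\mathrm{res}_{\mathfrak s}(i)-\mathrm{res}_{\mathfrak t}(i))(\mathrm{res}_{\mathfrak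 s}(i)-q\,\mathrm{res}_{\mathfrak t}(i))}{(\mathrm{res}_{\mathfrak s}(i)-\mathrm{res}_{\mathfrak t}(i))^2}$. A superscript $(n)$ or $(n-1)$ indicates whether an object is formed for $\mathscr H_{\ell,n}(q,\mathbf Q)$ or for $\mathscr H_{\ell,n-1}(q,\mathbf Q)$ (same $q,\mathbf Q$). For $n=1$ the conventions are $\mathscr H_{\ell,0}=K$, with one (empty) standard tableau, $\mathfrak f^{(0)}=1$ and $\gamma^{(0)}=1$.
   Formalization: For n ≥ 2 all parameters Q_1,…,Q_ℓ are assumed nonzero; otherwise the claim fails: for ℓ=1, n=2, Q_1=0, q≠±1 all residues vanish, f_(2)=1+T_1, f_(1,1)=1, so ι(f)=1 has coefficient 0 at f_(2). *)

theory Defs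
  imports
    "HOL-Library.Poly_Mapping"
    "HOL-Algebra.QuotRing"
    "HOL-Combinatorics.Permutations"
begin

section \<open>Multipartitions and tableaux\<close>

text \<open>
  All indices start at 1.  A multipartition is a function: \<open>lam c i\<close> is the length of row \<open>i\<close>
  of component \<open>c\<close>, and it is 0 for indices that do not occur.  A node \<open>(i, j, c)\<close> lies in
  row \<open>i\<close> and column \<open>j\<close> of component \<open>c\<close>.  A tableau is a function on nodes which takes the
  value 0 (never an entry) outside its diagram, so that equality of tableaux is equality of
  functions and a tableau determines its shape.
\<close>

type_synonym mshape = "nat \<Rightarrow> nat \<Rightarrow> nat"
type_synonym node = "nat \<times> nat \<times> nat"
type_synonym tableau = "node \<Rightarrow> nat"

definition is_partition :: "(nat \<Rightarrow> nat) \<Rightarrow> bool" where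
  "is_partition p \<longleftrightarrow> p 0 = 0 \<and> finite {i. p i \<noteq> 0} \<and> (\<forall>i\<ge>1. p (Suc i) \<le> p i)"

definition psize :: "(nat \<Rightarrow> nat) \<Rightarrow> nat" where
  "psize p = (\<Sum>i | p i \<noteq> 0. p i)"

definition multipartitions :: "nat \<Rightarrow> nat \<Rightarrow> mshape set" where
  "multipartitions l n =
     {lam. (\<forall>c\<in>{1..l}. is_partition (lam c)) \<and> (\<forall>c. c \<notin> {1..l} \<longrightarrow> lam c = (\<lambda>_. 0)) \<and>
           (\<Sum>c=1..l. psize (lam c)) = n}"

definition diagram :: "mshape \<Rightarrow> node set" where
  "diagram lam = {(i, j, c). 1 \<le> i \<and> 1 \<le> c \<and> 1 \<le> j \<and> j \<le> lam c i}"

definition is_tableau :: "mshape \<Rightarrow> tableau \<Rightarrow> bool" where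
  "is_tableau lam t \<longleftrightarrow>
     bij_betw t (diagram lam) {1..card (diagram lam)} \<and> (\<forall>x. x \<notin> diagram lam \<longrightarrow> t x = 0)"

definition Std :: "mshape \<Rightarrow> tableau set" where
  "Std lam = {t. is_tableau lam t \<and>
     (\<forall>i j j' c. (i, j, c) \<in> diagram lam \<and> (i, j', c) \<in> diagram lam \<and> j < j'
        \<longrightarrow> t (i, j, c) < t (i, j', c)) \<and>
     (\<forall>i i' j c. (i, j, c) \<in> diagram lam \<and> (i', j, c) \<in> diagram lam \<and> i < i'
        \<longrightarrow> t (i, j, c) < t (i', j, c))}"

definition tab_restrict :: "tableau \<Rightarrow> nat \<Rightarrow> tableau"  (infixl "\<down>" 75) where
  "t \<down> k = (\<lambda>x. if t x \<le> k then t x else 0)"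

definition shape :: "tableau \<Rightarrow> mshape" where
  "shape t = (\<lambda>c i. card {j. t (i, j, c) \<noteq> 0})"

definition shape_dominates :: "nat \<Rightarrow> mshape \<Rightarrow> mshape \<Rightarrow> bool" where
  "shape_dominates l lam mu \<longleftrightarrow> (\<forall>s\<in>{1..l}. \<forall>i\<ge>1.
     (\<Sum>t=1..<s. psize (lam t)) + (\<Sum>j=1..i. lam s j)
       \<ge> (\<Sum>t=1..<s. psize (mu t)) + (\<Sum>j=1..i. mu s j))"

definition tab_dominates :: "nat \<Rightarrow> tableau \<Rightarrow> tableau \<Rightarrow> bool" where
  "tab_dominates l s t \<longleftrightarrow> (\<forall>k. shape_dominates l (shape (s \<down> k)) (shape (t \<down> k)))"

definition initial_tableau :: "mshape \<Rightarrow> tableau" where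
  "initial_tableau lam = (\<lambda>(i, j, c).
     if (i, j, c) \<in> diagram lam
     then (\<Sum>c'=1..<c. psize (lam c')) + (\<Sum>i'=1..<i. lam c i') + j else 0)"

section \<open>Permutations\<close>

text \<open>
  Permutations are functions, and the right action of \<open>w\<close> on a tableau \<open>t\<close> is \<open>w \<circ> t\<close>.
  Products of permutations are read from left to right, so in the permutation of a word the
  first letter is applied first.
\<close>

fun word_perm :: "nat list \<Rightarrow> nat \<Rightarrow> nat" where
  "word_perm [] = id"
| "word_perm (i # ws) = word_perm ws \<circ> Transposition.transpose i (Suc i)"

definition reduced_word :: "nat \<Rightarrow> (nat \<Rightarrow> nat) \<Rightarrow> nat list \<Rightarrow> bool" where
  "reduced_word n w ws \<longleftrightarrow> set ws \<subseteq> {1..<n} \<and> word_perm ws = w \<and>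
     (\<forall>js. set js \<subseteq> {1..<n} \<and> word_perm js = w \<longrightarrow> length ws \<le> length js)"

definition tab_perm :: "mshape \<Rightarrow> tableau \<Rightarrow> nat \<Rightarrow> nat" where
  "tab_perm lam t =
     (THE d. d permutes {1..card (diagram lam)} \<and> d \<circ> initial_tableau lam = t)"

definition young_subgroup :: "mshape \<Rightarrow> (nat \<Rightarrow> nat) set" where
  "young_subgroup lam = {w. w permutes {1..card (diagram lam)} \<and>
     (\<forall>i j c. (i, j, c) \<in> diagram lam \<longrightarrow>
        (\<exists>j'. (i, j', c) \<in> diagram lam \<and>
              w (initial_tableau lam (i, j, c)) = initial_tableau lam (i, j', c)))}"

section \<open>The cyclotomic Hecke algebra\<close>

text \<open>
  Words form a monoid under concatenation, so that finitely supported functions on words with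
  convolution are the free associative algebra.
\<close>

instantiation list :: (type) monoid_add
begin

definition zero_list :: "'a list" where "zero_list = []"
definition plus_list :: "'a list \<Rightarrow> 'a list \<Rightarrow> 'a list" where "plus_list xs ys = xs @ ys"

instance by standard (simp_all add: zero_list_def plus_list_def)

end

type_synonym 'a free_alg = "nat list \<Rightarrow>\<^sub>0 'a"

text \<open>\<open>mon [i\<^sub>1, \<dots>, i\<^sub>k]\<close> is the monomial \<open>T_{i\<^sub>1} \<dots> T_{i\<^sub>k}\<close>.\<close>

definition mon :: "nat list \<Rightarrow> 'a::field free_alg" where
  "mon w = Poly_Mapping.single w 1"

definition const :: "'a::field \<Rightarrow> 'a free_alg" where
  "const a = Poly_Mapping.single [] a"

text \<open>The free algebra on the letters \<open>T\<^sub>0, \<dots>, T_{n-1}\<close>; for \<open>n = 0\<close> it is the field.\<close>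

definition free_algebra :: "nat \<Rightarrow> 'a::field free_alg ring" where
  "free_algebra n = \<lparr>carrier = {x. \<forall>w\<in>Poly_Mapping.keys x. set w \<subseteq> {..<n}},
     monoid.mult = (*), one = 1, zero = 0, add = (+)\<rparr>"

definition hecke_relations :: "nat \<Rightarrow> nat \<Rightarrow> 'a::field \<Rightarrow> (nat \<Rightarrow> 'a) \<Rightarrow> 'a free_alg set" where
  "hecke_relations l n q Q =
     {r. 1 \<le> n \<and> r = prod_list (map (\<lambda>c. mon [0] - const (Q c)) [1..<Suc l])} \<union>
     {r. 2 \<le> n \<and> r = mon [0, 1, 0, 1] - mon [1, 0, 1, 0]} \<union>
     {r. \<exists>i. 1 \<le> i \<and> i < n \<and> r = (mon [i] - const q) * (mon [i] + 1)} \<union>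
     {r. \<exists>i j. i < n \<and> j < n \<and> \<bar>int i - int j\<bar> > 1 \<and> r = mon [i, j] - mon [j, i]} \<union>
     {r. \<exists>i. 1 \<le> i \<and> i + 1 < n \<and> r = mon [i, i + 1, i] - mon [i + 1, i, i + 1]}"

definition hecke_ideal :: "nat \<Rightarrow> nat \<Rightarrow> 'a::field \<Rightarrow> (nat \<Rightarrow> 'a) \<Rightarrow> 'a free_alg set" where
  "hecke_ideal l n q Q = Idl\<^bsub>free_algebra n\<^esub> (hecke_relations l n q Q)"

definition hecke :: "nat \<Rightarrow> nat \<Rightarrow> 'a::field \<Rightarrow> (nat \<Rightarrow> 'a) \<Rightarrow> 'a free_alg set ring" where
  "hecke l n q Q = free_algebra n Quot hecke_ideal l n q Q"

definition hecke_proj ::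
    "nat \<Rightarrow> nat \<Rightarrow> 'a::field \<Rightarrow> (nat \<Rightarrow> 'a) \<Rightarrow> 'a free_alg \<Rightarrow> 'a free_alg set" where
  "hecke_proj l n q Q x = hecke_ideal l n q Q +>\<^bsub>free_algebra n\<^esub> x"

definition hecke_smult ::
    "nat \<Rightarrow> nat \<Rightarrow> 'a::field \<Rightarrow> (nat \<Rightarrow> 'a) \<Rightarrow> 'a \<Rightarrow> 'a free_alg set \<Rightarrow> 'a free_alg set" where
  "hecke_smult l n q Q a X = hecke_proj l n q Q (const a) \<otimes>\<^bsub>hecke l n q Q\<^esub> X"

text \<open>
  The embedding of the algebra of rank \<open>n - 1\<close> into that of rank \<open>n\<close>: the class of \<open>x\<close> goes to
  the class of \<open>x\<close>, so \<open>T\<^sub>i\<close> goes to \<open>T\<^sub>i\<close>.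
\<close>

definition hecke_embed ::
    "nat \<Rightarrow> nat \<Rightarrow> 'a::field \<Rightarrow> (nat \<Rightarrow> 'a) \<Rightarrow> 'a free_alg set \<Rightarrow> 'a free_alg set" where
  "hecke_embed l n q Q X = the_elem (hecke_proj l n q Q ` X)"

text \<open>A ring is semisimple if its left regular module is.\<close>

definition left_ideal :: "'b set \<Rightarrow> ('b, 'm) ring_scheme \<Rightarrow> bool" where
  "left_ideal I R \<longleftrightarrow>
     additive_subgroup I R \<and> (\<forall>r\<in>carrier R. \<forall>x\<in>I. r \<otimes>\<^bsub>R\<^esub> x \<in> I)"

definition semisimple_ring :: "('b, 'm) ring_scheme \<Rightarrow> bool" where
  "semisimple_ring R \<longleftrightarrow> ring R \<and>
     (\<forall>I. left_ideal I R \<longrightarrow>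
        (\<exists>J. left_ideal J R \<and> I \<inter> J = {\<zero>\<^bsub>R\<^esub>} \<and> I <+>\<^bsub>R\<^esub> J = carrier R))"

section \<open>The seminormal basis\<close>

text \<open>
  The elements below are given by representatives in the free algebra.  Their classes in the
  Hecke algebra do not depend on the choices of reduced words, nor on the order of the
  factors \<open>L_k - c\<close>, since the \<open>L_k\<close> commute there.
\<close>

definition star :: "'a::field free_alg \<Rightarrow> 'a free_alg" where
  "star x = (\<Sum>w\<in>Poly_Mapping.keys x. Poly_Mapping.single (rev w) (Poly_Mapping.lookup x w))"

definition T_perm :: "nat \<Rightarrow> (nat \<Rightarrow> nat) \<Rightarrow> 'a::field free_alg" where
  "T_perm n w = mon (SOME ws. reduced_word n w ws)"

definition jucys_murphy :: "'a::field \<Rightarrow> nat \<Rightarrow> 'a free_alg" where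
  "jucys_murphy q m = const (q powi (1 - int m)) * mon (rev [1..<m] @ [0] @ [1..<m])"

definition residue :: "'a::field \<Rightarrow> (nat \<Rightarrow> 'a) \<Rightarrow> tableau \<Rightarrow> nat \<Rightarrow> 'a" where
  "residue q Q t k = (case (THE x. t x = k) of (i, j, c) \<Rightarrow> q powi (int j - int i) * Q c)"

definition residue_set :: "nat \<Rightarrow> nat \<Rightarrow> 'a::field \<Rightarrow> (nat \<Rightarrow> 'a) \<Rightarrow> nat \<Rightarrow> 'a set" where
  "residue_set l n q Q k = {residue q Q t k | t lam. lam \<in> multipartitions l n \<and> t \<in> Std lam}"

text \<open>
  Product over a finite set in a noncommutative ring; meaningful if the factors commute
  pairwise, as \<open>L_k - c\<close> and \<open>L_k - c'\<close> do already in the free algebra.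
\<close>

definition set_prod :: "('b \<Rightarrow> 'r::monoid_mult) \<Rightarrow> 'b set \<Rightarrow> 'r" where
  "set_prod f A = Finite_Set.fold (\<lambda>b x. f b * x) 1 A"

definition m_rep ::
    "nat \<Rightarrow> nat \<Rightarrow> 'a::field \<Rightarrow> (nat \<Rightarrow> 'a) \<Rightarrow> mshape \<Rightarrow> tableau \<Rightarrow> tableau \<Rightarrow> 'a free_alg" where
  "m_rep l n q Q lam s t =
     star (T_perm n (tab_perm lam s)) *
     (\<Sum>w\<in>young_subgroup lam. T_perm n w) *
     prod_list (map (\<lambda>r.
        prod_list (map (\<lambda>k. jucys_murphy q k - const (Q r)) [1..<Suc (\<Sum>c=1..<r. psize (lam c))]))
       [2..<Suc l]) *
     T_perm n (tab_perm lam t)"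

definition F_rep ::
    "nat \<Rightarrow> nat \<Rightarrow> 'a::field \<Rightarrow> (nat \<Rightarrow> 'a) \<Rightarrow> tableau \<Rightarrow> 'a free_alg" where
  "F_rep l n q Q t =
     prod_list (map (\<lambda>k.
        set_prod (\<lambda>c. const (1 / (residue q Q t k - c)) * (jucys_murphy q k - const c))
          (residue_set l n q Q k - {residue q Q t k}))
       [1..<Suc n])"

definition seminormal ::
    "nat \<Rightarrow> nat \<Rightarrow> 'a::field \<Rightarrow> (nat \<Rightarrow> 'a) \<Rightarrow> mshape \<Rightarrow> tableau \<Rightarrow> tableau \<Rightarrow> 'a free_alg set" where
  "seminormal l n q Q lam s t =
     hecke_proj l n q Q (F_rep l n q Q s * m_rep l n q Q lam s t * F_rep l n q Q t)"

section \<open>The gamma-coefficients\<close>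

definition q_int :: "'a::field \<Rightarrow> nat \<Rightarrow> 'a" where
  "q_int q k = (\<Sum>e<k. q ^ e)"

definition q_fact :: "'a::field \<Rightarrow> nat \<Rightarrow> 'a" where
  "q_fact q m = (\<Prod>k=1..m. q_int q k)"

definition q_fact_shape :: "nat \<Rightarrow> 'a::field \<Rightarrow> mshape \<Rightarrow> 'a" where
  "q_fact_shape l q lam = (\<Prod>c=1..l. \<Prod>i | lam c i \<noteq> 0. q_fact q (lam c i))"

text \<open>
  Only the values of \<open>\<gamma>\<close> at standard tableaux of size \<open>n\<close> are constrained, and they are
  determined.
\<close>

definition gamma_coeffs ::
    "nat \<Rightarrow> nat \<Rightarrow> 'a::field \<Rightarrow> (nat \<Rightarrow> 'a) \<Rightarrow> (tableau \<Rightarrow> 'a) \<Rightarrow> bool" where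
  "gamma_coeffs l n q Q \<gamma> \<longleftrightarrow>
     (\<forall>lam\<in>multipartitions l n.
        (\<forall>t\<in>Std lam. \<gamma> t \<noteq> 0) \<and>
        \<gamma> (initial_tableau lam) = q_fact_shape l q lam *
          (\<Prod>(s, t)\<in>{(s, t). 1 \<le> s \<and> s < t \<and> t \<le> l}.
             \<Prod>(i, j)\<in>{(i, j). 1 \<le> i \<and> 1 \<le> j \<and> j \<le> lam s i}.
               q powi (int j - int i) * Q s - Q t) \<and>
        (\<forall>s\<in>Std lam. \<forall>t\<in>Std lam. \<forall>i\<in>{1..<n}.
           s = Transposition.transpose i (Suc i) \<circ> t \<and> tab_dominates l s t \<and> s \<noteq> t \<longrightarrow>
           \<gamma> t / \<gamma> s =
             (q * residue q Q s i - residue q Q t i) * (residue q Q s i - q * residue q Q t i)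
               / (residue q Q s i - residue q Q t i)\<^sup>2))"

end

theory Submission
  imports Defs "HOL-Algebra.UnivPoly"
begin

text \<open>
  The coefficients are read off in the seminormal representations.  For every multipartition
  \<open>\<lambda>\<close> of \<open>n\<close>, the functions on the standard \<open>\<lambda>\<close>-tableaux carry a representation of
  \<open>H\<^sub>n\<close> in which \<open>L\<^sub>k\<close> multiplies the value at \<open>t\<close> by the residue of \<open>k\<close> in \<open>t\<close>
  (\<open>acts_diag_jucys_murphy\<close>, \<open>hecke_ideal_seminormal_act\<close>).  Residue sequences
  distinguish all standard tableaux of size \<open>n\<close>, so \<open>F\<^sub>t\<close> acts as the projection to the
  line of \<open>t\<close>, and \<open>f\<^sub>s\<^sub>t\<close> acts as a multiple of a matrix unit.  The multiple is a product
  \<open>C\<^sub>\<lambda> G(s) H(t)\<close> (\<open>seminormal_rep_act_self\<close>).  Here \<open>C\<^sub>\<lambda>\<close> is the eigenvalue of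
  \<open>x\<^sub>\<lambda> u\<^sub>\<lambda>\<close> at the initial tableau, where \<open>x\<^sub>\<lambda>\<close> is the sum of the \<open>T\<^sub>w\<close> over the
  Young subgroup and \<open>u\<^sub>\<lambda>\<close> the product of the factors \<open>L\<^sub>k - Q\<^sub>s\<close>; this
  element annihilates every other basis vector (\<open>symmetriser_times_factor\<close>).
  The scalar \<open>G(s)\<close> is the matrix coefficient of
  \<open>T\<^sup>*\<^bsub>d(s)\<^esub>\<close> between \<open>s\<close> and the initial tableau, and \<open>H(t)\<close> is that of
  \<open>T\<^bsub>d(t)\<^esub>\<close> between the initial tableau and \<open>t\<close>; both are products of
  rational functions of residues over the inversions of the tableau
  (\<open>word_up_coeff\<close>, \<open>word_down_coeff\<close>).  The rules that define \<open>\<gamma>\<close> give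
  \<open>\<gamma>(t) = C\<^sub>\<lambda> G(t) H(t)\<close> (\<open>gamma_initial\<close>, \<open>gamma_closed_form\<close>).

  Now restrict the representation of shape \<open>\<lambda>\<close> to \<open>H\<^bsub>n-1\<^esub>\<close>.  Forgetting the entry \<open>n\<close>
  identifies it with the direct sum of the representations of the shapes \<open>\<mu>\<close> obtained by
  removing a node (\<open>act_extend_vec\<close>).  Hence the element \<open>f\<^sub>s\<^sub>t\<close> of rank \<open>n - 1\<close>
  has the matrix entry \<open>C\<^sub>\<mu> G(s) H(t)\<close> at \<open>(u, v)\<close> if \<open>u\<close> and \<open>v\<close> restrict to \<open>s\<close>
  and \<open>t\<close>, and the entry 0 otherwise.  In the expansion of that element only
  the term of \<open>f\<^sub>u\<^sub>v\<close> contributes to this entry, so that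
  \<open>\<beta>\<^sub>u\<^sub>v C\<^sub>\<lambda> G(u) H(v) = C\<^sub>\<mu> G(s) H(t)\<close> or 0.  Finally the inversions of \<open>u\<close> are those
  of \<open>s\<close> together with the pairs formed by the last node and the nodes read after it, and these
  pairs are the same for \<open>u\<close> and \<open>v\<close> (\<open>coeff_restrict\<close>); therefore
  \<open>G(u) / G(s) = G(v) / G(t)\<close> and \<open>H(u) / H(s) = H(v) / H(t)\<close>, and the three expressions of the
  theorem coincide.

  The values of \<open>\<gamma>\<close> at the initial tableaux of one-row and one-column shapes are nonzero, which
  separates the parameters (\<open>separated_of_gamma\<close>); all denominators are controlled by this.
\<close>

section \<open>Representations of the free algebra\<close>

lemma const_mult_mon: "const a * mon w = Poly_Mapping.single w a"
  by (simp add: const_def mon_def mult_single plus_list_def)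

lemma one_eq_mon_Nil: "(1 :: 'a::field free_alg) = mon []"
  by (simp add: mon_def zero_list_def flip: single_one)

text \<open>
  Stripping one monomial at a time reduces identities between additive maps on the free algebra
  to monomials.
\<close>

lemma free_alg_induct [case_names zero add_monomial]:
  fixes x :: "'a::field free_alg"
  assumes zero: "P 0"
    and add: "\<And>a w x. w \<notin> Poly_Mapping.keys x \<Longrightarrow> a \<noteq> 0 \<Longrightarrow> P x \<Longrightarrow>
      P (const a * mon w + x)"
  shows "P x"
proof (induction x rule: update_induct)
  case const
  show ?case by (rule zero)
next
  case (update x w a)
  have "Poly_Mapping.update w a x = const a * mon w + x"
    using update.hyps
    by (intro poly_mapping_eqI)
      (auto simp: lookup_update const_mult_mon lookup_add lookup_single when_def
        not_in_keys_iff_lookup_eq_zero)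
  then show ?case
    using add[OF update.hyps update.IH] by simp
qed

lemma const_commutes: "const a * x = x * const a"
proof (induction x rule: free_alg_induct)
  case (add_monomial b w x)
  have "const a * (const b * mon w) = const b * mon w * const a"
    by (simp add: const_mult_mon) (simp add: const_def mult_single plus_list_def mult.commute)
  with add_monomial show ?case by (simp add: distrib_left distrib_right)
qed simp

text \<open>
  A family \<open>T\<close> of linear operators on functions is a representation of the free algebra.  The
  word \<open>[i, j, \<dots>]\<close> acts as \<open>T i \<circ> T j \<circ> \<dots>\<close>, so that the product of the algebra
  becomes composition.
\<close>

definition free_act ::
    "(nat \<Rightarrow> ('b \<Rightarrow> 'a) \<Rightarrow> 'b \<Rightarrow> 'a) \<Rightarrow> 'a::field free_alg \<Rightarrow> ('b \<Rightarrow> 'a) \<Rightarrow> 'b \<Rightarrow> 'a" where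
  "free_act T x \<phi> b = (\<Sum>w\<in>Poly_Mapping.keys x. Poly_Mapping.lookup x w * foldr T w \<phi> b)"

definition linear_op :: "(('b \<Rightarrow> 'a::field) \<Rightarrow> 'b \<Rightarrow> 'a) \<Rightarrow> bool" where
  "linear_op F \<longleftrightarrow> (\<forall>\<phi> \<psi>. F (\<lambda>b. \<phi> b + \<psi> b) = (\<lambda>b. F \<phi> b + F \<psi> b)) \<and>
     (\<forall>a \<phi>. F (\<lambda>b. a * \<phi> b) = (\<lambda>b. a * F \<phi> b))"

lemma linear_op_add: "linear_op F \<Longrightarrow> F (\<lambda>b. \<phi> b + \<psi> b) = (\<lambda>b. F \<phi> b + F \<psi> b)"
  and linear_op_scale: "linear_op F \<Longrightarrow> F (\<lambda>b. a * \<phi> b) = (\<lambda>b. a * F \<phi> b)"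
  by (auto simp: linear_op_def)

lemma linear_op_zero: "linear_op F \<Longrightarrow> F (\<lambda>b. 0) = (\<lambda>b. 0)"
  using linear_op_scale[of F 0 "\<lambda>b. 0"] by simp

lemma linear_op_sum:
  assumes "linear_op F"
  shows "F (\<lambda>b. \<Sum>k\<in>A. \<phi> k b) = (\<lambda>b. \<Sum>k\<in>A. F (\<phi> k) b)"
proof (induction A rule: infinite_finite_induct)
  case (insert k A)
  then show ?case
    using linear_op_add[OF assms, of "\<phi> k" "\<lambda>b. \<Sum>k\<in>A. \<phi> k b"] by simp
qed (simp_all add: linear_op_zero[OF assms])

lemma linear_op_foldr:
  assumes "\<And>i. linear_op (T i)"
  shows "linear_op (foldr T w)"
proof (induction w)
  case (Cons i w)
  then show ?case using assms[of i] by (simp add: linear_op_def)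
qed (simp add: linear_op_def)

lemma free_act_superset:
  assumes "finite A" "Poly_Mapping.keys x \<subseteq> A"
  shows "free_act T x \<phi> b = (\<Sum>w\<in>A. Poly_Mapping.lookup x w * foldr T w \<phi> b)"
  unfolding free_act_def using assms
  by (intro sum.mono_neutral_left) (auto simp: not_in_keys_iff_lookup_eq_zero)

lemma free_act_zero [simp]: "free_act T 0 \<phi> = (\<lambda>b. 0)"
  by (simp add: free_act_def fun_eq_iff)

lemma free_act_add: "free_act T (x + y) \<phi> = (\<lambda>b. free_act T x \<phi> b + free_act T y \<phi> b)"
proof
  fix b
  let ?A = "Poly_Mapping.keys x \<union> Poly_Mapping.keys y"
  have A: "finite ?A" "Poly_Mapping.keys x \<subseteq> ?A" "Poly_Mapping.keys y \<subseteq> ?A"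
    "Poly_Mapping.keys (x + y) \<subseteq> ?A"
    by (auto simp: Poly_Mapping.keys_add)
  show "free_act T (x + y) \<phi> b = free_act T x \<phi> b + free_act T y \<phi> b"
    using free_act_superset[OF A(1,2), of T \<phi> b] free_act_superset[OF A(1,3), of T \<phi> b]
      free_act_superset[OF A(1,4), of T \<phi> b]
    by (simp add: lookup_add sum.distrib distrib_right)
qed

lemma free_act_sum: "free_act T (\<Sum>k\<in>A. x k) \<phi> = (\<lambda>b. \<Sum>k\<in>A. free_act T (x k) \<phi> b)"
  by (induction A rule: infinite_finite_induct) (auto simp: free_act_add)

lemma free_act_single: "free_act T (Poly_Mapping.single w a) \<phi> = (\<lambda>b. a * foldr T w \<phi> b)"
  by (cases "a = 0") (auto simp: free_act_def)

lemma free_act_mon [simp]: "free_act T (mon w) = foldr T w"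
  by (auto simp: mon_def free_act_single fun_eq_iff)

lemma free_act_one [simp]: "free_act T 1 \<phi> = \<phi>"
  by (simp add: one_eq_mon_Nil)

lemma free_act_const: "free_act T (const a) \<phi> = (\<lambda>b. a * \<phi> b)"
  by (simp add: const_def free_act_single)

lemma linear_op_free_act:
  assumes "\<And>i. linear_op (T i)"
  shows "linear_op (free_act T x)"
proof -
  have "linear_op (foldr T w)" for w
    using assms by (rule linear_op_foldr)
  then show ?thesis
    unfolding linear_op_def
    by (simp add: free_act_def fun_eq_iff distrib_left mult.left_commute sum.distrib sum_distrib_left)
qed

lemma free_act_mult:
  assumes lin: "\<And>i. linear_op (T i)"
  shows "free_act T (x * y) \<phi> = free_act T x (free_act T y \<phi>)"
proof (induction x rule: free_alg_induct)
  case (add_monomial a v x)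
  have lv: "linear_op (foldr T v)" using lin by (rule linear_op_foldr)
  have "free_act T (const a * mon v * y) \<phi> = free_act T (const a * mon v) (free_act T y \<phi>)"
  proof (induction y rule: free_alg_induct)
    case zero
    then show ?case
      using linear_op_zero[OF lv] by (simp add: const_mult_mon free_act_single)
  next
    case (add_monomial b w y)
    have "const a * mon v * (const b * mon w) = Poly_Mapping.single (v @ w) (a * b)"
      by (simp add: const_mult_mon mult_single plus_list_def)
    moreover have "foldr T v (\<lambda>c. b * foldr T w \<phi> c + free_act T y \<phi> c) =
        (\<lambda>c. b * foldr T v (foldr T w \<phi>) c + foldr T v (free_act T y \<phi>) c)"
      using linear_op_add[OF lv] linear_op_scale[OF lv] by metis
    ultimately show ?case
      using add_monomial
      by (simp add: distrib_left free_act_add) (simp add: const_mult_mon free_act_single algebra_simps)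
  qed
  then show ?case
    using add_monomial by (simp add: distrib_right free_act_add)
qed simp

lemma free_act_uminus: "free_act T (- x) \<phi> = (\<lambda>b. - free_act T x \<phi> b)"
proof
  fix b
  show "free_act T (- x) \<phi> b = - free_act T x \<phi> b"
    using fun_cong[OF free_act_add[of T x "- x" \<phi>], of b] by (simp add: minus_unique)
qed

lemma free_act_diff: "free_act T (x - y) \<phi> = (\<lambda>b. free_act T x \<phi> b - free_act T y \<phi> b)"
  using free_act_add[of T x "- y" \<phi>] by (simp add: free_act_uminus)

text \<open>
  The functions with support in \<open>S\<close> are the representation space; the operators used
  below agree with the intended ones only on it.
\<close>

definition supp_in :: "'b set \<Rightarrow> ('b \<Rightarrow> 'a::zero) set" where
  "supp_in S = {\<phi>. \<forall>b. b \<notin> S \<longrightarrow> \<phi> b = 0}"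

lemma supp_inD: "\<phi> \<in> supp_in S \<Longrightarrow> b \<notin> S \<Longrightarrow> \<phi> b = 0"
  by (simp add: supp_in_def)

lemma foldr_supp_in:
  assumes "\<And>i \<phi>. i < n \<Longrightarrow> \<phi> \<in> supp_in S \<Longrightarrow> T i \<phi> \<in> supp_in S"
  shows "set w \<subseteq> {..<n} \<Longrightarrow> \<phi> \<in> supp_in S \<Longrightarrow> foldr T w \<phi> \<in> supp_in S"
  by (induction w) (auto intro: assms)

lemma free_act_supp_in:
  assumes T: "\<And>i \<phi>. i < n \<Longrightarrow> \<phi> \<in> supp_in S \<Longrightarrow> T i \<phi> \<in> supp_in S"
    and x: "x \<in> carrier (free_algebra n)" and \<phi>: "\<phi> \<in> supp_in S"
  shows "free_act T x \<phi> \<in> supp_in S"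
proof -
  have "foldr T w \<phi> \<in> supp_in S" if "w \<in> Poly_Mapping.keys x" for w
    using x that by (intro foldr_supp_in[OF T _ \<phi>]) (auto simp: free_algebra_def)
  then show ?thesis
    by (auto simp: free_act_def supp_in_def)
qed

section \<open>The Hecke algebra as a quotient\<close>

lemma mem_free_algebra:
  "x \<in> carrier (free_algebra n) \<longleftrightarrow> (\<forall>w\<in>Poly_Mapping.keys x. set w \<subseteq> {..<n})"
  by (simp add: free_algebra_def)

lemma free_algebra_add_closed:
  assumes "x \<in> carrier (free_algebra n)" "y \<in> carrier (free_algebra n)"
  shows "x + y \<in> carrier (free_algebra n)"
  using assms Poly_Mapping.keys_add[of x y] unfolding mem_free_algebra by blast

lemma keys_uminus_free: "Poly_Mapping.keys (- x) = Poly_Mapping.keys (x :: 'a::field free_alg)"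
  by (auto simp: in_keys_iff)

lemma free_algebra_uminus_closed:
  "x \<in> carrier (free_algebra n) \<Longrightarrow> - x \<in> carrier (free_algebra n)"
  by (simp add: mem_free_algebra keys_uminus_free)

lemma free_algebra_diff_closed:
  assumes "x \<in> carrier (free_algebra n)" "y \<in> carrier (free_algebra n)"
  shows "x - y \<in> carrier (free_algebra n)"
  using free_algebra_add_closed[OF assms(1) free_algebra_uminus_closed[OF assms(2)]] by simp

lemma free_algebra_mult_closed:
  assumes "x \<in> carrier (free_algebra n)" "y \<in> carrier (free_algebra n)"
  shows "x * y \<in> carrier (free_algebra n)"
proof -
  have "set w \<subseteq> {..<n}" if w: "w \<in> Poly_Mapping.keys (x * y)" for w
  proof -
    obtain u v where "w = u + v" "u \<in> Poly_Mapping.keys x" "v \<in> Poly_Mapping.keys y"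
      using subsetD[OF keys_mult[of x y] w] by blast
    then show ?thesis using assms by (auto simp: mem_free_algebra plus_list_def)
  qed
  then show ?thesis by (simp add: mem_free_algebra)
qed

lemma free_algebra_mon: "set w \<subseteq> {..<n} \<Longrightarrow> mon w \<in> carrier (free_algebra n)"
  by (simp add: mem_free_algebra mon_def)

lemma free_algebra_const: "const a \<in> carrier (free_algebra n)"
  by (cases "a = 0") (auto simp: mem_free_algebra const_def)

lemma free_algebra_one: "1 \<in> carrier (free_algebra n)"
  by (simp add: one_eq_mon_Nil free_algebra_mon)

lemma free_algebra_zero: "0 \<in> carrier (free_algebra n)"
  by (simp add: mem_free_algebra)

lemma free_algebra_sum:
  "(\<And>k. k \<in> A \<Longrightarrow> x k \<in> carrier (free_algebra n)) \<Longrightarrow> (\<Sum>k\<in>A. x k) \<in> carrier (free_algebra n)"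
  by (induction A rule: infinite_finite_induct)
    (simp_all add: free_algebra_zero free_algebra_add_closed)

lemma free_algebra_prod_list:
  "(\<And>x. x \<in> set xs \<Longrightarrow> x \<in> carrier (free_algebra n)) \<Longrightarrow> prod_list xs \<in> carrier (free_algebra n)"
  by (induction xs) (simp_all add: free_algebra_one free_algebra_mult_closed)

lemma free_algebra_simps:
  "x \<otimes>\<^bsub>free_algebra n\<^esub> y = x * y" "x \<oplus>\<^bsub>free_algebra n\<^esub> y = x + y"
  "\<one>\<^bsub>free_algebra n\<^esub> = 1" "\<zero>\<^bsub>free_algebra n\<^esub> = 0"
  by (simp_all add: free_algebra_def)

lemma ring_free_algebra: "ring (free_algebra n :: 'a::field free_alg ring)"
proof (rule ringI)
  show "abelian_group (free_algebra n :: 'a free_alg ring)"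
  proof (rule abelian_groupI)
    fix x :: "'a free_alg"
    assume "x \<in> carrier (free_algebra n)"
    then show "\<exists>y\<in>carrier (free_algebra n). y \<oplus>\<^bsub>free_algebra n\<^esub> x = \<zero>\<^bsub>free_algebra n\<^esub>"
      by (intro bexI[of _ "- x"]) (simp_all add: free_algebra_simps free_algebra_uminus_closed)
  qed (simp_all add: free_algebra_simps free_algebra_add_closed free_algebra_zero ac_simps)
  show "Group.monoid (free_algebra n :: 'a free_alg ring)"
    by (rule monoidI)
      (simp_all add: free_algebra_simps free_algebra_mult_closed free_algebra_one mult.assoc)
qed (simp_all add: free_algebra_simps distrib_left distrib_right)

lemma ideal_free_algebraI:
  fixes I :: "'a::field free_alg set"
  assumes "I \<subseteq> carrier (free_algebra n)" and "0 \<in> I"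
    and "\<And>x y. x \<in> I \<Longrightarrow> y \<in> I \<Longrightarrow> x + y \<in> I" and "\<And>x. x \<in> I \<Longrightarrow> - x \<in> I"
    and "\<And>x y. x \<in> I \<Longrightarrow> y \<in> carrier (free_algebra n) \<Longrightarrow> y * x \<in> I"
    and "\<And>x y. x \<in> I \<Longrightarrow> y \<in> carrier (free_algebra n) \<Longrightarrow> x * y \<in> I"
  shows "ideal I (free_algebra n)"
proof (rule idealI)
  interpret R: ring "free_algebra n :: 'a free_alg ring" by (rule ring_free_algebra)
  show "subgroup I (add_monoid (free_algebra n))"
  proof (rule group.subgroupI)
    show "Group.group (add_monoid (free_algebra n :: 'a free_alg ring))" by (rule R.add.is_group)
    show "I \<noteq> {}" using assms(2) by blast
    fix x assume x: "x \<in> I"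
    have "inv\<^bsub>add_monoid (free_algebra n)\<^esub> x = - x"
      using R.minus_equality[of "- x" x] x assms(1) assms(4)[OF x]
      by (auto simp: free_algebra_simps a_inv_def)
    then show "inv\<^bsub>add_monoid (free_algebra n)\<^esub> x \<in> I" using x assms(4) by simp
  qed (use assms in \<open>auto simp: free_algebra_simps\<close>)
qed (use assms ring_free_algebra in \<open>auto simp: free_algebra_simps\<close>)

lemma hecke_relations_closed: "hecke_relations l n q Q \<subseteq> carrier (free_algebra n)"
proof -
  have "prod_list (map (\<lambda>c. mon [0] - const (Q c)) [1..<Suc l]) \<in> carrier (free_algebra n)" if "1 \<le> n"
    using that by (intro free_algebra_prod_list)
      (auto simp del: upt_Suc intro!: free_algebra_diff_closed free_algebra_const free_algebra_mon)
  then show ?thesis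
    unfolding hecke_relations_def
    by (auto simp del: upt_Suc intro!: free_algebra_mult_closed free_algebra_diff_closed
        free_algebra_add_closed free_algebra_one free_algebra_const free_algebra_mon)
qed

lemma ideal_hecke_ideal: "ideal (hecke_ideal l n q Q) (free_algebra n)"
  unfolding hecke_ideal_def
  by (rule ring.genideal_ideal[OF ring_free_algebra hecke_relations_closed])

lemma hecke_relations_mono: "hecke_relations l (n - 1) q Q \<subseteq> hecke_relations l n q Q"
proof
  fix r assume "r \<in> hecke_relations l (n - 1) q Q"
  then consider "1 \<le> n - 1" "r = prod_list (map (\<lambda>c. mon [0] - const (Q c)) [1..<Suc l])"
    | "2 \<le> n - 1" "r = mon [0, 1, 0, 1] - mon [1, 0, 1, 0]"
    | i where "1 \<le> i" "i < n - 1" "r = (mon [i] - const q) * (mon [i] + 1)"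
    | i j where "i < n - 1" "j < n - 1" "\<bar>int i - int j\<bar> > 1" "r = mon [i, j] - mon [j, i]"
    | i where "1 \<le> i" "i + 1 < n - 1" "r = mon [i, i + 1, i] - mon [i + 1, i, i + 1]"
    unfolding hecke_relations_def by blast
  then show "r \<in> hecke_relations l n q Q"
  proof cases
    case 1
    then have "1 \<le> n" by simp
    with 1 show ?thesis unfolding hecke_relations_def by blast
  next
    case 2
    then have "2 \<le> n" by simp
    with 2 show ?thesis unfolding hecke_relations_def by blast
  next
    case 3
    then have "i < n" by simp
    with 3 show ?thesis unfolding hecke_relations_def by blast
  next
    case 4
    then have "i < n" "j < n" by simp_all
    with 4 show ?thesis unfolding hecke_relations_def by blast
  next
    case 5
    then have "i + 1 < n" by simp
    with 5 show ?thesis unfolding hecke_relations_def by blast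
  qed
qed

lemma hecke_ideal_mono: "hecke_ideal l (n - 1) q Q \<subseteq> hecke_ideal l n q Q"
proof -
  let ?I = "hecke_ideal l n q Q" and ?C = "carrier (free_algebra (n - 1))"
  interpret I: ideal ?I "free_algebra n" by (rule ideal_hecke_ideal)
  have sub: "?C \<subseteq> carrier (free_algebra n)"
    by (fastforce simp: mem_free_algebra)
  have left: "y * x \<in> ?I" "x * y \<in> ?I" if "x \<in> ?I" "y \<in> ?C" for x y
    using I.I_l_closed[OF that(1), of y] I.I_r_closed[OF that(1), of y] that(2) sub
    by (auto simp: free_algebra_simps)
  have "ideal (?I \<inter> ?C) (free_algebra (n - 1))"
  proof (rule ideal_free_algebraI)
    show "0 \<in> ?I \<inter> ?C"
      using additive_subgroup.zero_closed[OF I.additive_subgroup_axioms] free_algebra_zero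
      by (auto simp: free_algebra_simps)
    show "x + y \<in> ?I \<inter> ?C" if "x \<in> ?I \<inter> ?C" "y \<in> ?I \<inter> ?C" for x y
      using that additive_subgroup.a_closed[OF I.additive_subgroup_axioms, of x y]
      by (auto simp: free_algebra_simps free_algebra_add_closed)
    show "- x \<in> ?I \<inter> ?C" if "x \<in> ?I \<inter> ?C" for x
    proof -
      have "(- 1) * x \<in> ?I"
        using that left free_algebra_uminus_closed[OF free_algebra_one] by blast
      then show ?thesis using that by (simp add: free_algebra_uminus_closed)
    qed
  qed (use left in \<open>auto simp: free_algebra_mult_closed\<close>)
  moreover have "hecke_relations l n q Q \<subseteq> ?I"
    unfolding hecke_ideal_def
    by (rule ring.genideal_self[OF ring_free_algebra hecke_relations_closed])
  ultimately have "Idl\<^bsub>free_algebra (n - 1)\<^esub> (hecke_relations l (n - 1) q Q) \<subseteq> ?I \<inter> ?C"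
    using hecke_relations_mono[of l n q Q] hecke_relations_closed[of l "n - 1" q Q]
    by (intro ring.genideal_minimal[OF ring_free_algebra]) auto
  then show ?thesis by (simp add: hecke_ideal_def)
qed

lemma hecke_proj_eq_iff:
  assumes "x \<in> carrier (free_algebra n)" "y \<in> carrier (free_algebra n)"
  shows "hecke_proj l n q Q x = hecke_proj l n q Q y \<longleftrightarrow> x - y \<in> hecke_ideal l n q Q"
proof -
  interpret I: ideal "hecke_ideal l n q Q" "free_algebra n" by (rule ideal_hecke_ideal)
  have "\<ominus>\<^bsub>free_algebra n\<^esub> y = - y"
    using assms by (intro I.minus_equality) (auto simp: free_algebra_simps free_algebra_uminus_closed)
  then show ?thesis
    unfolding hecke_proj_def
    using I.quotient_eq_iff_same_a_r_cos[OF ideal_hecke_ideal assms]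
    by (simp add: a_minus_def free_algebra_simps)
qed

text \<open>
  The embedding is well defined because the relations of rank \<open>n - 1\<close> hold in rank \<open>n\<close>, so
  that a coset of rank \<open>n - 1\<close> has a single image.
\<close>

lemma hecke_embed_proj:
  assumes "x \<in> carrier (free_algebra (n - 1))"
  shows "hecke_embed l n q Q (hecke_proj l (n - 1) q Q x) = hecke_proj l n q Q x"
proof -
  interpret J: ideal "hecke_ideal l (n - 1) q Q" "free_algebra (n - 1)" by (rule ideal_hecke_ideal)
  have sub: "carrier (free_algebra (n - 1)) \<subseteq> carrier (free_algebra n)"
    by (fastforce simp: mem_free_algebra)
  have x: "x \<in> hecke_proj l (n - 1) q Q x"
    unfolding hecke_proj_def using assms by (rule J.a_rcos_self)
  have "hecke_proj l n q Q y = hecke_proj l n q Q x" if y: "y \<in> hecke_proj l (n - 1) q Q x" for y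
  proof -
    obtain h where h: "h \<in> hecke_ideal l (n - 1) q Q" "y = h + x"
      using y unfolding hecke_proj_def a_r_coset_def r_coset_def
      by (auto simp: free_algebra_def)
    then have "h \<in> carrier (free_algebra (n - 1))" using J.Icarr by blast
    then have hx: "h \<in> carrier (free_algebra n)" "x \<in> carrier (free_algebra n)"
      using assms sub by blast+
    then have "y \<in> carrier (free_algebra n)"
      unfolding h(2) by (rule free_algebra_add_closed)
    moreover have "y - x \<in> hecke_ideal l n q Q"
      using subsetD[OF hecke_ideal_mono h(1)] h(2) by simp
    ultimately show ?thesis
      using hecke_proj_eq_iff hx(2) by blast
  qed
  then have "hecke_proj l n q Q ` hecke_proj l (n - 1) q Q x = (\<lambda>y. hecke_proj l n q Q x) ` hecke_proj l (n - 1) q Q x"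
    by (intro image_cong refl)
  also have "\<dots> = {hecke_proj l n q Q x}"
    using x by blast
  finally have "hecke_proj l n q Q ` hecke_proj l (n - 1) q Q x = {hecke_proj l n q Q x}" .
  then show ?thesis by (simp add: hecke_embed_def)
qed

lemma hecke_proj_hom: "ring_hom_ring (free_algebra n) (hecke l n q Q) (hecke_proj l n q Q)"
proof -
  interpret I: ideal "hecke_ideal l n q Q" "free_algebra n" by (rule ideal_hecke_ideal)
  have "hecke_proj l n q Q = (+>\<^bsub>free_algebra n\<^esub>) (hecke_ideal l n q Q)"
    by (simp add: fun_eq_iff hecke_proj_def)
  then show ?thesis
    using I.rcos_ring_hom_ring by (simp add: hecke_def)
qed

lemma hecke_smult_proj:
  assumes "x \<in> carrier (free_algebra n)"
  shows "hecke_smult l n q Q a (hecke_proj l n q Q x) = hecke_proj l n q Q (const a * x)"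
  using ring_hom_mult[OF ring_hom_ring.homh[OF hecke_proj_hom[of n l q Q]] free_algebra_const assms]
  by (simp add: hecke_smult_def free_algebra_simps)

lemma finsum_hecke_proj:
  assumes x: "\<And>k. k \<in> A \<Longrightarrow> x k \<in> carrier (free_algebra n)"
    and g: "\<And>k. k \<in> A \<Longrightarrow> g k = hecke_proj l n q Q (x k)"
  shows "(\<Oplus>\<^bsub>hecke l n q Q\<^esub>k\<in>A. g k) = hecke_proj l n q Q (\<Sum>k\<in>A. x k)"
proof -
  interpret h: ring_hom_ring "free_algebra n" "hecke l n q Q" "hecke_proj l n q Q"
    by (rule hecke_proj_hom)
  have "(\<Sum>k\<in>A. x k) = (\<Oplus>\<^bsub>free_algebra n\<^esub>k\<in>A. x k)"
    using x
  proof (induction A rule: infinite_finite_induct)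
    case (insert k A)
    then show ?case
      by (subst h.R.finsum_insert) (auto simp: free_algebra_simps)
  qed (simp_all add: free_algebra_simps h.R.finsum_infinite)
  then have "hecke_proj l n q Q (\<Sum>k\<in>A. x k)
      = (\<Oplus>\<^bsub>hecke l n q Q\<^esub>k\<in>A. hecke_proj l n q Q (x k))"
    using h.hom_finsum[of x A] x by (simp add: comp_def)
  also have "\<dots> = (\<Oplus>\<^bsub>hecke l n q Q\<^esub>k\<in>A. g k)"
    using x g h.hom_closed by (intro h.S.finsum_cong') auto
  finally show ?thesis by simp
qed

text \<open>
  A representation in which the defining relations act as zero kills the whole ideal, since
  the elements acting as zero form one.
\<close>

lemma hecke_ideal_acts_zero:
  assumes lin: "\<And>i. linear_op (T i)"
    and T: "\<And>i \<phi>. i < n \<Longrightarrow> \<phi> \<in> supp_in S \<Longrightarrow> T i \<phi> \<in> supp_in S"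
    and rel: "\<And>r \<phi>. r \<in> hecke_relations l n q Q \<Longrightarrow> \<phi> \<in> supp_in S \<Longrightarrow> free_act T r \<phi> = (\<lambda>b. 0)"
    and x: "x \<in> hecke_ideal l n q Q" and \<phi>: "\<phi> \<in> supp_in S"
  shows "free_act T x \<phi> = (\<lambda>b. 0)"
proof -
  let ?K = "{x \<in> carrier (free_algebra n). \<forall>\<phi>\<in>supp_in S. free_act T x \<phi> = (\<lambda>b. 0)}"
  have zero: "free_act T x (\<lambda>b. 0) = (\<lambda>b. 0)" for x
    by (rule linear_op_zero[OF linear_op_free_act[OF lin]])
  have supp: "free_act T x \<phi> \<in> supp_in S" if "x \<in> carrier (free_algebra n)" "\<phi> \<in> supp_in S" for x \<phi>
    using T that by (rule free_act_supp_in)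
  have "ideal ?K (free_algebra n)"
    using supp zero
    by (intro ideal_free_algebraI)
      (auto simp: free_act_add free_act_uminus free_act_mult[OF lin] free_algebra_add_closed
        free_algebra_zero free_algebra_uminus_closed free_algebra_mult_closed)
  then have "hecke_ideal l n q Q \<subseteq> ?K"
    unfolding hecke_ideal_def using rel hecke_relations_closed[of l n q Q]
    by (intro ring.genideal_minimal[OF ring_free_algebra]) auto
  then show ?thesis using x \<phi> by blast
qed

section \<open>Inversions, reduced words and the length generating function\<close>

abbreviation perm_inv :: "(nat \<Rightarrow> nat) \<Rightarrow> nat \<Rightarrow> nat" where
  "perm_inv \<equiv> inv_into UNIV"

abbreviation adj_swap :: "nat \<Rightarrow> nat \<Rightarrow> nat" where
  "adj_swap i \<equiv> Transposition.transpose i (Suc i)"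

lemma adj_swap_simps:
  "adj_swap i i = Suc i" "adj_swap i (Suc i) = i" "k \<noteq> i \<Longrightarrow> k \<noteq> Suc i \<Longrightarrow> adj_swap i k = k"
  by (simp_all add: transpose_def)

lemma adj_swap_comp: "adj_swap i \<circ> (adj_swap i \<circ> f) = f" "g \<circ> adj_swap i \<circ> adj_swap i = g"
  by (simp_all add: fun_eq_iff)

lemma adj_swap_permutes: "1 \<le> i \<Longrightarrow> i < n \<Longrightarrow> adj_swap i permutes {1..n}"
  by (intro permutes_swap_id) auto

lemma adj_swap_far_commute:
  "Suc i < j \<Longrightarrow> adj_swap i \<circ> adj_swap j = adj_swap j \<circ> adj_swap i"
  by (auto simp: fun_eq_iff transpose_def)

lemma adj_swap_braid:
  "adj_swap i \<circ> adj_swap (Suc i) \<circ> adj_swap i = adj_swap (Suc i) \<circ> adj_swap i \<circ> adj_swap (Suc i)"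
  by (auto simp: fun_eq_iff transpose_def)

lemma adj_swap_less_iff:
  assumes "x \<noteq> y"
  shows "adj_swap i x < adj_swap i y \<longleftrightarrow> (x < y \<and> \<not> (x = i \<and> y = Suc i)) \<or> (x = Suc i \<and> y = i)"
  using assms by (auto simp: transpose_def)

definition inversions :: "'x set \<Rightarrow> ('x \<Rightarrow> 'x \<Rightarrow> bool) \<Rightarrow> ('x \<Rightarrow> nat) \<Rightarrow> ('x \<times> 'x) set" where
  "inversions D r f = {(a, b). a \<in> D \<and> b \<in> D \<and> r a b \<and> f b < f a}"

lemma finite_inversions: "finite D \<Longrightarrow> finite (inversions D r f)"
  by (rule finite_subset[of _ "D \<times> D"]) (auto simp: inversions_def)

text \<open>
  Exchanging two neighbouring values changes the relative order of that one pair only.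
\<close>

lemma inversions_adj_swap:
  assumes inj: "inj_on f D" and a: "a \<in> D" "f a = i" and b: "b \<in> D" "f b = Suc i"
    and r: "r a b" "\<not> r b a"
  shows "inversions D r (adj_swap i \<circ> f) = insert (a, b) (inversions D r f)"
    and "(a, b) \<notin> inversions D r f"
proof -
  show "(a, b) \<notin> inversions D r f" using a b by (simp add: inversions_def)
  have "(x, y) \<in> inversions D r (adj_swap i \<circ> f) \<longleftrightarrow> (x, y) \<in> insert (a, b) (inversions D r f)" for x y
  proof (cases "x \<in> D \<and> y \<in> D \<and> x \<noteq> y")
    case True
    then have ne: "f y \<noteq> f x" using inj by (auto dest: inj_onD)
    have "f x = i \<longleftrightarrow> x = a" "f x = Suc i \<longleftrightarrow> x = b" "f y = i \<longleftrightarrow> y = a" "f y = Suc i \<longleftrightarrow> y = b"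
      using True a b inj by (metis inj_onD)+
    then show ?thesis
      using True a b r adj_swap_less_iff[OF ne, of i] by (auto simp: inversions_def)
  qed (use a b r in \<open>auto simp: inversions_def\<close>)
  then show "inversions D r (adj_swap i \<circ> f) = insert (a, b) (inversions D r f)"
    by (auto simp: set_eq_iff)
qed

lemma card_inversions_adj_swap:
  assumes "finite D" "inj_on f D" "a \<in> D" "f a = i" "b \<in> D" "f b = Suc i" "r a b" "\<not> r b a"
  shows "card (inversions D r (adj_swap i \<circ> f)) = Suc (card (inversions D r f))"
  using inversions_adj_swap[OF assms(2-8)] finite_inversions[OF assms(1), of r f] by simp

text \<open>
  The inversions of the inverse permutation are used because a new first letter of a word
  multiplies the permutation on the right, hence its inverse on the left.
\<close>

definition perm_len :: "nat \<Rightarrow> (nat \<Rightarrow> nat) \<Rightarrow> nat" where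
  "perm_len n w = card (inversions {1..n} (<) (perm_inv w))"

lemma perm_len_ascent:
  assumes w: "w permutes {1..n}" and i: "1 \<le> i" "i < n" and asc: "w i < w (Suc i)"
  shows "perm_len n (w \<circ> adj_swap i) = Suc (perm_len n w)"
proof -
  have "perm_inv (w \<circ> adj_swap i) = perm_inv (adj_swap i) \<circ> perm_inv w"
    using w by (intro o_inv_distrib) (auto simp: permutes_bij)
  then have "perm_inv (w \<circ> adj_swap i) = adj_swap i \<circ> perm_inv w" by simp
  moreover have "w i \<in> {1..n}" "w (Suc i) \<in> {1..n}"
    using permutes_in_image[OF w] i by auto
  ultimately show ?thesis
    unfolding perm_len_def using asc w permutes_inj[OF permutes_inv[OF w]]
    by (simp only:)
      (rule card_inversions_adj_swap[of _ _ "w i" _ "w (Suc i)"],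
        auto simp: permutes_inverses intro: inj_on_subset)
qed

lemma adj_swap_comp_permutes:
  "w permutes {1..n} \<Longrightarrow> 1 \<le> i \<Longrightarrow> i < n \<Longrightarrow> (w \<circ> adj_swap i) permutes {1..n}"
  by (rule permutes_compose[OF adj_swap_permutes])

lemma perm_len_descent:
  assumes w: "w permutes {1..n}" and i: "1 \<le> i" "i < n" and desc: "w (Suc i) < w i"
  shows "perm_len n w = Suc (perm_len n (w \<circ> adj_swap i))"
  using perm_len_ascent[OF adj_swap_comp_permutes[OF w i] i] desc
  by (simp add: adj_swap_comp(2))

lemma word_perm_permutes: "set ws \<subseteq> {1..<n} \<Longrightarrow> word_perm ws permutes {1..n}"
proof (induction ws)
  case Nil
  then show ?case by (simp only: word_perm.simps permutes_id)
next
  case (Cons i ws)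
  then have "word_perm ws permutes {1..n}" "1 \<le> i" "i < n" by auto
  then show ?case by (simp only: word_perm.simps adj_swap_comp_permutes)
qed

lemma permutes_neq_Suc: "w permutes A \<Longrightarrow> w i \<noteq> w (Suc i)"
  by (simp add: permutes_inj[THEN inj_eq])

lemma perm_len_id: "perm_len n id = 0"
proof -
  have "inversions {1..n} (<) (perm_inv id) = {}" by (auto simp: inversions_def)
  then show ?thesis unfolding perm_len_def by simp
qed

lemma perm_len_word_perm_le: "set ws \<subseteq> {1..<n} \<Longrightarrow> perm_len n (word_perm ws) \<le> length ws"
proof (induction ws)
  case Nil
  then show ?case using perm_len_id by (metis word_perm.simps(1) le0)
next
  case (Cons i ws)
  then have w: "word_perm ws permutes {1..n}" and i: "1 \<le> i" "i < n"
    by (simp_all add: word_perm_permutes del: One_nat_def)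
  have "perm_len n (word_perm ws \<circ> adj_swap i) \<le> Suc (perm_len n (word_perm ws))"
    using perm_len_ascent[OF w i] perm_len_descent[OF w i] permutes_neq_Suc[OF w, of i]
    by linarith
  also have "perm_len n (word_perm ws) \<le> length ws"
    using Cons by simp
  finally show ?case by (simp add: comp_def)
qed

lemma ex_descent:
  assumes w: "w permutes {1..n}" and "w \<noteq> id"
  obtains i where "1 \<le> i" "i < n" "w (Suc i) < w i"
proof (rule ccontr)
  assume "\<not> thesis"
  with that permutes_neq_Suc[OF w] have asc: "w i < w (Suc i)" if "1 \<le> i" "i < n" for i
    using that by (metis linorder_neqE_nat)
  have "i \<le> w i" if "1 \<le> i" "i \<le> n" for i
    using that
  proof (induction i rule: nat_induct_at_least)
    case base
    then show ?case using permutes_in_image[OF w, of 1] by auto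
  next
    case (Suc i)
    then show ?case using asc[of i] by simp
  qed
  then have "w = id" using w by (intro permutes_natset_ge) auto
  with \<open>w \<noteq> id\<close> show False by simp
qed

lemma ex_word_of_perm_len:
  assumes "w permutes {1..n}"
  shows "\<exists>ws. set ws \<subseteq> {1..<n} \<and> word_perm ws = w \<and> length ws = perm_len n w"
  using assms
proof (induction "perm_len n w" arbitrary: w)
  case 0
  then have "w = id"
    using ex_descent perm_len_descent by (metis nat.distinct(1))
  then show ?case using 0 by (intro exI[of _ "[]"]) auto
next
  case (Suc m)
  have "w \<noteq> id"
  proof
    assume "w = id"
    with Suc.hyps(2) show False by (simp add: perm_len_id)
  qed
  then obtain i where i: "1 \<le> i" "i < n" "w (Suc i) < w i"
    using ex_descent Suc.prems by blast
  then have len: "perm_len n w = Suc (perm_len n (w \<circ> adj_swap i))"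
    using perm_len_descent Suc.prems by blast
  then obtain ws where ws: "set ws \<subseteq> {1..<n}" "word_perm ws = w \<circ> adj_swap i"
      "length ws = perm_len n (w \<circ> adj_swap i)"
    using Suc.hyps(1)[of "w \<circ> adj_swap i"] Suc.hyps(2) adj_swap_comp_permutes[OF Suc.prems i(1,2)]
    by auto
  then show ?case
    using len i by (intro exI[of _ "i # ws"]) (auto simp: adj_swap_comp)
qed

text \<open>
  Every letter changes the number of inversions by one, and every permutation other than the
  identity has a descent; hence the number of inversions is the length.
\<close>

lemma reduced_word_iff:
  assumes "w permutes {1..n}"
  shows "reduced_word n w ws \<longleftrightarrow> set ws \<subseteq> {1..<n} \<and> word_perm ws = w \<and> length ws = perm_len n w"
  using ex_word_of_perm_len[OF assms] perm_len_word_perm_le[of _ n]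
  unfolding reduced_word_def by (metis le_antisym)

lemma reduced_word_some:
  assumes "w permutes {1..n}"
  shows "reduced_word n w (SOME ws. reduced_word n w ws)"
  using ex_word_of_perm_len[OF assms] reduced_word_iff[OF assms] by (metis someI_ex)

lemma reduced_word_permutes: "reduced_word n w ws \<Longrightarrow> w permutes {1..n}"
  using word_perm_permutes by (auto simp: reduced_word_def)

lemma reduced_word_ConsD:
  assumes "reduced_word n w (i # ws)"
  shows "1 \<le> i" "i < n" "w (Suc i) < w i" "reduced_word n (w \<circ> adj_swap i) ws"
proof -
  have w: "w permutes {1..n}" using assms by (rule reduced_word_permutes)
  have red: "set (i # ws) \<subseteq> {1..<n}" "word_perm ws \<circ> adj_swap i = w" "Suc (length ws) = perm_len n w"
    using assms by (auto simp: reduced_word_iff[OF w])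
  then show i: "1 \<le> i" "i < n" by auto
  have ws: "word_perm ws = w \<circ> adj_swap i" using red(2) by (metis adj_swap_comp(2))
  have le: "perm_len n (w \<circ> adj_swap i) \<le> length ws"
    using perm_len_word_perm_le[of ws n] red(1) ws by simp
  show desc: "w (Suc i) < w i"
    using perm_len_ascent[OF w i] le red(3) permutes_neq_Suc[OF w, of i] by linarith
  show "reduced_word n (w \<circ> adj_swap i) ws"
    unfolding reduced_word_iff[OF adj_swap_comp_permutes[OF w i]]
    using red ws perm_len_descent[OF w i desc] by auto
qed

lemma reduced_word_ConsI:
  assumes red: "reduced_word n (w \<circ> adj_swap i) ws" and w: "w permutes {1..n}"
    and i: "1 \<le> i" "i < n" and desc: "w (Suc i) < w i"
  shows "reduced_word n w (i # ws)"
  using red perm_len_descent[OF w i desc] i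
  unfolding reduced_word_iff[OF w] reduced_word_iff[OF adj_swap_comp_permutes[OF w i]]
  by (auto simp: adj_swap_comp(2))

text \<open>
  Matsumoto's theorem for the symmetric group.  If two reduced words of \<open>w\<close> begin with
  different letters \<open>i\<close> and \<open>j\<close>, then both are descents of \<open>w\<close>, so \<open>w\<close> has reduced words which
  begin with the two sides of the braid relation of \<open>i\<close> and \<open>j\<close> and agree afterwards; induction
  compares each given word with one of these.
\<close>

lemma matsumoto:
  assumes closed: "\<And>i \<phi>. 1 \<le> i \<Longrightarrow> i < n \<Longrightarrow> \<phi> \<in> V \<Longrightarrow> F i \<phi> \<in> V"
    and far: "\<And>i j \<phi>. 1 \<le> i \<Longrightarrow> Suc i < j \<Longrightarrow> j < n \<Longrightarrow> \<phi> \<in> V \<Longrightarrow> F i (F j \<phi>) = F j (F i \<phi>)"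
    and braid: "\<And>i \<phi>. 1 \<le> i \<Longrightarrow> Suc i < n \<Longrightarrow> \<phi> \<in> V \<Longrightarrow>
      F i (F (Suc i) (F i \<phi>)) = F (Suc i) (F i (F (Suc i) \<phi>))"
    and \<phi>: "\<phi> \<in> V"
  shows "reduced_word n w us \<Longrightarrow> reduced_word n w vs \<Longrightarrow> foldr F us \<phi> = foldr F vs \<phi>"
proof (induction "length us" arbitrary: w us vs rule: less_induct)
  case less
  have foldr_V: "foldr F ws \<phi> \<in> V" if "set ws \<subseteq> {1..<n}" for ws
    using that \<phi> by (induction ws) (auto intro: closed)
  have w: "w permutes {1..n}" using less.prems(1) by (rule reduced_word_permutes)
  have len: "length us = length vs"
    using less.prems by (simp add: reduced_word_iff[OF w])
  have IH: "foldr F xs \<phi> = foldr F ys \<phi>"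
    if "reduced_word n x xs" "reduced_word n x ys" "length xs < length us" for x xs ys
    using less.hyps that by blast
  \<comment> \<open>Both words begin with a descent of \<open>w\<close>; the case of equal first letters is an induction step.\<close>
  have distinct_heads: "foldr F (i # us') \<phi> = foldr F (j # vs') \<phi>"
    if ij: "i < j" and us: "reduced_word n w (i # us')" and vs: "reduced_word n w (j # vs')"
      and lens: "length us' < length us" "length vs' < length us" for i j us' vs'
  proof (cases "Suc i < j")
    case True
    note i = reduced_word_ConsD[OF us] and j = reduced_word_ConsD[OF vs]
    let ?x = "w \<circ> adj_swap i \<circ> adj_swap j"
    have perms: "(w \<circ> adj_swap i) permutes {1..n}" "(w \<circ> adj_swap j) permutes {1..n}"
      "?x permutes {1..n}"
      by (intro adj_swap_comp_permutes w i j)+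
    obtain zs where zs: "reduced_word n ?x zs"
      using reduced_word_some[OF perms(3)] by blast
    have comm: "?x = w \<circ> adj_swap j \<circ> adj_swap i"
      using adj_swap_far_commute[OF True] by (simp add: comp_assoc)
    have "reduced_word n (w \<circ> adj_swap i) (j # zs)"
      using zs perms(1) j(1-3) True by (intro reduced_word_ConsI) (auto simp: adj_swap_simps)
    moreover have "reduced_word n (w \<circ> adj_swap j) (i # zs)"
      using zs perms(2) i(1-3) True unfolding comm
      by (intro reduced_word_ConsI) (auto simp: adj_swap_simps)
    moreover have "F i (F j (foldr F zs \<phi>)) = F j (F i (foldr F zs \<phi>))"
      using far[OF i(1) True j(2)] foldr_V zs by (auto simp: reduced_word_def)
    ultimately show ?thesis
      using IH[OF i(4) _ lens(1)] IH[OF j(4) _ lens(2)] by simp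
  next
    case False
    with ij have j_eq: "j = Suc i" by simp
    note i = reduced_word_ConsD[OF us] and j = reduced_word_ConsD[OF vs, unfolded j_eq]
    let ?a = "w \<circ> adj_swap i" and ?b = "w \<circ> adj_swap (Suc i)"
    let ?ab = "?a \<circ> adj_swap (Suc i)" and ?ba = "?b \<circ> adj_swap i"
    let ?x = "?ab \<circ> adj_swap i"
    have p: "?a permutes {1..n}" "?b permutes {1..n}"
      by (intro adj_swap_comp_permutes w i j)+
    have pp: "?ab permutes {1..n}" "?ba permutes {1..n}"
      by (intro adj_swap_comp_permutes p i j)+
    have px: "?x permutes {1..n}"
      by (intro adj_swap_comp_permutes pp i j)
    obtain zs where zs: "reduced_word n ?x zs"
      using reduced_word_some[OF px] by blast
    have x_eq: "?x = ?ba \<circ> adj_swap (Suc i)"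
      using adj_swap_braid[of i] by (simp add: comp_assoc)
    have "reduced_word n ?ab (i # zs)"
      using i(1-3) j(1-3) by (intro reduced_word_ConsI zs pp) (auto simp: transpose_def)
    then have "reduced_word n ?a (Suc i # i # zs)"
      using i(1-3) j(1-3) by (intro reduced_word_ConsI[of n ?a] p) (auto simp: transpose_def)
    moreover have "reduced_word n ?ba (Suc i # zs)"
      using i(1-3) j(1-3)
      by (intro reduced_word_ConsI zs[unfolded x_eq] pp) (auto simp: transpose_def)
    then have "reduced_word n ?b (i # Suc i # zs)"
      using i(1-3) j(1-3) by (intro reduced_word_ConsI[of n ?b] p) (auto simp: transpose_def)
    moreover have "F i (F (Suc i) (F i (foldr F zs \<phi>))) = F (Suc i) (F i (F (Suc i) (foldr F zs \<phi>)))"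
      using braid[OF i(1) j(2)] foldr_V zs by (auto simp: reduced_word_def)
    ultimately show ?thesis
      using IH[OF i(4) _ lens(1)] IH[OF j(4) _ lens(2)[unfolded j_eq]] by (simp add: j_eq)
  qed
  show ?case
  proof (cases us)
    case Nil
    then show ?thesis using len by simp
  next
    case (Cons i us')
    then obtain j vs' where vs: "vs = j # vs'" using len by (cases vs) auto
    have lens: "length us' < length us" "length vs' < length us"
      using Cons vs len by auto
    consider "i = j" | "i < j" | "j < i" by linarith
    then show ?thesis
    proof cases
      case 1
      have "foldr F us' \<phi> = foldr F vs' \<phi>"
        using IH[of "w \<circ> adj_swap i" us' vs'] less.prems lens reduced_word_ConsD(4)
        unfolding Cons vs 1 by blast
      then show ?thesis by (simp add: Cons vs 1)
    next
      case 2
      then show ?thesis using distinct_heads less.prems lens unfolding Cons vs by blast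
    next
      case 3
      then show ?thesis using distinct_heads less.prems lens unfolding Cons vs by metis
    qed
  qed
qed

text \<open>
  A Young subgroup is given by a labelling \<open>B\<close> of the points, whose fibres are its blocks.
\<close>

definition block_perms :: "(nat \<Rightarrow> 'b) \<Rightarrow> nat \<Rightarrow> (nat \<Rightarrow> nat) set" where
  "block_perms B n = {w. w permutes {1..n} \<and> (\<forall>k\<in>{1..n}. B (w k) = B k)}"

lemma finite_block_perms: "finite (block_perms B n)"
  by (rule finite_subset[OF _ finite_permutations[of "{1..n}"]]) (auto simp: block_perms_def)

text \<open>
  Read from left to right, an interval of letters carries its first point to the top and shifts
  the others down.
\<close>

lemma word_perm_upt:
  assumes "p \<le> N"
  shows "word_perm [p..<N] = (\<lambda>k. if k = p then N else if p < k \<and> k \<le> N then k - 1 else k)"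
  using assms
proof (induction p rule: inc_induct)
  case base
  then show ?case by (auto simp: fun_eq_iff)
next
  case (step p)
  then show ?case by (auto simp: upt_conv_Cons fun_eq_iff transpose_def)
qed

lemma permutes_Suc_fixed:
  assumes "w permutes {1..Suc n}" "w (Suc n) = Suc n"
  shows "w permutes {1..n}"
proof -
  have "{1..n} = {1..Suc n} - {Suc n}" by auto
  then show ?thesis
    using assms by (auto intro: permutes_superset)
qed

lemma perm_len_Suc:
  assumes w: "w permutes {1..n}"
  shows "perm_len (Suc n) w = perm_len n w"
proof -
  have top: "perm_inv w (Suc n) = Suc n"
    using permutes_not_in[OF permutes_inv[OF w], of "Suc n"] by simp
  have "perm_inv w a \<le> n" if "a \<le> n" "1 \<le> a" for a
    using permutes_in_image[OF permutes_inv[OF w], of a] that by auto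
  then have "inversions {1..Suc n} (<) (perm_inv w) = inversions {1..n} (<) (perm_inv w)"
    using top by (force simp: inversions_def le_Suc_eq)
  then show ?thesis by (simp add: perm_len_def)
qed

lemma perm_len_comp_upt:
  assumes w: "w permutes {1..n}" and p: "1 \<le> p" "p \<le> Suc n"
  shows "(w \<circ> word_perm [p..<Suc n]) permutes {1..Suc n} \<and>
    perm_len (Suc n) (w \<circ> word_perm [p..<Suc n]) = perm_len n w + (Suc n - p)"
  using p(2,1)
proof (induction p rule: inc_induct)
  case base
  then show ?case
    using perm_len_Suc[OF w] permutes_subset[OF w, of "{1..Suc n}"] by auto
next
  case (step p)
  let ?v = "w \<circ> word_perm [Suc p..<Suc n]"
  have eq: "w \<circ> word_perm [p..<Suc n] = ?v \<circ> adj_swap p"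
    using step.hyps(2) by (simp add: upt_conv_Cons comp_assoc del: upt_Suc)
  have v: "?v permutes {1..Suc n}" "perm_len (Suc n) ?v = perm_len n w + (Suc n - Suc p)"
    using step.IH by (metis le_SucI step.prems)+
  have "?v (Suc p) = w (Suc n)"
    using step.hyps by (subst comp_apply, subst word_perm_upt) auto
  also have "\<dots> = Suc n" using permutes_not_in[OF w] by simp
  finally have top: "?v (Suc p) = Suc n" .
  have "?v p \<in> {1..Suc n}"
    using permutes_in_image[OF v(1), of p] step.hyps step.prems by simp
  then have "?v p < ?v (Suc p)"
    using top permutes_neq_Suc[OF v(1), of p] by simp
  then show ?case
    unfolding eq using v step.hyps step.prems
    by (simp only: perm_len_ascent[OF v(1)] adj_swap_comp_permutes[OF v(1)]) simp
qed

text \<open>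
  Every element of the block subgroup of rank \<open>n + 1\<close> is uniquely an element of rank \<open>n\<close>
  composed with the cycle which carries some point \<open>p\<close> of the last block to \<open>n + 1\<close>; this
  adds \<open>n + 1 - p\<close> to the length, so each rank contributes one \<open>q\<close>-integer.
\<close>

lemma sum_perm_len_block_perms:
  fixes q :: "'a::field"
  assumes "\<And>a b c. 1 \<le> a \<Longrightarrow> a < b \<Longrightarrow> b < c \<Longrightarrow> c \<le> n \<Longrightarrow> B a = B c \<Longrightarrow> B b = B c"
  shows "(\<Sum>w\<in>block_perms B n. q ^ perm_len n w) = (\<Prod>k=1..n. q_int q (card {j\<in>{1..k}. B j = B k}))"
  using assms
proof (induction n)
  case 0
  have "block_perms B 0 = {id}" by (auto simp: block_perms_def)
  then have "(\<Sum>w\<in>block_perms B 0. q ^ perm_len 0 w) = q ^ perm_len 0 id"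
    by (simp only: sum.insert sum.empty finite.emptyI empty_iff not_False_eq_True add_0_right)
  then show ?case by (simp only: perm_len_id) simp
next
  case (Suc n)
  note interval = Suc.prems
  let ?N = "Suc n"
  let ?P = "{p\<in>{1..?N}. B p = B ?N}"
  let ?c = "\<lambda>p. word_perm [p..<?N]"
  let ?f = "\<lambda>(w, p). w \<circ> ?c p"
  have c_perm: "?c p permutes {1..?N}" if "p \<in> ?P" for p
    using that by (intro word_perm_permutes) auto
  have same: "B j = B ?N" if "p \<in> ?P" "p \<le> j" "j \<le> ?N" for p j
    using interval[of p j ?N] that by (cases "j = p \<or> j = ?N") auto
  have c_block: "B (?c p k) = B k" if "p \<in> ?P" "k \<in> {1..?N}" for p k
    using that same[OF that(1), of "k - 1"] same[OF that(1), of k]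
    by (subst word_perm_upt) auto
  have c_top: "?c p p = ?N" if "p \<in> ?P" for p
    using that by (subst word_perm_upt) auto
  have bij: "bij_betw ?f (block_perms B n \<times> ?P) (block_perms B ?N)"
  proof (rule bij_betwI')
    fix x y assume xy: "x \<in> block_perms B n \<times> ?P" "y \<in> block_perms B n \<times> ?P"
    obtain w p v r where x: "x = (w, p)" and y: "y = (v, r)" by (cases x, cases y) auto
    have w: "w permutes {1..n}" "v permutes {1..n}" "p \<in> ?P" "r \<in> ?P"
      using xy by (auto simp: x y block_perms_def)
    show "(?f x = ?f y) = (x = y)"
    proof
      assume eq: "?f x = ?f y"
      have perm: "(w \<circ> ?c p) permutes {1..?N}"
        using w perm_len_comp_upt by auto
      have "(w \<circ> ?c p) p = ?N" "(v \<circ> ?c r) r = ?N"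
        using permutes_not_in[OF w(1), of ?N] permutes_not_in[OF w(2), of ?N] c_top w by auto
      then have "(w \<circ> ?c p) p = (w \<circ> ?c p) r"
        using eq unfolding x y prod.case by metis
      then have "p = r"
        using permutes_inj[OF perm] by (rule injD[rotated])
      then have "w \<circ> (?c p \<circ> perm_inv (?c p)) = v \<circ> (?c p \<circ> perm_inv (?c p))"
        using eq by (simp add: x y flip: comp_assoc)
      then show "x = y"
        using permutes_inv_o[OF c_perm[OF w(3)]] \<open>p = r\<close> by (simp add: x y)
    qed simp
  next
    fix x assume "x \<in> block_perms B n \<times> ?P"
    then obtain w p where x: "x = (w, p)" "w permutes {1..n}" "\<And>k. k \<in> {1..n} \<Longrightarrow> B (w k) = B k"
      "p \<in> ?P"
      by (auto simp: block_perms_def)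
    have "B (w k) = B k" if "k \<in> {1..?N}" for k
      using that x(3)[of k] permutes_not_in[OF x(2), of ?N] by (cases "k = ?N") auto
    moreover have "?c p k \<in> {1..?N}" if "k \<in> {1..?N}" for k
      using permutes_in_image[OF c_perm[OF x(4)]] that by simp
    ultimately have "B (w (?c p k)) = B k" if "k \<in> {1..?N}" for k
      using that c_block[OF x(4)] by metis
    then show "?f x \<in> block_perms B ?N"
      using perm_len_comp_upt[OF x(2), of p] x(1,4) by (simp add: block_perms_def)
  next
    fix v assume v: "v \<in> block_perms B ?N"
    then have vp: "v permutes {1..?N}" by (simp add: block_perms_def)
    define p where "p = perm_inv v ?N"
    have vp_top: "v p = ?N" by (simp add: p_def permutes_inverses[OF vp])
    have "p \<in> {1..?N}"
      using permutes_in_image[OF permutes_inv[OF vp], of ?N] by (simp add: p_def)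
    moreover from this have "B (v p) = B p"
      using v unfolding block_perms_def by blast
    then have "B p = B ?N" by (simp add: vp_top)
    ultimately have p: "p \<in> ?P" by simp
    let ?w = "v \<circ> perm_inv (?c p)"
    have ic: "perm_inv (?c p) permutes {1..?N}" using c_perm[OF p] by (rule permutes_inv)
    have "perm_inv (?c p) ?N = p"
      using permutes_inverses(2)[OF c_perm[OF p], of p] unfolding c_top[OF p] .
    then have "?w ?N = ?N" by (simp only: comp_apply vp_top)
    moreover have "?w permutes {1..?N}"
      using ic vp by (rule permutes_compose)
    ultimately have "?w permutes {1..n}" by (rule permutes_Suc_fixed[rotated])
    moreover have "B (?w k) = B k" if "k \<in> {1..n}" for k
    proof -
      let ?j = "perm_inv (?c p) k"
      have j: "?j \<in> {1..?N}" using permutes_in_image[OF ic, of k] that by simp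
      then have "B (v ?j) = B ?j" using v by (simp add: block_perms_def)
      also have "\<dots> = B k" using c_block[OF p j] unfolding permutes_inverses[OF c_perm[OF p]] by simp
      finally show ?thesis by (simp only: comp_apply)
    qed
    ultimately have "(?w, p) \<in> block_perms B n \<times> ?P"
      using p by (simp add: block_perms_def)
    moreover have "v = ?f (?w, p)"
      by (simp only: prod.case comp_assoc permutes_inv_o[OF c_perm[OF p]] comp_id)
    ultimately show "\<exists>x\<in>block_perms B n \<times> ?P. v = ?f x" by blast
  qed
  have "(\<Sum>v\<in>block_perms B ?N. q ^ perm_len ?N v)
      = (\<Sum>x\<in>block_perms B n \<times> ?P. q ^ perm_len ?N (?f x))"
    by (rule sum.reindex_bij_betw[OF bij, symmetric])
  also have "\<dots> = (\<Sum>(w, p)\<in>block_perms B n \<times> ?P. q ^ perm_len n w * q ^ (?N - p))"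
  proof (rule sum.cong[OF refl], clarify)
    fix w p assume "w \<in> block_perms B n" "p \<in> {1..?N}"
    then have "perm_len ?N (w \<circ> ?c p) = perm_len n w + (?N - p)"
      using perm_len_comp_upt[of w n p] by (auto simp: block_perms_def)
    then show "q ^ perm_len ?N (w \<circ> ?c p) = q ^ perm_len n w * q ^ (?N - p)"
      by (simp only: power_add)
  qed
  also have "\<dots> = (\<Sum>w\<in>block_perms B n. q ^ perm_len n w) * (\<Sum>p\<in>?P. q ^ (?N - p))"
    by (simp add: sum_product sum.cartesian_product del: atLeastAtMost_iff)
  also have "(\<Sum>p\<in>?P. q ^ (?N - p)) = q_int q (card ?P)"
  proof -
    \<comment> \<open>The last block is the interval from its least point to \<open>n + 1\<close>.\<close>
    define p0 where "p0 = Min ?P"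
    have fin: "finite ?P" by simp
    have "?P \<noteq> {}" by auto
    then have p0: "p0 \<in> ?P"
      unfolding p0_def by (rule Min_in[OF fin])
    have min: "p0 \<le> p" if "p \<in> ?P" for p
      unfolding p0_def using fin that by (rule Min_le)
    have P: "?P = {p0..?N}"
    proof (intro equalityI subsetI)
      fix p assume "p \<in> ?P"
      then show "p \<in> {p0..?N}" using min[of p] by simp
    next
      fix p assume "p \<in> {p0..?N}"
      then show "p \<in> ?P" using same[OF p0, of p] p0 by simp
    qed
    have "(\<Sum>p\<in>{p0..?N}. q ^ (?N - p)) = (\<Sum>e<Suc ?N - p0. q ^ e)"
      by (rule sum.reindex_bij_witness[of _ "\<lambda>e. ?N - e" "\<lambda>p. ?N - p"])
        (use p0 in auto)
    then show ?thesis unfolding P by (simp add: q_int_def)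
  qed
  also have "(\<Sum>w\<in>block_perms B n. q ^ perm_len n w) = (\<Prod>k=1..n. q_int q (card {j\<in>{1..k}. B j = B k}))"
    using interval by (intro Suc.IH) (meson le_SucI)
  finally show ?case by simp
qed

section \<open>Diagrams and standard tableaux\<close>

lemma mem_diagram: "(i, j, c) \<in> diagram lam \<longleftrightarrow> 1 \<le> i \<and> 1 \<le> c \<and> 1 \<le> j \<and> j \<le> lam c i"
  by (simp add: diagram_def)

lemma partition_antimono:
  assumes "is_partition p" "1 \<le> i" "i \<le> i'"
  shows "p i' \<le> p i"
  using assms(3,2)
proof (induction i' rule: dec_induct)
  case (step m)
  moreover have "p (Suc m) \<le> p m" using assms(1,2) step by (simp add: is_partition_def)
  ultimately show ?case by simp
qed simp

lemma multipartition_row: "lam \<in> multipartitions l n \<Longrightarrow> is_partition (lam c)"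
  by (cases "c \<in> {1..l}") (auto simp: multipartitions_def is_partition_def)

lemma multipartition_component:
  "lam \<in> multipartitions l n \<Longrightarrow> (i, j, c) \<in> diagram lam \<Longrightarrow> c \<in> {1..l}"
  by (cases "c \<in> {1..l}") (auto simp: multipartitions_def mem_diagram)

definition nw :: "node \<Rightarrow> node \<Rightarrow> bool" where
  "nw = (\<lambda>(i, j, c) (i', j', c'). c = c' \<and> i \<le> i' \<and> j \<le> j')"

lemma nw_simp [simp]: "nw (i, j, c) (i', j', c') \<longleftrightarrow> c = c' \<and> i \<le> i' \<and> j \<le> j'"
  by (simp add: nw_def)

text \<open>The order in which the initial tableau reads the nodes.\<close>

definition reads_before :: "node \<Rightarrow> node \<Rightarrow> bool" where
  "reads_before = (\<lambda>(i, j, c) (i', j', c'). c < c' \<or> c = c' \<and> (i < i' \<or> i = i' \<and> j < j'))"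

lemma reads_before_simp [simp]:
  "reads_before (i, j, c) (i', j', c') \<longleftrightarrow> c < c' \<or> c = c' \<and> (i < i' \<or> i = i' \<and> j < j')"
  by (simp add: reads_before_def)

lemma reads_before_asym: "reads_before x y \<Longrightarrow> \<not> reads_before y x"
  by (cases x, cases y) auto

lemma reads_before_total: "x \<noteq> y \<Longrightarrow> reads_before x y \<or> reads_before y x"
  by (cases x, cases y) auto

lemma diagram_nw_closed:
  assumes "lam \<in> multipartitions l n" "(i', j', c') \<in> diagram lam" "nw (i, j, c) (i', j', c')"
    "1 \<le> i" "1 \<le> j"
  shows "(i, j, c) \<in> diagram lam"
  using assms partition_antimono[OF multipartition_row[OF assms(1), of c], of i i']
  by (auto simp: mem_diagram)

lemma psize_finite_support: "is_partition p \<Longrightarrow> finite {i. p i \<noteq> 0}"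
  by (simp add: is_partition_def)

lemma diagram_eq_image:
  assumes "lam \<in> multipartitions l n"
  shows "diagram lam = (\<lambda>(c, i, j). (i, j, c)) ` (SIGMA c:{1..l}. SIGMA i:{i. lam c i \<noteq> 0}. {1..lam c i})"
proof -
  have pos: "1 \<le> i" if "lam c i \<noteq> 0" for c i
    using multipartition_row[OF assms, of c] that by (cases i) (auto simp: is_partition_def)
  show ?thesis (is "_ = ?f ` ?S")
  proof (intro equalityI subsetI)
    fix x assume x: "x \<in> diagram lam"
    obtain i j c where xeq: "x = (i, j, c)" by (cases x)
    then have "(c, i, j) \<in> ?S"
      using x multipartition_component[OF assms, of i j c] by (auto simp: mem_diagram)
    then show "x \<in> ?f ` ?S" unfolding xeq by (rule rev_image_eqI) simp
  next
    fix x assume "x \<in> ?f ` ?S"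
    then obtain i j c where "x = (i, j, c)" "lam c i \<noteq> 0" "1 \<le> c" "1 \<le> j" "j \<le> lam c i"
      by auto
    then show "x \<in> diagram lam" using pos[of c i] by (simp add: mem_diagram)
  qed
qed

lemma finite_diagram: "lam \<in> multipartitions l n \<Longrightarrow> finite (diagram lam)"
  using psize_finite_support[OF multipartition_row]
  by (subst diagram_eq_image) (auto intro!: finite_imageI finite_SigmaI)

lemma card_diagram:
  assumes "lam \<in> multipartitions l n"
  shows "card (diagram lam) = n"
proof -
  have "card (diagram lam) = card (SIGMA c:{1..l}. SIGMA i:{i. lam c i \<noteq> 0}. {1..lam c i})"
    unfolding diagram_eq_image[OF assms] by (rule card_image) (auto simp: inj_on_def)
  also have "\<dots> = (\<Sum>c=1..l. psize (lam c))"
    using psize_finite_support[OF multipartition_row[OF assms]] by (simp add: psize_def)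
  also have "\<dots> = n" using assms by (simp add: multipartitions_def)
  finally show ?thesis .
qed

lemma diagram_inject:
  assumes "lam \<in> multipartitions l n" "mu \<in> multipartitions l m" "diagram lam = diagram mu"
  shows "lam = mu"
proof (intro ext)
  fix c i
  show "lam c i = mu c i"
  proof (cases "1 \<le> i \<and> 1 \<le> c")
    case True
    then have "{j. (i, j, c) \<in> diagram lam} = {1..lam c i}" "{j. (i, j, c) \<in> diagram mu} = {1..mu c i}"
      by (auto simp: mem_diagram)
    then show ?thesis using assms(3) by (metis card_atLeastAtMost diff_Suc_1)
  next
    case False
    then have "lam c i = 0" "mu c i = 0"
      using multipartition_row[OF assms(1), of c] multipartition_row[OF assms(2), of c] assms(1,2)
      by (auto simp: is_partition_def multipartitions_def not_le less_Suc0)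
    then show ?thesis by simp
  qed
qed

text \<open>
  A row segment and a column segment meet in at most one node.  This bounds the contents that
  occur, since the content of a node is the difference of the lengths of two such segments.
\<close>

lemma segments_card:
  assumes "finite D" and row: "\<And>r. 1 \<le> r \<Longrightarrow> r \<le> m \<Longrightarrow> (i, r, c) \<in> D"
    and col: "\<And>r. 1 \<le> r \<Longrightarrow> r \<le> m' \<Longrightarrow> (r, j, c') \<in> D"
  shows "m + m' \<le> card D + of_bool (c = c')"
proof -
  let ?A = "(\<lambda>r. (i, r, c)) ` {1..m}" and ?B = "(\<lambda>r. (r, j, c')) ` {1..m'}"
  have "card ?A = m" "card ?B = m'" by (simp_all add: card_image inj_on_def)
  moreover have "card (?A \<inter> ?B) \<le> of_bool (c = c')"
  proof (cases "c = c'")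
    case True
    have "card (?A \<inter> ?B) \<le> card {(i, j, c)}" by (rule card_mono) auto
    then show ?thesis using True by simp
  next
    case False
    then have "?A \<inter> ?B = {}" by auto
    then show ?thesis by simp
  qed
  moreover have "card (?A \<union> ?B) \<le> card D"
    using assms by (intro card_mono) auto
  ultimately show ?thesis
    using card_Un_Int[of ?A ?B] by simp
qed

lemma diagram_hook:
  assumes lam: "lam \<in> multipartitions l n" and a: "(i, j, c) \<in> diagram lam" "(i', j', c) \<in> diagram lam"
  shows "j + i' \<le> Suc n"
proof -
  have "j + i' \<le> card (diagram lam) + of_bool (c = c)"
  proof (rule segments_card[OF finite_diagram[OF lam]])
    show "(i, r, c) \<in> diagram lam" if "1 \<le> r" "r \<le> j" for r
      using a(1) that by (auto simp: mem_diagram)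
    show "(r, j', c) \<in> diagram lam" if "1 \<le> r" "r \<le> i'" for r
      using diagram_nw_closed[OF lam a(2), of r j' c] a(2) that by (auto simp: mem_diagram)
  qed
  then show ?thesis by (simp add: card_diagram[OF lam])
qed

lemma finite_multipartitions: "finite (multipartitions l n)"
proof (rule finite_imageD)
  show "inj_on diagram (multipartitions l n)"
    by (auto intro: inj_onI diagram_inject)
  have "diagram lam \<subseteq> {1..n} \<times> {1..n} \<times> {1..l}" if lam: "lam \<in> multipartitions l n" for lam
  proof
    fix x assume x: "x \<in> diagram lam"
    obtain i j c where xeq: "x = (i, j, c)" by (cases x)
    show "x \<in> {1..n} \<times> {1..n} \<times> {1..l}"
      using multipartition_component[OF lam x[unfolded xeq]]
        diagram_hook[OF lam x[unfolded xeq] x[unfolded xeq]] x by (auto simp: xeq mem_diagram)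
  qed
  then have "diagram ` multipartitions l n \<subseteq> Pow ({1..n} \<times> {1..n} \<times> {1..l})" by blast
  then show "finite (diagram ` multipartitions l n)"
    by (rule finite_subset) simp
qed

lemma tableau_bij:
  "lam \<in> multipartitions l n \<Longrightarrow> is_tableau lam t \<Longrightarrow> bij_betw t (diagram lam) {1..n}"
  by (simp add: is_tableau_def card_diagram)

lemma tableau_outside: "is_tableau lam t \<Longrightarrow> x \<notin> diagram lam \<Longrightarrow> t x = 0"
  unfolding is_tableau_def by blast

lemma tableau_pos: "is_tableau lam t \<Longrightarrow> x \<in> diagram lam \<longleftrightarrow> t x \<noteq> 0"
proof (cases "x \<in> diagram lam")
  case True
  assume "is_tableau lam t"
  then have "t x \<in> {1..card (diagram lam)}"
    using True bij_betwE unfolding is_tableau_def by blast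
  then show ?thesis using True by simp
qed (metis tableau_outside)

lemma Std_is_tableau: "t \<in> Std lam \<Longrightarrow> is_tableau lam t"
  by (simp add: Std_def)

lemma finite_Std:
  assumes "lam \<in> multipartitions l n"
  shows "finite (Std lam)"
proof (rule finite_subset)
  show "Std lam \<subseteq> {t. \<forall>x. (x \<in> diagram lam \<longrightarrow> t x \<in> {1..n}) \<and> (x \<notin> diagram lam \<longrightarrow> t x = 0)}"
    using tableau_bij[OF assms Std_is_tableau] tableau_outside[OF Std_is_tableau] bij_betwE by blast
  show "finite {t. \<forall>x. (x \<in> diagram lam \<longrightarrow> t x \<in> {1..n}) \<and> (x \<notin> diagram lam \<longrightarrow> t x = 0)}"
    by (rule finite_set_of_finite_funs[OF finite_diagram[OF assms]]) simp
qed

lemma Std_shape_unique: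
  assumes "lam \<in> multipartitions l n" "mu \<in> multipartitions l m" "t \<in> Std lam" "t \<in> Std mu"
  shows "lam = mu"
proof (rule diagram_inject[OF assms(1,2)])
  show "diagram lam = diagram mu"
    using tableau_pos[OF Std_is_tableau[OF assms(3)]] tableau_pos[OF Std_is_tableau[OF assms(4)]]
    by blast
qed

definition box :: "tableau \<Rightarrow> nat \<Rightarrow> node" where
  "box t k = (THE x. t x = k)"

lemma box_eqI:
  assumes "is_tableau lam t" "x \<in> diagram lam" "t x = k"
  shows "box t k = x"
  unfolding box_def
proof (rule the_equality)
  fix y assume y: "t y = k"
  have "t x \<noteq> 0" using tableau_pos[OF assms(1)] assms(2) by blast
  then have "y \<in> diagram lam" using tableau_pos[OF assms(1)] y assms(3) by simp
  then show "y = x"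
    using assms y bij_betw_imp_inj_on[of t "diagram lam"] by (auto simp: is_tableau_def dest: inj_onD)
qed (rule assms)

lemma box_props:
  assumes "lam \<in> multipartitions l n" "is_tableau lam t" "1 \<le> k" "k \<le> n"
  shows "box t k \<in> diagram lam" "t (box t k) = k"
proof -
  obtain x where x: "x \<in> diagram lam" "t x = k"
    using bij_betw_imp_surj_on[OF tableau_bij[OF assms(1,2)]] assms(3,4)
    by (metis atLeastAtMost_iff imageE)
  moreover have "box t k = x" using assms(2) x by (rule box_eqI)
  ultimately show "box t k \<in> diagram lam" "t (box t k) = k" by simp_all
qed

lemma box_swap: "box (adj_swap i \<circ> t) k = box t (adj_swap i k)"
proof -
  have "(adj_swap i \<circ> t) x = k \<longleftrightarrow> t x = adj_swap i k" for x
    using transpose_involutory[of i "Suc i"] by (metis comp_apply)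
  then show ?thesis by (simp add: box_def)
qed

lemma Std_nw_less:
  assumes lam: "lam \<in> multipartitions l n" and t: "t \<in> Std lam"
    and x: "x \<in> diagram lam" and y: "y \<in> diagram lam" and "nw x y" "x \<noteq> y"
  shows "t x < t y"
proof -
  obtain i j c i' j' where xy: "x = (i, j, c)" "y = (i', j', c)" "i \<le> i'" "j \<le> j'"
    using assms(5) by (cases x, cases y) auto
  have mid: "(i, j', c) \<in> diagram lam"
    using diagram_nw_closed[OF lam, of i' j' c i j' c] x y xy by (auto simp: mem_diagram)
  have "t (i, j, c) \<le> t (i, j', c)"
    using t x mid xy(1,4) by (cases "j = j'") (auto simp: Std_def intro!: less_imp_le)
  moreover have "t (i, j', c) \<le> t (i', j', c)"
    using t y mid xy(2,3) by (cases "i = i'") (auto simp: Std_def intro!: less_imp_le)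
  moreover have "t x \<noteq> t y"
    using t x y assms(6) by (auto simp: Std_def is_tableau_def dest: bij_betw_imp_inj_on inj_onD)
  ultimately show ?thesis using xy by simp
qed

lemma swap_is_tableau:
  assumes lam: "lam \<in> multipartitions l n" and t: "is_tableau lam t" and i: "1 \<le> i" "i < n"
  shows "is_tableau lam (adj_swap i \<circ> t)"
proof -
  have "bij_betw (adj_swap i) {1..n} {1..n}"
    using adj_swap_permutes[OF i] by (rule permutes_imp_bij)
  then have "bij_betw (adj_swap i \<circ> t) (diagram lam) {1..n}"
    using tableau_bij[OF lam t] by (rule bij_betw_trans[rotated])
  then show ?thesis
    using t i by (auto simp: is_tableau_def card_diagram[OF lam] transpose_def)
qed

definition row_std :: "mshape \<Rightarrow> tableau \<Rightarrow> bool" where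
  "row_std lam t \<longleftrightarrow> (\<forall>i j j' c. (i, j, c) \<in> diagram lam \<and> (i, j', c) \<in> diagram lam \<and> j < j'
     \<longrightarrow> t (i, j, c) < t (i, j', c))"

definition col_std :: "mshape \<Rightarrow> tableau \<Rightarrow> bool" where
  "col_std lam t \<longleftrightarrow> (\<forall>i i' j c. (i, j, c) \<in> diagram lam \<and> (i', j, c) \<in> diagram lam \<and> i < i'
     \<longrightarrow> t (i, j, c) < t (i', j, c))"

lemma Std_iff: "t \<in> Std lam \<longleftrightarrow> is_tableau lam t \<and> row_std lam t \<and> col_std lam t"
  by (simp add: Std_def row_std_def col_std_def)

text \<open>
  An exchange of neighbouring entries destroys the row condition only if the two entries stand
  side by side, since no third entry fits between them.
\<close>

lemma row_std_swap_fail: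
  assumes lam: "lam \<in> multipartitions l n" and t: "is_tableau lam t" "row_std lam t"
    and fail: "\<not> row_std lam (adj_swap k \<circ> t)"
  obtains i j c where "box t k = (i, j, c)" "box t (Suc k) = (i, Suc j, c)"
proof -
  obtain i j j' c where x: "(i, j, c) \<in> diagram lam" and y: "(i, j', c) \<in> diagram lam" and "j < j'"
    and nless: "\<not> adj_swap k (t (i, j, c)) < adj_swap k (t (i, j', c))"
    using fail by (auto simp: row_std_def)
  have less: "t (i, j, c) < t (i, j', c)" using t(2) x y \<open>j < j'\<close> by (auto simp: row_std_def)
  then have vals: "t (i, j, c) = k" "t (i, j', c) = Suc k"
    using nless adj_swap_less_iff[of "t (i, j, c)" "t (i, j', c)" k] by auto
  have "j' = Suc j"
  proof (rule ccontr)
    assume "j' \<noteq> Suc j"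
    then have j: "j < Suc j" "Suc j < j'" using \<open>j < j'\<close> by auto
    have "(i, Suc j, c) \<in> diagram lam" using y j by (simp add: mem_diagram)
    then have "t (i, j, c) < t (i, Suc j, c)" "t (i, Suc j, c) < t (i, j', c)"
      using t(2) x y j unfolding row_std_def by blast+
    then show False using vals by simp
  qed
  then show thesis
    using that box_eqI[OF t(1) x] box_eqI[OF t(1) y] vals by metis
qed

lemma col_std_swap_fail:
  assumes lam: "lam \<in> multipartitions l n" and t: "is_tableau lam t" "col_std lam t"
    and fail: "\<not> col_std lam (adj_swap k \<circ> t)"
  obtains i j c where "box t k = (i, j, c)" "box t (Suc k) = (Suc i, j, c)"
proof -
  obtain i i' j c where x: "(i, j, c) \<in> diagram lam" and y: "(i', j, c) \<in> diagram lam" and "i < i'"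
    and nless: "\<not> adj_swap k (t (i, j, c)) < adj_swap k (t (i', j, c))"
    using fail by (auto simp: col_std_def)
  have less: "t (i, j, c) < t (i', j, c)" using t(2) x y \<open>i < i'\<close> by (auto simp: col_std_def)
  then have vals: "t (i, j, c) = k" "t (i', j, c) = Suc k"
    using nless adj_swap_less_iff[of "t (i, j, c)" "t (i', j, c)" k] by auto
  have "i' = Suc i"
  proof (rule ccontr)
    assume "i' \<noteq> Suc i"
    then have i: "i < Suc i" "Suc i < i'" using \<open>i < i'\<close> by auto
    have "(Suc i, j, c) \<in> diagram lam"
      using diagram_nw_closed[OF lam y, of "Suc i" j c] y i by (auto simp: mem_diagram)
    then have "t (i, j, c) < t (Suc i, j, c)" "t (Suc i, j, c) < t (i', j, c)"
      using t(2) x y i unfolding col_std_def by blast+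
    then show False using vals by simp
  qed
  then show thesis
    using that box_eqI[OF t(1) x] box_eqI[OF t(1) y] vals by metis
qed

definition linked :: "node \<Rightarrow> node \<Rightarrow> bool" where
  "linked = (\<lambda>(i, j, c) (i', j', c'). c = c' \<and> (i = i' \<or> j = j'))"

lemma linked_simp [simp]:
  "linked (i, j, c) (i', j', c') \<longleftrightarrow> c = c' \<and> (i = i' \<or> j = j')"
  by (simp add: linked_def)

lemma linked_less:
  assumes "lam \<in> multipartitions l n" "t \<in> Std lam" "u \<in> Std lam" "x \<in> diagram lam" "y \<in> diagram lam"
    "linked x y" "t x < t y"
  shows "u x < u y"
proof -
  have ne: "x \<noteq> y" using assms(7) by auto
  have "nw x y \<or> nw y x" using assms(6) by (cases x, cases y) auto
  moreover have "\<not> nw y x" using Std_nw_less[OF assms(1,2,5,4)] ne assms(7) by force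
  ultimately show ?thesis using Std_nw_less[OF assms(1,3,4,5)] ne by blast
qed

lemma swap_Std_iff:
  assumes lam: "lam \<in> multipartitions l n" and t: "t \<in> Std lam" and k: "1 \<le> k" "k < n"
  shows "adj_swap k \<circ> t \<in> Std lam \<longleftrightarrow> \<not> linked (box t k) (box t (Suc k))"
proof
  have tab: "is_tableau lam t" using t by (rule Std_is_tableau)
  have bx: "box t k \<in> diagram lam" "t (box t k) = k"
      "box t (Suc k) \<in> diagram lam" "t (box t (Suc k)) = Suc k"
    using box_props[OF lam tab] k by auto
  show "\<not> linked (box t k) (box t (Suc k))" if "adj_swap k \<circ> t \<in> Std lam"
    using linked_less[OF lam t that bx(1,3)] bx(2,4) by (auto simp: adj_swap_simps)
  assume nl: "\<not> linked (box t k) (box t (Suc k))"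
  have "row_std lam (adj_swap k \<circ> t)"
    using row_std_swap_fail[OF lam tab] t nl by (metis Std_iff linked_simp)
  moreover have "col_std lam (adj_swap k \<circ> t)"
    using col_std_swap_fail[OF lam tab] t nl by (metis Std_iff linked_simp)
  ultimately show "adj_swap k \<circ> t \<in> Std lam"
    using swap_is_tableau[OF lam tab k] by (simp add: Std_iff)
qed

text \<open>
  If both swaps together give a standard tableau, so does each of them: the second swap moves
  neither of the entries whose order would be wrong.
\<close>

lemma swap_far_Std_iff:
  assumes lam: "lam \<in> multipartitions l n" and t: "t \<in> Std lam"
    and ij: "1 \<le> i" "Suc i < j" "j < n"
  shows "adj_swap i \<circ> (adj_swap j \<circ> t) \<in> Std lam \<longleftrightarrow> adj_swap i \<circ> t \<in> Std lam \<and> adj_swap j \<circ> t \<in> Std lam"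
proof (cases "adj_swap j \<circ> t \<in> Std lam")
  case True
  then show ?thesis
    using swap_Std_iff[OF lam True, of i] swap_Std_iff[OF lam t, of i] ij
    by (simp add: box_swap adj_swap_simps)
next
  case False
  have bx: "box t j \<in> diagram lam" "t (box t j) = j"
      "box t (Suc j) \<in> diagram lam" "t (box t (Suc j)) = Suc j"
    using box_props[OF lam Std_is_tableau[OF t]] ij by auto
  have "linked (box t j) (box t (Suc j))"
    using swap_Std_iff[OF lam t, of j] False ij by auto
  moreover have "(adj_swap i \<circ> (adj_swap j \<circ> t)) (box t j) = Suc j"
      "(adj_swap i \<circ> (adj_swap j \<circ> t)) (box t (Suc j)) = j"
    using bx(2,4) ij by (simp_all add: adj_swap_simps)
  ultimately have "adj_swap i \<circ> (adj_swap j \<circ> t) \<notin> Std lam"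
    using linked_less[OF lam t _ bx(1,3)] bx(2,4) by (metis lessI not_less_iff_gr_or_eq)
  then show ?thesis using False by simp
qed

subsection \<open>The initial tableau\<close>

definition component_start :: "mshape \<Rightarrow> nat \<Rightarrow> nat" where
  "component_start lam c = (\<Sum>c'=1..<c. psize (lam c'))"

lemma initial_tableau_apply:
  "(i, j, c) \<in> diagram lam \<Longrightarrow>
    initial_tableau lam (i, j, c) = component_start lam c + (\<Sum>i'=1..<i. lam c i') + j"
  by (simp add: initial_tableau_def component_start_def)

lemma initial_tableau_outside: "x \<notin> diagram lam \<Longrightarrow> initial_tableau lam x = 0"
  by (cases x) (simp add: initial_tableau_def)

lemma row_sum_le_psize:
  assumes "is_partition p"
  shows "(\<Sum>i=1..<m. p i) \<le> psize p"
proof -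
  have "(\<Sum>i=1..<m. p i) = (\<Sum>i\<in>{1..<m} \<inter> {i. p i \<noteq> 0}. p i)"
    by (rule sum.mono_neutral_right) auto
  also have "\<dots> \<le> psize p"
    unfolding psize_def using psize_finite_support[OF assms] by (intro sum_mono2) auto
  finally show ?thesis .
qed

lemma component_start_mono: "c \<le> d \<Longrightarrow> component_start lam c \<le> component_start lam d"
  unfolding component_start_def by (rule sum_mono2) auto

lemma initial_tableau_range:
  assumes lam: "lam \<in> multipartitions l n" and x: "(i, j, c) \<in> diagram lam"
  shows "component_start lam c < initial_tableau lam (i, j, c)"
    and "initial_tableau lam (i, j, c) \<le> component_start lam (Suc c)"
proof -
  show "component_start lam c < initial_tableau lam (i, j, c)"
    using x by (simp add: initial_tableau_apply mem_diagram)
  have "(\<Sum>i'=1..<i. lam c i') + j \<le> (\<Sum>i'=1..<Suc i. lam c i')"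
    using x by (simp add: mem_diagram)
  also have "\<dots> \<le> psize (lam c)" by (rule row_sum_le_psize[OF multipartition_row[OF lam]])
  finally show "initial_tableau lam (i, j, c) \<le> component_start lam (Suc c)"
    using x by (simp add: initial_tableau_apply component_start_def mem_diagram)
qed

lemma initial_tableau_less:
  assumes lam: "lam \<in> multipartitions l n" and x: "x \<in> diagram lam" and y: "y \<in> diagram lam"
    and "reads_before x y"
  shows "initial_tableau lam x < initial_tableau lam y"
proof -
  obtain i j c i' j' c' where xy: "x = (i, j, c)" "y = (i', j', c')" by (cases x, cases y) auto
  consider "c < c'" | "c = c'" "i < i'" | "c = c'" "i = i'" "j < j'"
    using assms(4) xy by auto
  then show ?thesis
  proof cases
    case 1
    then have "component_start lam (Suc c) \<le> component_start lam c'"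
      by (intro component_start_mono) simp
    then show ?thesis
      using initial_tableau_range[OF lam, of i j c] initial_tableau_range[OF lam, of i' j' c'] x y xy
      by simp
  next
    case 2
    have "(\<Sum>i'=1..<i. lam c i') + j \<le> (\<Sum>i'=1..<Suc i. lam c i')"
      using x xy by (simp add: mem_diagram)
    also have "\<dots> \<le> (\<Sum>i'=1..<i'. lam c i')"
      using 2 by (intro sum_mono2) auto
    also have "\<dots> < (\<Sum>i'=1..<i'. lam c i') + j'" using y xy by (simp add: mem_diagram)
    finally show ?thesis using x y xy 2 by (simp add: initial_tableau_apply)
  next
    case 3
    then show ?thesis using x y xy by (simp add: initial_tableau_apply)
  qed
qed

lemma initial_tableau_less_iff:
  assumes "lam \<in> multipartitions l n" "x \<in> diagram lam" "y \<in> diagram lam"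
  shows "initial_tableau lam x < initial_tableau lam y \<longleftrightarrow> reads_before x y"
  using initial_tableau_less[OF assms(1,2,3)] initial_tableau_less[OF assms(1,3,2)]
    reads_before_total[of x y] by (cases "x = y") (auto dest: reads_before_asym)

text \<open>
  Strict monotonicity in the reading order makes the initial tableau injective, and its values
  do not exceed the number of nodes.
\<close>

lemma initial_is_tableau:
  assumes lam: "lam \<in> multipartitions l n"
  shows "is_tableau lam (initial_tableau lam)"
proof -
  have inj: "inj_on (initial_tableau lam) (diagram lam)"
    using initial_tableau_less[OF lam] reads_before_total by (metis (no_types) inj_onI less_irrefl)
  have "initial_tableau lam ` diagram lam \<subseteq> {1..n}"
  proof (clarsimp)
    fix i j c assume x: "(i, j, c) \<in> diagram lam"
    have "component_start lam (Suc c) \<le> component_start lam (Suc l)"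
      using multipartition_component[OF lam x] by (intro component_start_mono) simp
    also have "\<dots> = n"
      using lam by (simp add: component_start_def multipartitions_def atLeastLessThanSuc_atLeastAtMost)
    finally show "Suc 0 \<le> initial_tableau lam (i, j, c) \<and> initial_tableau lam (i, j, c) \<le> n"
      using initial_tableau_range[OF lam x] by simp
  qed
  then have "initial_tableau lam ` diagram lam = {1..n}"
    using card_image[OF inj] card_diagram[OF lam] by (intro card_subset_eq) auto
  then show ?thesis
    using inj by (simp add: is_tableau_def bij_betw_def card_diagram[OF lam] initial_tableau_outside)
qed

lemma initial_Std:
  assumes lam: "lam \<in> multipartitions l n"
  shows "initial_tableau lam \<in> Std lam"
  unfolding Std_def mem_Collect_eq using initial_is_tableau[OF lam] initial_tableau_less[OF lam] by simp

section \<open>Residues\<close>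

definition node_res :: "'a::field \<Rightarrow> (nat \<Rightarrow> 'a) \<Rightarrow> node \<Rightarrow> 'a" where
  "node_res q Q = (\<lambda>(i, j, c). q powi (int j - int i) * Q c)"

lemma node_res_simp [simp]: "node_res q Q (i, j, c) = q powi (int j - int i) * Q c"
  by (simp add: node_res_def)

lemma residue_eq_node_res: "residue q Q t k = node_res q Q (box t k)"
  by (simp add: residue_def box_def node_res_def)

lemma residue_swap: "residue q Q (adj_swap i \<circ> t) k = residue q Q t (adj_swap i k)"
  by (simp add: residue_eq_node_res box_swap)

text \<open>
  The conditions on the parameters which for \<open>q \<noteq> 1\<close> are equivalent to semisimplicity,
  together with the nonvanishing of the parameters themselves.
\<close>

definition separated :: "nat \<Rightarrow> nat \<Rightarrow> 'a::field \<Rightarrow> (nat \<Rightarrow> 'a) \<Rightarrow> bool" where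
  "separated l n q Q \<longleftrightarrow> q \<noteq> 0 \<and> (\<forall>k\<in>{1..n}. q ^ k \<noteq> 1) \<and>
     (\<forall>c d e. 1 \<le> c \<and> c < d \<and> d \<le> l \<and> \<bar>e\<bar> < int n \<longrightarrow> q powi e * Q c \<noteq> Q d) \<and>
     (2 \<le> n \<longrightarrow> (\<forall>c\<in>{1..l}. Q c \<noteq> 0))"

lemma separated_mono: "separated l n q Q \<Longrightarrow> m \<le> n \<Longrightarrow> separated l m q Q"
  by (auto simp: separated_def)

lemma separated_powi:
  assumes "separated l n q Q" "m \<noteq> 0" "\<bar>m\<bar> \<le> int n"
  shows "q powi m \<noteq> 1"
proof -
  have "nat \<bar>m\<bar> \<in> {1..n}" using assms(2,3) by auto
  then have "q ^ nat \<bar>m\<bar> \<noteq> 1" using assms(1) unfolding separated_def by blast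
  then show ?thesis
    using inverse_eq_1_iff[of "q ^ nat \<bar>m\<bar>"]
    by (cases "0 \<le> m") (auto simp: power_int_def power_inverse)
qed

lemma powi_cancel:
  fixes q :: "'a::field"
  assumes "q \<noteq> 0" "q powi a * x = q powi e * (q powi b * y)"
  shows "q powi (a - b - e) * x = y"
proof -
  have "q powi (a - b - e) * x = q powi (- b - e) * (q powi a * x)"
    using assms(1) by (simp add: mult.assoc[symmetric] power_int_add[symmetric])
      (simp add: algebra_simps)
  also have "\<dots> = q powi (- b - e) * (q powi e * (q powi b * y))" by (simp only: assms(2))
  also have "\<dots> = q powi ((- b - e) + e + b) * y"
    using assms(1) by (simp only: power_int_add mult.assoc simp_thms)
  finally show ?thesis by simp
qed

text \<open>
  Two incomparable nodes whose northwest parts lie in a set of fewer than \<open>n\<close> nodes have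
  different residues: the arms of the two nodes bound the difference of their contents.  If
  there is one node less, the residues do not even differ by a factor \<open>q\<close>.
\<close>

lemma node_res_incomparable:
  assumes sep: "separated l n q Q"
    and pos: "1 \<le> i" "1 \<le> j" "1 \<le> i'" "1 \<le> j'" and comp: "c \<in> {1..l}" "c' \<in> {1..l}"
    and D: "finite D"
    and a: "\<And>p r. 1 \<le> p \<Longrightarrow> p \<le> i \<Longrightarrow> 1 \<le> r \<Longrightarrow> r \<le> j \<Longrightarrow> (p, r) \<noteq> (i, j) \<Longrightarrow> (p, r, c) \<in> D"
    and b: "\<And>p r. 1 \<le> p \<Longrightarrow> p \<le> i' \<Longrightarrow> 1 \<le> r \<Longrightarrow> r \<le> j' \<Longrightarrow> (p, r) \<noteq> (i', j') \<Longrightarrow> (p, r, c') \<in> D"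
    and incomp: "\<not> nw (i, j, c) (i', j', c')" "\<not> nw (i', j', c') (i, j, c)"
    and e: "\<bar>e\<bar> \<le> 1" "\<bar>e\<bar> + int (card D) < int n"
  shows "node_res q Q (i, j, c) \<noteq> q powi e * node_res q Q (i', j', c')"
proof
  assume eq: "node_res q Q (i, j, c) = q powi e * node_res q Q (i', j', c')"
  have q: "q \<noteq> 0" using sep by (simp add: separated_def)
  let ?m = "(int j - int i) - (int j' - int i') - e"
  have eq1: "q powi ?m * Q c = Q c'"
    using eq by (intro powi_cancel[OF q]) simp
  have row_a: "(i, r, c) \<in> D" if "1 \<le> r" "r \<le> j - 1" for r using a[of i r] pos that by auto
  have col_a: "(r, j, c) \<in> D" if "1 \<le> r" "r \<le> i - 1" for r using a[of r j] pos that by auto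
  have row_b: "(i', r, c') \<in> D" if "1 \<le> r" "r \<le> j' - 1" for r using b[of i' r] pos that by auto
  have col_b: "(r, j', c') \<in> D" if "1 \<le> r" "r \<le> i' - 1" for r using b[of r j'] pos that by auto
  show False
  proof (cases "c = c'")
    case False
    have "j - 1 + (i' - 1) \<le> card D" "j' - 1 + (i - 1) \<le> card D"
      using segments_card[OF D row_a col_b] segments_card[OF D row_b col_a] False by auto
    then have m: "\<bar>?m\<bar> < int n" using pos e(2) by linarith
    show False
    proof (cases "c < c'")
      case True
      then show False using sep eq1 m comp unfolding separated_def by auto
    next
      case False
      have "q powi (- ?m) * Q c' = Q c"
        using q unfolding eq1[symmetric] by (simp add: power_int_minus del: minus_diff_eq)
      moreover have "c' < c" using False \<open>c \<noteq> c'\<close> by simp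
      moreover have "\<bar>- ?m\<bar> < int n" using m by linarith
      ultimately show False using sep comp unfolding separated_def by (metis atLeastAtMost_iff)
    qed
  next
    case True
    have arms: "j - 1 + (i' - 1) \<le> Suc (card D)" "j' - 1 + (i - 1) \<le> Suc (card D)"
      using segments_card[OF D row_a col_b] segments_card[OF D row_b col_a] True by auto
    have cross: "(i < i' \<and> j' < j) \<or> (i' < i \<and> j < j')"
      using incomp True by auto
    then have m: "?m \<noteq> 0" "\<bar>?m\<bar> \<le> int n" using arms pos e by linarith+
    have "D \<noteq> {}" using cross row_a[of 1] row_b[of 1] pos by force
    then have "card D \<noteq> 0" using D by simp
    then have "2 \<le> n" using e(2) by linarith
    then have "Q c \<noteq> 0" using sep comp by (auto simp: separated_def)
    then have "q powi ?m = 1" using eq1 True by simp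
    then show False using separated_powi[OF sep m] by simp
  qed
qed

text \<open>
  Two nodes of one component have contents which differ by less than \<open>n\<close>, so their residues
  agree only on a common diagonal.
\<close>

lemma node_res_same_component:
  assumes sep: "separated l n q Q" and lam: "lam \<in> multipartitions l n"
    and a: "(i, j, c) \<in> diagram lam" and b: "(i', j', c) \<in> diagram lam" and n: "2 \<le> n"
    and eq: "node_res q Q (i, j, c) = node_res q Q (i', j', c)"
  shows "int j - int i = int j' - int i'"
proof (rule ccontr)
  assume ne: "int j - int i \<noteq> int j' - int i'"
  have q: "q \<noteq> 0" using sep by (simp add: separated_def)
  let ?m = "(int j - int i) - (int j' - int i') - 0"
  have "q powi ?m * Q c = Q c" using eq by (intro powi_cancel[OF q]) simp
  moreover have "Q c \<noteq> 0"
    using sep n multipartition_component[OF lam a] by (auto simp: separated_def)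
  ultimately have "q powi ?m = 1" by simp
  moreover have "\<bar>?m\<bar> \<le> int n"
    using diagram_hook[OF lam a b] diagram_hook[OF lam b a] a b by (auto simp: mem_diagram)
  ultimately show False using separated_powi[OF sep, of ?m] ne by simp
qed

locale separated_shape =
  fixes l n :: nat and q :: "'a::field" and Q :: "nat \<Rightarrow> 'a" and lam :: mshape
  assumes sep: "separated l n q Q" and lam: "lam \<in> multipartitions l n"
begin

lemma q_nonzero: "q \<noteq> 0" using sep by (simp add: separated_def)

lemma Std_box:
  assumes "t \<in> Std lam" "1 \<le> k" "k \<le> n"
  shows "box t k \<in> diagram lam" "t (box t k) = k"
  using box_props[OF lam Std_is_tableau[OF assms(1)] assms(2,3)] .

lemma Std_box_entry: "t \<in> Std lam \<Longrightarrow> x \<in> diagram lam \<Longrightarrow> box t (t x) = x"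
  by (rule box_eqI[OF Std_is_tableau]) auto

lemma Std_entry_range:
  assumes "t \<in> Std lam" "x \<in> diagram lam"
  shows "1 \<le> t x" "t x \<le> n"
  using bij_betwE[OF tableau_bij[OF lam Std_is_tableau[OF assms(1)]]] assms(2) by auto

text \<open>Entries on one diagonal differ by at least three.\<close>

lemma residue_close_ne:
  assumes t: "t \<in> Std lam" and k: "1 \<le> k" "k < m" "m \<le> k + 2" "m \<le> n"
  shows "residue q Q t k \<noteq> residue q Q t m"
proof
  assume eq: "residue q Q t k = residue q Q t m"
  obtain i j c where a: "box t k = (i, j, c)" by (cases "box t k")
  obtain i' j' c' where b: "box t m = (i', j', c')" by (cases "box t m")
  have ad: "(i, j, c) \<in> diagram lam" "t (i, j, c) = k"
    using Std_box[OF t, of k] k a by auto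
  have bd: "(i', j', c') \<in> diagram lam" "t (i', j', c') = m"
    using Std_box[OF t, of m] k b by auto
  have eq': "node_res q Q (i, j, c) = node_res q Q (i', j', c')"
    using eq by (simp add: residue_eq_node_res a b)
  have n: "2 \<le> n" using k by simp
  show False
  proof (cases "c = c'")
    case False
    let ?D = "diagram lam - {(i, j, c), (i', j', c')}"
    have "card ?D = n - 2"
      using ad(1) bd(1) False finite_diagram[OF lam] by (simp add: card_diagram[OF lam] card_Diff_subset)
    then have "node_res q Q (i, j, c) \<noteq> q powi 0 * node_res q Q (i', j', c')"
      using ad(1) bd(1) n False finite_diagram[OF lam] multipartition_component[OF lam]
        diagram_nw_closed[OF lam ad(1)] diagram_nw_closed[OF lam bd(1)]
      by (intro node_res_incomparable[OF sep, where D = ?D]) (auto simp: mem_diagram)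
    then show False using eq' by simp
  next
    case True
    have content: "int j - int i = int j' - int i'"
      using node_res_same_component[OF sep lam ad(1) _ n eq'[folded True]] bd(1) True by simp
    have ne: "(i, j, c) \<noteq> (i', j', c')" using ad(2) bd(2) k by auto
    have "\<not> nw (i', j', c') (i, j, c)"
      using Std_nw_less[OF lam t bd(1) ad(1)] ad(2) bd(2) k ne by auto
    then have less: "i < i'" "j < j'" using content True by auto
    let ?x = "(i, Suc j, c)" and ?y = "(Suc i, j, c)" and ?z = "(Suc i, Suc j, c)"
    have z: "?z \<in> diagram lam" and x: "?x \<in> diagram lam" and y: "?y \<in> diagram lam"
      using diagram_nw_closed[OF lam bd(1)] less True ad(1) by (auto simp: mem_diagram)
    have "k < t ?x" "k < t ?y" "t ?x < t ?z" "t ?y < t ?z"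
      using Std_nw_less[OF lam t ad(1) x] Std_nw_less[OF lam t ad(1) y]
        Std_nw_less[OF lam t x z] Std_nw_less[OF lam t y z] ad(2) by auto
    moreover have "t ?z \<le> m"
      using Std_nw_less[OF lam t z bd(1)] bd(2) less True by (cases "?z = (i', j', c')") auto
    moreover have "t ?x \<noteq> t ?y"
      using Std_box_entry[OF t x] Std_box_entry[OF t y] by auto
    ultimately show False using k(3) by linarith
  qed
qed

text \<open>
  The nodes of an inversion are incomparable, and every other node northwest of one of them
  is one of the remaining \<open>n - 2\<close> nodes.
\<close>

lemma node_res_inversion:
  assumes t: "t \<in> Std lam" and inv: "(a, b) \<in> inversions (diagram lam) reads_before t" and e: "\<bar>e\<bar> \<le> 1"
  shows "node_res q Q b \<noteq> q powi e * node_res q Q a"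
proof -
  obtain i j c where a: "a = (i, j, c)" by (cases a)
  obtain i' j' c' where b: "b = (i', j', c')" by (cases b)
  have ad: "(i, j, c) \<in> diagram lam" and bd: "(i', j', c') \<in> diagram lam"
    and less: "t (i', j', c') < t (i, j, c)" and rb: "reads_before (i, j, c) (i', j', c')"
    using inv by (auto simp: inversions_def a b)
  have ne: "(i, j, c) \<noteq> (i', j', c')" using less by auto
  have incomp: "\<not> nw (i, j, c) (i', j', c')" "\<not> nw (i', j', c') (i, j, c)"
    using Std_nw_less[OF lam t ad bd] less ne rb by auto
  let ?D = "diagram lam - {(i, j, c), (i', j', c')}"
  have "card ?D = n - 2" and "2 \<le> n"
    using ad bd ne finite_diagram[OF lam] card_mono[of "diagram lam" "{(i, j, c), (i', j', c')}"]
    by (auto simp: card_diagram[OF lam] card_Diff_subset)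
  then show ?thesis
    unfolding a b
    using ad bd e incomp finite_diagram[OF lam] multipartition_component[OF lam]
      diagram_nw_closed[OF lam ad] diagram_nw_closed[OF lam bd]
    by (intro node_res_incomparable[OF sep, where D = ?D]) (auto simp: mem_diagram)
qed

lemma residue_one:
  assumes t: "t \<in> Std lam" and "1 \<le> n"
  obtains c where "c \<in> {1..l}" "residue q Q t 1 = Q c"
proof -
  obtain i j c where a: "box t 1 = (i, j, c)" by (cases "box t 1")
  have ad: "(i, j, c) \<in> diagram lam" "t (i, j, c) = 1"
    using Std_box[OF t, of 1] \<open>1 \<le> n\<close> a by auto
  have corner: "(1, 1, c) \<in> diagram lam"
    using diagram_nw_closed[OF lam ad(1), of 1 1 c] ad(1) by (auto simp: mem_diagram)
  have "(i, j, c) = (1, 1, c)"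
    using Std_nw_less[OF lam t corner ad(1)] Std_entry_range(1)[OF t corner] ad
    by (auto simp: mem_diagram)
  then show thesis
    using that[of c] multipartition_component[OF lam ad(1)] a by (simp add: residue_eq_node_res)
qed

lemma residue_row_neighbour:
  "box t k = (i, j, c) \<Longrightarrow> box t (Suc k) = (i, Suc j, c) \<Longrightarrow> residue q Q t (Suc k) = q * residue q Q t k"
  using q_nonzero power_int_add_1'[of q "int j - int i"]
  by (simp add: residue_eq_node_res algebra_simps)

lemma residue_col_neighbour:
  "box t k = (i, j, c) \<Longrightarrow> box t (Suc k) = (Suc i, j, c) \<Longrightarrow> residue q Q t k = q * residue q Q t (Suc k)"
  using q_nonzero power_int_add_1'[of q "int j - int (Suc i)"]
  by (simp add: residue_eq_node_res algebra_simps)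

lemma residue_swap_not_Std:
  assumes t: "t \<in> Std lam" and k: "1 \<le> k" "k < n" and "adj_swap k \<circ> t \<notin> Std lam"
  shows "residue q Q t (Suc k) = q * residue q Q t k \<or> residue q Q t k = q * residue q Q t (Suc k)"
proof -
  have tab: "is_tableau lam t" using t by (rule Std_is_tableau)
  have "\<not> row_std lam (adj_swap k \<circ> t) \<or> \<not> col_std lam (adj_swap k \<circ> t)"
    using assms(4) swap_is_tableau[OF lam tab k] by (auto simp: Std_iff)
  then show ?thesis
    using row_std_swap_fail[OF lam tab] col_std_swap_fail[OF lam tab] t
      residue_row_neighbour residue_col_neighbour by (metis Std_iff)
qed

text \<open>
  If entries of two standard tableaux agree below \<open>k\<close>, then the possible places of \<open>k\<close> are
  incomparable and so are told apart by their residues.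
\<close>

lemma box_determined_by_residue:
  assumes mu: "mu \<in> multipartitions l n" and t: "t \<in> Std lam" and u: "u \<in> Std mu"
    and k: "1 \<le> k" "k \<le> n" and agree: "\<And>m. 1 \<le> m \<Longrightarrow> m < k \<Longrightarrow> box t m = box u m"
    and res: "residue q Q t k = residue q Q u k"
  shows "box t k = box u k"
proof (rule ccontr)
  interpret mu: separated_shape l n q Q mu using sep mu by unfold_locales
  assume ne: "box t k \<noteq> box u k"
  obtain i j c where a: "box t k = (i, j, c)" by (cases "box t k")
  obtain i' j' c' where b: "box u k = (i', j', c')" by (cases "box u k")
  have ad: "(i, j, c) \<in> diagram lam" "t (i, j, c) = k"
    using Std_box[OF t k] a by auto
  have bd: "(i', j', c') \<in> diagram mu" "u (i', j', c') = k"
    using mu.Std_box[OF u k] b by auto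
  let ?D = "box t ` {1..<k}"
  have D_t: "x \<in> ?D" if "x \<in> diagram lam" "t x < k" for x
    using Std_box_entry[OF t that(1)] Std_entry_range(1)[OF t that(1)] that(2)
    by (intro image_eqI[of _ _ "t x"]) auto
  have D_u: "x \<in> ?D" if "x \<in> diagram mu" "u x < k" for x
    using mu.Std_box_entry[OF u that(1)] mu.Std_entry_range(1)[OF u that(1)] that(2) agree[of "u x"]
    by (intro image_eqI[of _ _ "u x"]) auto
  have t_D: "t x < k" if "x \<in> ?D" for x using that Std_box(2)[OF t] k by auto
  have u_D: "u x < k" if "x \<in> ?D" for x using that agree mu.Std_box(2)[OF u] k by auto
  have nw_a: "(p, r, c) \<in> ?D" if "1 \<le> p" "p \<le> i" "1 \<le> r" "r \<le> j" "(p, r) \<noteq> (i, j)" for p r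
  proof -
    have "(p, r, c) \<in> diagram lam" using diagram_nw_closed[OF lam ad(1)] that by auto
    then show ?thesis using Std_nw_less[OF lam t _ ad(1)] ad(2) that by (intro D_t) auto
  qed
  have nw_b: "(p, r, c') \<in> ?D" if "1 \<le> p" "p \<le> i'" "1 \<le> r" "r \<le> j'" "(p, r) \<noteq> (i', j')" for p r
  proof -
    have "(p, r, c') \<in> diagram mu" using diagram_nw_closed[OF mu bd(1)] that by auto
    then show ?thesis using Std_nw_less[OF mu u _ bd(1)] bd(2) that by (intro D_u) auto
  qed
  have incomp: "\<not> nw (i, j, c) (i', j', c')" "\<not> nw (i', j', c') (i, j, c)"
    using nw_b[of i j] nw_a[of i' j'] t_D[of "(i, j, c)"] u_D[of "(i', j', c')"] ne ad bd
    by (auto simp: a b mem_diagram)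
  have "card ?D \<le> k - 1" using card_image_le[of "{1..<k}" "box t"] by simp
  then have "node_res q Q (i, j, c) \<noteq> q powi 0 * node_res q Q (i', j', c')"
    using ad bd k incomp nw_a nw_b multipartition_component[OF lam ad(1)]
      multipartition_component[OF mu bd(1)]
    by (intro node_res_incomparable[OF sep, where D = ?D]) (auto simp: mem_diagram)
  then show False using res by (simp add: residue_eq_node_res a b)
qed

lemma Std_eq_of_boxes:
  assumes mu: "mu \<in> multipartitions l n" and t: "t \<in> Std lam" and u: "u \<in> Std mu"
    and boxes: "\<And>k. 1 \<le> k \<Longrightarrow> k \<le> n \<Longrightarrow> box t k = box u k"
  shows "t = u"
proof
  interpret mu: separated_shape l n q Q mu using sep mu by unfold_locales
  fix x
  consider "x \<in> diagram lam" | "x \<in> diagram mu" | "x \<notin> diagram lam" "x \<notin> diagram mu" by blast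
  then show "t x = u x"
  proof cases
    case 1
    then have k: "1 \<le> t x" "t x \<le> n" using Std_entry_range[OF t] by auto
    then show ?thesis using boxes[OF k] mu.Std_box(2)[OF u k] Std_box_entry[OF t 1] by simp
  next
    case 2
    then have k: "1 \<le> u x" "u x \<le> n" using mu.Std_entry_range[OF u] by auto
    then show ?thesis using boxes[OF k] Std_box(2)[OF t k] mu.Std_box_entry[OF u 2] by simp
  next
    case 3
    then show ?thesis using tableau_outside[OF Std_is_tableau[OF t]] tableau_outside[OF Std_is_tableau[OF u]]
      by simp
  qed
qed

lemma Std_eq_of_residues:
  assumes mu: "mu \<in> multipartitions l n" and t: "t \<in> Std lam" and u: "u \<in> Std mu"
    and res: "\<And>k. 1 \<le> k \<Longrightarrow> k \<le> n \<Longrightarrow> residue q Q t k = residue q Q u k"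
  shows "t = u"
proof (rule Std_eq_of_boxes[OF mu t u])
  fix k :: nat assume "1 \<le> k" "k \<le> n"
  then show "box t k = box u k"
  proof (induction k rule: less_induct)
    case (less k)
    have "box t m = box u m" if "1 \<le> m" "m < k" for m
      using less.IH[OF that(2,1)] that less.prems by linarith
    then show ?case
      using box_determined_by_residue[OF mu t u less.prems] res[OF less.prems] by blast
  qed
qed

end

section \<open>Seminormal representations\<close>

definition diag_coeff :: "'a::field \<Rightarrow> 'a \<Rightarrow> 'a \<Rightarrow> 'a" where
  "diag_coeff q x y = (q - 1) * y / (y - x)"

definition off_coeff :: "'a::field \<Rightarrow> 'a \<Rightarrow> 'a \<Rightarrow> 'a" where
  "off_coeff q x y = (y - q * x) / (y - x)"

text \<open>
  Young's seminormal form on the functions on standard tableaux, normalised such that the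
  off-diagonal coefficient is a Demazure--Lusztig coefficient: it is given by one rational
  function, whichever of the two tableaux dominates the other.
\<close>

definition seminormal_gen ::
    "'a::field \<Rightarrow> (nat \<Rightarrow> 'a) \<Rightarrow> tableau set \<Rightarrow> nat \<Rightarrow> (tableau \<Rightarrow> 'a) \<Rightarrow> tableau \<Rightarrow> 'a" where
  "seminormal_gen q Q S i \<phi> t =
     (if t \<notin> S then 0
      else if i = 0 then residue q Q t 1 * \<phi> t
      else diag_coeff q (residue q Q t i) (residue q Q t (Suc i)) * \<phi> t +
           off_coeff q (residue q Q t i) (residue q Q t (Suc i)) * \<phi> (adj_swap i \<circ> t))"

lemma linear_seminormal_gen: "linear_op (seminormal_gen q Q S i)"
  by (auto simp: linear_op_def seminormal_gen_def fun_eq_iff algebra_simps)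

lemma seminormal_gen_supp: "seminormal_gen q Q S i \<phi> \<in> supp_in S"
  by (simp add: supp_in_def seminormal_gen_def)

abbreviation seminormal_act ::
    "'a::field \<Rightarrow> (nat \<Rightarrow> 'a) \<Rightarrow> tableau set \<Rightarrow> 'a free_alg \<Rightarrow> (tableau \<Rightarrow> 'a) \<Rightarrow> tableau \<Rightarrow> 'a" where
  "seminormal_act q Q S \<equiv> free_act (seminormal_gen q Q S)"

lemma seminormal_act_mult:
  "seminormal_act q Q S (x * y) \<phi> = seminormal_act q Q S x (seminormal_act q Q S y \<phi>)"
  by (rule free_act_mult[OF linear_seminormal_gen])

lemma seminormal_word_supp: "\<phi> \<in> supp_in S \<Longrightarrow> foldr (seminormal_gen q Q S) w \<phi> \<in> supp_in S"
  by (induction w) (auto intro: seminormal_gen_supp)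

lemma diag_coeff_row: "x \<noteq> 0 \<Longrightarrow> q \<noteq> 1 \<Longrightarrow> diag_coeff q x (q * x) = q"
  by (simp add: diag_coeff_def left_diff_distrib[symmetric, where b = 1, simplified])
    (simp add: field_simps)

lemma diag_coeff_col: "y \<noteq> 0 \<Longrightarrow> q \<noteq> 1 \<Longrightarrow> diag_coeff q (q * y) y = -1"
proof -
  assume "y \<noteq> 0" "q \<noteq> 1"
  then have "y - q * y \<noteq> 0" by simp
  then show ?thesis by (simp add: diag_coeff_def divide_eq_eq algebra_simps)
qed

text \<open>
  Apart from the braid relation, everything that happens on the span of \<open>t\<close> and its swap comes
  down to these identities for the two residues \<open>x\<close> and \<open>y\<close>.
\<close>

lemma coeff_conjugate:
  assumes "x \<noteq> y"
  shows "diag_coeff q x y * x * diag_coeff q x y + off_coeff q x y * y * off_coeff q y x = q * y"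
proof -
  define d where "d = y - x"
  have "y = x + d" "d \<noteq> 0" using assms by (simp_all add: d_def)
  then show ?thesis
    unfolding diag_coeff_def off_coeff_def by (simp add: divide_simps) (simp add: algebra_simps)
qed

lemma coeff_conjugate_off:
  assumes "x \<noteq> y"
  shows "diag_coeff q x y * x + y * diag_coeff q y x = 0"
proof -
  define d where "d = y - x"
  have "y = x + d" "d \<noteq> 0" using assms by (simp_all add: d_def)
  then show ?thesis
    unfolding diag_coeff_def by (simp add: divide_simps)
qed

lemma coeff_quadratic:
  assumes "x \<noteq> y"
  shows "diag_coeff q x y * diag_coeff q x y + off_coeff q x y * off_coeff q y x
      = (q - 1) * diag_coeff q x y + q"
proof -
  define d where "d = y - x"
  have "y = x + d" "d \<noteq> 0" using assms by (simp_all add: d_def)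
  then show ?thesis
    unfolding diag_coeff_def off_coeff_def by (simp add: divide_simps) (simp add: algebra_simps)
qed

lemma coeff_trace:
  assumes "x \<noteq> y"
  shows "diag_coeff q x y + diag_coeff q y x = q - 1"
proof -
  define d where "d = y - x"
  have "y = x + d" "d \<noteq> 0" using assms by (simp_all add: d_def)
  then show ?thesis
    unfolding diag_coeff_def by (simp add: divide_simps) (simp add: algebra_simps)
qed

text \<open>
  The next three identities compare the coefficients of the two sides of the braid relation at
  the fillings which differ from the given one by at most one adjacent swap; at the remaining
  three fillings the coefficients agree factor by factor.
\<close>

lemma coeff_braid:
  assumes "x \<noteq> y" "y \<noteq> z" "x \<noteq> z"
  shows "diag_coeff q x y * diag_coeff q y z + diag_coeff q x z * diag_coeff q y x
      = diag_coeff q y z * diag_coeff q x z"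
proof -
  define d e f where "d = y - x" and "e = z - y" and "f = z - x"
  have diffs: "x - y = - d" "y - x = d" "z - y = e" "z - x = f"
    by (simp_all add: d_def e_def f_def)
  have "d \<noteq> 0" "e \<noteq> 0" "f \<noteq> 0"
    using assms by (simp_all add: d_def e_def f_def)
  then show ?thesis
    unfolding diag_coeff_def diffs
    by (simp add: divide_simps) (simp add: d_def e_def f_def algebra_simps)
qed

lemma coeff_braid':
  assumes "x \<noteq> y" "y \<noteq> z" "x \<noteq> z"
  shows "diag_coeff q x y * diag_coeff q x z
      = diag_coeff q y z * diag_coeff q x y + diag_coeff q x z * diag_coeff q z y"
proof -
  define d e f where "d = y - x" and "e = z - y" and "f = z - x"
  have diffs: "y - z = - e" "y - x = d" "z - y = e" "z - x = f"
    by (simp_all add: d_def e_def f_def)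
  have "d \<noteq> 0" "e \<noteq> 0" "f \<noteq> 0"
    using assms by (simp_all add: d_def e_def f_def)
  then show ?thesis
    unfolding diag_coeff_def diffs
    by (simp add: divide_simps) (simp add: d_def e_def f_def algebra_simps)
qed

text \<open>
  The quadratic relation and the trace express all coefficients by the three diagonal ones, and
  then the difference of the two sides is a multiple of the identity of \<open>coeff_braid\<close>.
\<close>

lemma coeff_braid_diag:
  assumes "x \<noteq> y" "y \<noteq> z" "x \<noteq> z"
  shows "diag_coeff q x y * diag_coeff q y z * diag_coeff q x y
        + off_coeff q x y * diag_coeff q x z * off_coeff q y x
      = diag_coeff q y z * diag_coeff q x y * diag_coeff q y z
        + off_coeff q y z * diag_coeff q x z * off_coeff q z y"
proof -
  let ?a = "diag_coeff q x y" and ?b = "diag_coeff q y z" and ?c = "diag_coeff q x z"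
  have ab: "off_coeff q x y * off_coeff q y x = (q - 1) * ?a + q - ?a * ?a"
    "off_coeff q y z * off_coeff q z y = (q - 1) * ?b + q - ?b * ?b"
    using coeff_quadratic[of x y q] coeff_quadratic[of y z q] assms by (simp_all add: algebra_simps)
  have tr: "diag_coeff q y x = q - 1 - ?a" "diag_coeff q z y = q - 1 - ?b"
    using coeff_trace[of x y q] coeff_trace[of y z q] assms by (simp_all add: algebra_simps)
  have rel: "?a * ?b + ?c * (q - 1 - ?a) = ?b * ?c"
    using coeff_braid[OF assms, of q] by (simp add: tr)
  have "?a * ?b * ?a + ?c * ((q - 1) * ?a + q - ?a * ?a)
      - (?b * ?a * ?b + ?c * ((q - 1) * ?b + q - ?b * ?b))
      = (?a - ?b) * (?a * ?b + ?c * (q - 1 - ?a) - ?b * ?c)"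
    by (simp add: algebra_simps)
  also have "\<dots> = 0" by (simp add: rel)
  finally have "?a * ?b * ?a + ?c * ((q - 1) * ?a + q - ?a * ?a) =
      ?b * ?a * ?b + ?c * ((q - 1) * ?b + q - ?b * ?b)" by simp
  then show ?thesis using ab by (simp add: mult.commute mult.left_commute)
qed

definition acts_diag :: "(nat \<Rightarrow> ('b \<Rightarrow> 'a) \<Rightarrow> 'b \<Rightarrow> 'a) \<Rightarrow> 'b set \<Rightarrow> 'a::field free_alg \<Rightarrow> ('b \<Rightarrow> 'a) \<Rightarrow> bool"
  where "acts_diag T S x d \<longleftrightarrow> (\<forall>\<phi>\<in>supp_in S. free_act T x \<phi> = (\<lambda>b. d b * \<phi> b))"

lemma acts_diagD: "acts_diag T S x d \<Longrightarrow> \<phi> \<in> supp_in S \<Longrightarrow> free_act T x \<phi> = (\<lambda>b. d b * \<phi> b)"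
  by (simp add: acts_diag_def)

lemma acts_diag_const: "acts_diag T S (const a) (\<lambda>_. a)"
  by (simp add: acts_diag_def free_act_const)

lemma acts_diag_one: "acts_diag T S 1 (\<lambda>_. 1)"
  by (simp add: acts_diag_def)

lemma acts_diag_diff:
  "acts_diag T S x d \<Longrightarrow> acts_diag T S y e \<Longrightarrow> acts_diag T S (x - y) (\<lambda>b. d b - e b)"
  by (simp add: acts_diag_def free_act_diff algebra_simps)

lemma acts_diag_mult:
  assumes "\<And>i. linear_op (T i)" "acts_diag T S x d" "acts_diag T S y e"
  shows "acts_diag T S (x * y) (\<lambda>b. d b * e b)"
  using assms(2,3) by (simp add: acts_diag_def free_act_mult[OF assms(1)] supp_in_def mult.assoc)

lemma acts_diag_prod_list:
  assumes lin: "\<And>i. linear_op (T i)" and "\<And>k. k \<in> set ks \<Longrightarrow> acts_diag T S (x k) (d k)"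
  shows "acts_diag T S (prod_list (map x ks)) (\<lambda>b. prod_list (map (\<lambda>k. d k b) ks))"
  using assms(2)
  by (induction ks) (auto intro: acts_diag_mult[OF lin] acts_diag_one)

lemma acts_diag_set_prod:
  assumes lin: "\<And>i. linear_op (T i)" and "finite A" "\<And>k. k \<in> A \<Longrightarrow> acts_diag T S (x k) (d k)"
    and comm: "\<And>k m. x k * x m = x m * x k"
  shows "acts_diag T S (set_prod x A) (\<lambda>b. \<Prod>k\<in>A. d k b)"
proof -
  interpret comp_fun_commute "\<lambda>k y. x k * y"
    using comm by unfold_locales (auto simp: fun_eq_iff mult.assoc[symmetric])
  show ?thesis
    using assms(2,3)
    by (induction A rule: finite_induct)
      (auto simp: set_prod_def intro: acts_diag_mult[OF lin] acts_diag_one)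
qed

context separated_shape
begin

abbreviation "gen \<equiv> seminormal_gen q Q (Std lam)"

lemma residue_Suc_ne:
  assumes "t \<in> Std lam" "1 \<le> i" "i < n"
  shows "residue q Q t i \<noteq> residue q Q t (Suc i)"
  using residue_close_ne[OF assms(1,2), of "Suc i"] assms(3) by simp

text \<open>
  If a swap leaves the standard tableaux, then the generator acts on the line of \<open>t\<close> by one of
  the two roots of the quadratic relation.
\<close>

lemma not_Std_coeff:
  assumes "t \<in> Std lam" "1 \<le> i" "i < n" "adj_swap i \<circ> t \<notin> Std lam"
  shows "diag_coeff q (residue q Q t i) (residue q Q t (Suc i)) = q \<and>
      residue q Q t (Suc i) = q * residue q Q t i \<or>
    diag_coeff q (residue q Q t i) (residue q Q t (Suc i)) = -1 \<and>
      residue q Q t i = q * residue q Q t (Suc i)"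
  using residue_swap_not_Std[OF assms] residue_Suc_ne[OF assms(1-3)] diag_coeff_row diag_coeff_col
  by (metis mult_1 mult_zero_right)

text \<open>
  This is the recursion of the Jucys--Murphy elements: multiplying the diagonal operator of the
  residues of \<open>i\<close> by \<open>T\<^sub>i\<close> on both sides gives \<open>q\<close> times that of \<open>i + 1\<close>.
\<close>

lemma gen_residue_gen:
  assumes \<phi>: "\<phi> \<in> supp_in (Std lam)" and i: "1 \<le> i" "i < n"
  shows "gen i (\<lambda>t. residue q Q t i * gen i \<phi> t) = (\<lambda>t. q * residue q Q t (Suc i) * \<phi> t)"
proof
  fix t
  show "gen i (\<lambda>t. residue q Q t i * gen i \<phi> t) t = q * residue q Q t (Suc i) * \<phi> t"
  proof (cases "t \<in> Std lam")
    case t: True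
    let ?x = "residue q Q t i" and ?y = "residue q Q t (Suc i)" and ?u = "adj_swap i \<circ> t"
    have xy: "?x \<noteq> ?y" using residue_Suc_ne[OF t i] .
    show ?thesis
    proof (cases "?u \<in> Std lam")
      case True
      have "gen i (\<lambda>t. residue q Q t i * gen i \<phi> t) t =
          (diag_coeff q ?x ?y * ?x * diag_coeff q ?x ?y + off_coeff q ?x ?y * ?y * off_coeff q ?y ?x) * \<phi> t
          + off_coeff q ?x ?y * (diag_coeff q ?x ?y * ?x + ?y * diag_coeff q ?y ?x) * \<phi> ?u"
        using t True i
        by (simp add: seminormal_gen_def residue_swap adj_swap_simps adj_swap_comp algebra_simps)
      then show ?thesis
        using coeff_conjugate[OF xy, of q] coeff_conjugate_off[OF xy, of q] by simp
    next
      case False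
      then have "\<phi> ?u = 0" using \<phi> by (rule supp_inD[rotated])
      then have "gen i (\<lambda>t. residue q Q t i * gen i \<phi> t) t =
          diag_coeff q ?x ?y * ?x * diag_coeff q ?x ?y * \<phi> t"
        using t False i by (simp add: seminormal_gen_def)
      then show ?thesis using not_Std_coeff[OF t i False] by auto
    qed
  next
    case False
    then show ?thesis using supp_inD[OF \<phi>] by (simp add: seminormal_gen_def)
  qed
qed

lemma gen_quadratic:
  assumes \<phi>: "\<phi> \<in> supp_in (Std lam)" and i: "1 \<le> i" "i < n"
  shows "gen i (gen i \<phi>) = (\<lambda>t. (q - 1) * gen i \<phi> t + q * \<phi> t)"
proof
  fix t
  show "gen i (gen i \<phi>) t = (q - 1) * gen i \<phi> t + q * \<phi> t"
  proof (cases "t \<in> Std lam")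
    case t: True
    let ?x = "residue q Q t i" and ?y = "residue q Q t (Suc i)" and ?u = "adj_swap i \<circ> t"
    have xy: "?x \<noteq> ?y" using residue_Suc_ne[OF t i] .
    show ?thesis
    proof (cases "?u \<in> Std lam")
      case True
      have "gen i (gen i \<phi>) t =
          (diag_coeff q ?x ?y * diag_coeff q ?x ?y + off_coeff q ?x ?y * off_coeff q ?y ?x) * \<phi> t
          + off_coeff q ?x ?y * (diag_coeff q ?x ?y + diag_coeff q ?y ?x) * \<phi> ?u"
        using t True i
        by (simp add: seminormal_gen_def residue_swap adj_swap_simps adj_swap_comp algebra_simps)
      also have "\<dots> = (q - 1) * gen i \<phi> t + q * \<phi> t"
        unfolding coeff_quadratic[OF xy] coeff_trace[OF xy]
        using t i by (simp add: seminormal_gen_def algebra_simps)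
      finally show ?thesis .
    next
      case False
      then have "\<phi> ?u = 0" using \<phi> by (rule supp_inD[rotated])
      then show ?thesis
        using t False i not_Std_coeff[OF t i False] by (auto simp: seminormal_gen_def algebra_simps)
    qed
  next
    case False
    then show ?thesis using supp_inD[OF \<phi>] by (simp add: seminormal_gen_def)
  qed
qed

lemma gen_far:
  assumes \<phi>: "\<phi> \<in> supp_in (Std lam)" and ij: "Suc i < j" "j < n"
  shows "gen i (gen j \<phi>) = gen j (gen i \<phi>)"
proof
  fix t
  show "gen i (gen j \<phi>) t = gen j (gen i \<phi>) t"
  proof (cases "t \<in> Std lam")
    case t: True
    let ?s = "adj_swap i \<circ> t" and ?u = "adj_swap j \<circ> t"
    have j: "1 \<le> j" using ij by simp
    show ?thesis
    proof (cases "i = 0")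
      case True
      have "gen 0 \<phi> ?u = residue q Q t 1 * \<phi> ?u"
        using supp_inD[OF \<phi>, of ?u] ij True
        by (simp add: seminormal_gen_def residue_swap adj_swap_simps)
      then show ?thesis
        using t True j by (simp add: seminormal_gen_def[of _ _ _ _ _ t] algebra_simps)
    next
      case False
      then have i: "1 \<le> i" by simp
      have comm: "adj_swap j \<circ> ?s = adj_swap i \<circ> ?u"
        using adj_swap_far_commute[OF ij(1)] by (metis comp_assoc)
      have st: "adj_swap i \<circ> ?u \<in> Std lam \<longleftrightarrow> ?s \<in> Std lam \<and> ?u \<in> Std lam"
        using swap_far_Std_iff[OF lam t i ij] .
      let ?a = "diag_coeff q (residue q Q t i) (residue q Q t (Suc i))"
      let ?b = "off_coeff q (residue q Q t i) (residue q Q t (Suc i))"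
      let ?c = "diag_coeff q (residue q Q t j) (residue q Q t (Suc j))"
      let ?d = "off_coeff q (residue q Q t j) (residue q Q t (Suc j))"
      have s: "gen j \<phi> ?s = ?c * \<phi> ?s + ?d * \<phi> (adj_swap i \<circ> ?u)"
        using supp_inD[OF \<phi>, of ?s] supp_inD[OF \<phi>, of "adj_swap i \<circ> ?u"] st ij j
        by (simp add: seminormal_gen_def residue_swap adj_swap_simps comm)
      have u: "gen i \<phi> ?u = ?a * \<phi> ?u + ?b * \<phi> (adj_swap i \<circ> ?u)"
        using supp_inD[OF \<phi>, of ?u] supp_inD[OF \<phi>, of "adj_swap i \<circ> ?u"] st ij i
        by (simp add: seminormal_gen_def residue_swap adj_swap_simps)
      have "gen i (gen j \<phi>) t = ?a * (?c * \<phi> t + ?d * \<phi> ?u) + ?b * gen j \<phi> ?s"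
        using t i j by (simp add: seminormal_gen_def[of _ _ _ _ _ t])
      moreover have "gen j (gen i \<phi>) t = ?c * (?a * \<phi> t + ?b * \<phi> ?s) + ?d * gen i \<phi> ?u"
        using t i j by (simp add: seminormal_gen_def[of _ _ _ _ _ t])
      ultimately show ?thesis by (simp add: s u algebra_simps)
    qed
  qed (simp add: seminormal_gen_def)
qed

text \<open>
  The braid relation is checked on the operators which are given by the same formula on all
  fillings of three boxes, where it is an identity of rational functions.  That suffices since
  the standard tableaux span a subquotient: the off-diagonal coefficient vanishes whenever a
  swap leaves the row-standard fillings, and whenever it leads from a row-standard filling
  that is not standard to a standard one.
\<close>

definition free_gen :: "nat \<Rightarrow> (tableau \<Rightarrow> 'a) \<Rightarrow> tableau \<Rightarrow> 'a" where
  "free_gen i \<phi> t = diag_coeff q (residue q Q t i) (residue q Q t (Suc i)) * \<phi> t +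
     off_coeff q (residue q Q t i) (residue q Q t (Suc i)) * \<phi> (adj_swap i \<circ> t)"

definition row_fillings :: "tableau set" where
  "row_fillings = {t. is_tableau lam t \<and> row_std lam t}"

lemma gen_eq_free_gen:
  assumes t: "t \<in> row_fillings" and i: "1 \<le> i" "i < n" and \<phi>: "\<phi> \<in> supp_in (Std lam)"
  shows "gen i \<phi> t = free_gen i \<phi> t"
proof (cases "t \<in> Std lam")
  case False
  have tab: "is_tableau lam t" and row: "row_std lam t" using t by (auto simp: row_fillings_def)
  have ncol: "\<not> col_std lam t" using False tab row by (simp add: Std_iff)
  let ?u = "adj_swap i \<circ> t"
  have zero: "off_coeff q (residue q Q t i) (residue q Q t (Suc i)) * \<phi> ?u = 0"
  proof (cases "?u \<in> Std lam")
    case True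
    have tu: "t = adj_swap i \<circ> ?u" by (simp add: adj_swap_comp)
    obtain a b c where "box ?u i = (a, b, c)" "box ?u (Suc i) = (Suc a, b, c)"
      using col_std_swap_fail[OF lam Std_is_tableau[OF True], of i] True ncol tu by (metis Std_iff)
    then have "residue q Q ?u i = q * residue q Q ?u (Suc i)" by (rule residue_col_neighbour)
    then have "residue q Q t (Suc i) = q * residue q Q t i"
      by (simp add: residue_swap adj_swap_simps)
    then show ?thesis by (simp add: off_coeff_def)
  qed (simp add: supp_inD[OF \<phi>])
  show ?thesis
    using False zero supp_inD[OF \<phi> False] by (simp add: seminormal_gen_def free_gen_def)
qed (use i in \<open>simp add: seminormal_gen_def free_gen_def\<close>)

lemma free_gen_cong:
  assumes i: "1 \<le> i" "i < n" and agree: "\<And>t. t \<in> row_fillings \<Longrightarrow> \<phi> t = \<psi> t"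
    and t: "t \<in> row_fillings"
  shows "free_gen i \<phi> t = free_gen i \<psi> t"
proof (cases "adj_swap i \<circ> t \<in> row_fillings")
  case False
  have tab: "is_tableau lam t" and row: "row_std lam t" using t by (auto simp: row_fillings_def)
  have nrow: "\<not> row_std lam (adj_swap i \<circ> t)"
    using False swap_is_tableau[OF lam tab i] by (simp add: row_fillings_def)
  obtain a b c where "box t i = (a, b, c)" "box t (Suc i) = (a, Suc b, c)"
    using row_std_swap_fail[OF lam tab row nrow] by blast
  then have "residue q Q t (Suc i) = q * residue q Q t i" by (rule residue_row_neighbour)
  then show ?thesis using agree[OF t] by (simp add: free_gen_def off_coeff_def)
qed (use agree t in \<open>simp add: free_gen_def\<close>)

lemma gen3_eq_free_gen3:
  assumes t: "t \<in> row_fillings" and ijk: "1 \<le> i" "i < n" "1 \<le> j" "j < n" "1 \<le> k" "k < n"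
    and \<phi>: "\<phi> \<in> supp_in (Std lam)"
  shows "gen i (gen j (gen k \<phi>)) t = free_gen i (free_gen j (free_gen k \<phi>)) t"
proof -
  have inner: "gen j (gen k \<phi>) t = free_gen j (free_gen k \<phi>) t" if "t \<in> row_fillings" for t
  proof -
    have "gen j (gen k \<phi>) t = free_gen j (gen k \<phi>) t"
      by (rule gen_eq_free_gen[OF that ijk(3,4) seminormal_gen_supp])
    also have "\<dots> = free_gen j (free_gen k \<phi>) t"
      by (rule free_gen_cong[OF ijk(3,4) gen_eq_free_gen[OF _ ijk(5,6) \<phi>] that])
    finally show ?thesis .
  qed
  have "gen i (gen j (gen k \<phi>)) t = free_gen i (gen j (gen k \<phi>)) t"
    by (rule gen_eq_free_gen[OF t ijk(1,2) seminormal_gen_supp])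
  also have "\<dots> = free_gen i (free_gen j (free_gen k \<phi>)) t"
    by (rule free_gen_cong[OF ijk(1,2) inner t])
  finally show ?thesis .
qed

lemma free_gen_braid:
  assumes "residue q Q t i = x" "residue q Q t (Suc i) = y" "residue q Q t (Suc (Suc i)) = z"
    and "x \<noteq> y" "y \<noteq> z" "x \<noteq> z"
  shows "free_gen i (free_gen (Suc i) (free_gen i \<phi>)) t =
    free_gen (Suc i) (free_gen i (free_gen (Suc i) \<phi>)) t"
proof -
  let ?s = "\<lambda>t. adj_swap i \<circ> t" and ?u = "\<lambda>t. adj_swap (Suc i) \<circ> t"
  let ?A = "diag_coeff q" and ?B = "off_coeff q"
  have sus: "?u (?s (?u t)) = ?s (?u (?s t))"
    using adj_swap_braid[of i] by (metis comp_assoc)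
  have "free_gen i (free_gen (Suc i) (free_gen i \<phi>)) t =
      (?A x y * ?A y z * ?A x y + ?B x y * ?A x z * ?B y x) * \<phi> t
      + ?B x y * (?A x y * ?A y z + ?A x z * ?A y x) * \<phi> (?s t)
      + ?B y z * (?A x y * ?A x z) * \<phi> (?u t)
      + ?A x y * ?B y z * ?B x z * \<phi> (?s (?u t))
      + ?A y z * ?B x y * ?B x z * \<phi> (?u (?s t))
      + ?B x y * ?B x z * ?B y z * \<phi> (?s (?u (?s t)))"
    using assms(1-3)
    by (simp add: free_gen_def residue_swap adj_swap_simps adj_swap_comp algebra_simps)
  also have "\<dots> = (?A y z * ?A x y * ?A y z + ?B y z * ?A x z * ?B z y) * \<phi> t
      + ?B x y * (?A y z * ?A x z) * \<phi> (?s t)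
      + ?B y z * (?A y z * ?A x y + ?A x z * ?A z y) * \<phi> (?u t)
      + ?A x y * ?B y z * ?B x z * \<phi> (?s (?u t))
      + ?A y z * ?B x y * ?B x z * \<phi> (?u (?s t))
      + ?B x y * ?B x z * ?B y z * \<phi> (?s (?u (?s t)))"
    unfolding coeff_braid_diag[OF assms(4-6)] coeff_braid[OF assms(4-6)]
      coeff_braid'[OF assms(4-6)] ..
  also have "\<dots> = free_gen (Suc i) (free_gen i (free_gen (Suc i) \<phi>)) t"
    using assms(1-3)
    by (simp add: free_gen_def residue_swap adj_swap_simps adj_swap_comp sus algebra_simps)
  finally show ?thesis .
qed

lemma gen_braid:
  assumes \<phi>: "\<phi> \<in> supp_in (Std lam)" and i: "1 \<le> i" "Suc i < n"
  shows "gen i (gen (Suc i) (gen i \<phi>)) = gen (Suc i) (gen i (gen (Suc i) \<phi>))"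
proof
  fix t
  show "gen i (gen (Suc i) (gen i \<phi>)) t = gen (Suc i) (gen i (gen (Suc i) \<phi>)) t"
  proof (cases "t \<in> Std lam")
    case t: True
    then have "t \<in> row_fillings" by (simp add: row_fillings_def Std_iff)
    moreover have "residue q Q t i \<noteq> residue q Q t (Suc i)"
      "residue q Q t (Suc i) \<noteq> residue q Q t (Suc (Suc i))"
      "residue q Q t i \<noteq> residue q Q t (Suc (Suc i))"
      using residue_close_ne[OF t] i by auto
    ultimately show ?thesis
      using i \<phi> free_gen_braid[OF refl refl refl] by (simp add: gen3_eq_free_gen3)
  qed (simp add: seminormal_gen_def)
qed

lemma gen_zero: "\<phi> \<in> supp_in (Std lam) \<Longrightarrow> gen 0 \<phi> = (\<lambda>t. residue q Q t 1 * \<phi> t)"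
  by (auto simp: fun_eq_iff seminormal_gen_def supp_in_def)

lemma acts_diag_T0: "acts_diag gen (Std lam) (mon [0]) (\<lambda>t. residue q Q t 1)"
  by (simp add: acts_diag_def gen_zero)

lemma residue_scaled_supp: "\<phi> \<in> supp_in S \<Longrightarrow> (\<lambda>t. f t * \<phi> t) \<in> supp_in S" for f :: "tableau \<Rightarrow> 'a"
  by (simp add: supp_in_def)

lemma acts_diag_jucys_murphy:
  assumes "1 \<le> m" "m \<le> n"
  shows "acts_diag gen (Std lam) (jucys_murphy q m) (\<lambda>t. residue q Q t m)"
proof -
  let ?w = "\<lambda>m. rev [1..<m] @ [0] @ [1..<m]"
  have "foldr gen (?w m) \<phi> = (\<lambda>t. q ^ (m - 1) * (residue q Q t m * \<phi> t))"
    if "\<phi> \<in> supp_in (Std lam)" for \<phi>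
    using assms that
  proof (induction m arbitrary: \<phi> rule: nat_induct_at_least)
    case base
    then show ?case by (simp add: gen_zero)
  next
    case (Suc m)
    have "foldr gen (?w (Suc m)) \<phi> = gen m (foldr gen (?w m) (gen m \<phi>))"
      using Suc.hyps by simp
    also have "\<dots> = gen m (\<lambda>t. q ^ (m - 1) * (residue q Q t m * gen m \<phi> t))"
      using Suc.IH[OF _ seminormal_gen_supp] Suc.prems(1) by (simp del: foldr_append append_Cons)
    also have "\<dots> = (\<lambda>t. q ^ (m - 1) * (q * residue q Q t (Suc m) * \<phi> t))"
      using gen_residue_gen[OF Suc.prems(2), of m] Suc
        linear_op_scale[OF linear_seminormal_gen, of q Q "Std lam" m "q ^ (m - 1)"] by simp
    also have "\<dots> = (\<lambda>t. q ^ (Suc m - 1) * (residue q Q t (Suc m) * \<phi> t))"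
      using Suc.hyps by (cases m) (auto simp: fun_eq_iff)
    finally show ?case .
  qed
  moreover have "q powi (1 - int m) * (q ^ (m - 1) * a) = a" for a
  proof -
    have "q powi (1 - int m) * q powi (int (m - 1)) = q powi 0"
      using q_nonzero assms by (subst power_int_add[symmetric]) auto
    then have unit: "q powi (1 - int m) * q ^ (m - 1) = 1"
      by (simp only: power_int_of_nat power_int_0_right)
    show ?thesis by (simp only: mult.assoc[symmetric] unit mult_1_left)
  qed
  ultimately show ?thesis
    unfolding acts_diag_def jucys_murphy_def
    by (intro ballI) (simp only: seminormal_act_mult free_act_const free_act_mon)
qed

lemma relations_act_zero:
  assumes r: "r \<in> hecke_relations l n q Q" and \<phi>: "\<phi> \<in> supp_in (Std lam)"
  shows "seminormal_act q Q (Std lam) r \<phi> = (\<lambda>t. 0)"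
proof -
  from r consider "1 \<le> n" "r = prod_list (map (\<lambda>c. mon [0] - const (Q c)) [1..<Suc l])"
    | "2 \<le> n" "r = mon [0, 1, 0, 1] - mon [1, 0, 1, 0]"
    | i where "1 \<le> i" "i < n" "r = (mon [i] - const q) * (mon [i] + 1)"
    | i j where "i < n" "j < n" "\<bar>int i - int j\<bar> > 1" "r = mon [i, j] - mon [j, i]"
    | i where "1 \<le> i" "i + 1 < n" "r = mon [i, i + 1, i] - mon [i + 1, i, i + 1]"
    unfolding hecke_relations_def by blast
  then show ?thesis
  proof cases
    case 1
    have "acts_diag gen (Std lam) r
        (\<lambda>t. prod_list (map (\<lambda>c. residue q Q t 1 - Q c) [1..<Suc l]))"
      unfolding 1(2)
      by (intro acts_diag_prod_list linear_seminormal_gen acts_diag_diff acts_diag_T0 acts_diag_const)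
    then have act: "seminormal_act q Q (Std lam) r \<phi> =
        (\<lambda>t. prod_list (map (\<lambda>c. residue q Q t 1 - Q c) [1..<Suc l]) * \<phi> t)"
      using \<phi> by (rule acts_diagD)
    have "prod_list (map (\<lambda>c. residue q Q t 1 - Q c) [1..<Suc l]) * \<phi> t = 0" for t
    proof (cases "t \<in> Std lam")
      case True
      then obtain c where "c \<in> {1..l}" "residue q Q t 1 = Q c" using residue_one 1(1) by blast
      then have "0 \<in> set (map (\<lambda>c. residue q Q t 1 - Q c) [1..<Suc l])"
        by (auto simp del: upt_Suc simp: image_iff intro!: bexI[of _ c])
      then show ?thesis using prod_list_zero_iff by (metis mult_zero_left)
    qed (simp add: supp_inD[OF \<phi>])
    then show ?thesis by (simp only: act)
  next
    case 2
    have q2: "gen 1 (\<lambda>t. residue q Q t 1 * gen 1 \<psi> t) = (\<lambda>t. q * residue q Q t 2 * \<psi> t)"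
      if "\<psi> \<in> supp_in (Std lam)" for \<psi>
      using gen_residue_gen[OF that, of 1] 2(1) by (simp add: numeral_2_eq_2)
    have "gen 0 (gen 1 (gen 0 (gen 1 \<phi>))) = (\<lambda>t. residue q Q t 1 * (q * residue q Q t 2 * \<phi> t))"
      using gen_zero[OF seminormal_gen_supp] gen_zero[OF residue_scaled_supp[OF \<phi>]] q2[OF \<phi>]
      by simp
    moreover have "gen 1 (gen 0 (gen 1 (gen 0 \<phi>))) =
        (\<lambda>t. q * residue q Q t 2 * (residue q Q t 1 * \<phi> t))"
      using gen_zero[OF seminormal_gen_supp] gen_zero[OF \<phi>] q2[OF residue_scaled_supp[OF \<phi>]]
      by simp
    ultimately show ?thesis
      by (simp add: 2(2) free_act_diff fun_eq_iff mult.commute mult.left_commute)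
  next
    case 3
    have "seminormal_act q Q (Std lam) r \<phi> = (\<lambda>t. gen i (\<lambda>t. gen i \<phi> t + \<phi> t) t - q * (gen i \<phi> t + \<phi> t))"
      by (simp add: 3(3) seminormal_act_mult free_act_diff free_act_add free_act_const)
    also have "gen i (\<lambda>t. gen i \<phi> t + \<phi> t) = (\<lambda>t. gen i (gen i \<phi>) t + gen i \<phi> t)"
      by (rule linear_op_add[OF linear_seminormal_gen])
    finally show ?thesis
      using gen_quadratic[OF \<phi> 3(1,2)] by (simp add: algebra_simps)
  next
    case 4
    then have "Suc i < j \<or> Suc j < i" by linarith
    then have "gen i (gen j \<phi>) = gen j (gen i \<phi>)"
      using gen_far[OF \<phi>] 4 by metis
    then show ?thesis by (simp add: 4 free_act_diff)
  next
    case 5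
    then show ?thesis using gen_braid[OF \<phi>, of i] by (simp add: free_act_diff)
  qed
qed

theorem hecke_ideal_seminormal_act:
  assumes "x \<in> hecke_ideal l n q Q" "\<phi> \<in> supp_in (Std lam)"
  shows "seminormal_act q Q (Std lam) x \<phi> = (\<lambda>t. 0)"
  using linear_seminormal_gen seminormal_gen_supp relations_act_zero assms
  by (rule hecke_ideal_acts_zero)

end

section \<open>The idempotents of the Jucys--Murphy elements\<close>

lemma finite_residue_set: "finite (residue_set l n q Q k)"
proof -
  have "residue_set l n q Q k = (\<Union>lam\<in>multipartitions l n. (\<lambda>t. residue q Q t k) ` Std lam)"
    by (auto simp: residue_set_def)
  then show ?thesis
    using finite_multipartitions finite_Std by simp
qed

lemma residue_in_residue_set:
  "lam \<in> multipartitions l n \<Longrightarrow> t \<in> Std lam \<Longrightarrow> residue q Q t k \<in> residue_set l n q Q k"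
  by (auto simp: residue_set_def)

text \<open>
  The product over a set in the definition of \<open>F\<^sub>t\<close> makes sense because its factors are
  polynomials in one element with central coefficients.
\<close>

lemma linear_factors_commute:
  fixes x :: "'a::field free_alg"
  shows "(const a * (x - const c)) * (const b * (x - const d))
    = (const b * (x - const d)) * (const a * (x - const c))"
proof -
  have lin: "(x - const c) * (x - const d) = (x - const d) * (x - const c)"
    using const_commutes[of c x] const_commutes[of d x] const_commutes[of c "const d"]
    by (simp add: left_diff_distrib right_diff_distrib)
  have "(const a * (x - const c)) * (const b * (x - const d))
      = const a * (((x - const c) * const b) * (x - const d))"
    by (simp only: mult.assoc)
  also have "\<dots> = const a * (const b * ((x - const c) * (x - const d)))"
    by (simp only: const_commutes[of b, symmetric] mult.assoc)
  also have "\<dots> = const b * (const a * ((x - const d) * (x - const c)))"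
    by (simp only: lin mult.assoc[symmetric] const_commutes[of a "const b"])
  also have "\<dots> = (const b * (x - const d)) * (const a * (x - const c))"
    by (simp only: mult.assoc const_commutes[of a "(x - const d) * (x - const c)"])
      (simp only: mult.assoc const_commutes[of a "x - const c"])
  finally show ?thesis .
qed

definition delta :: "'b \<Rightarrow> 'b \<Rightarrow> 'a::field" where
  "delta v = (\<lambda>t. if t = v then 1 else 0)"

lemma delta_supp: "v \<in> S \<Longrightarrow> delta v \<in> supp_in S"
  by (auto simp: delta_def supp_in_def)

context separated_shape
begin

text \<open>
  Tableaux of all shapes are separated by their residues, so \<open>F\<^sub>v\<close> projects to the line
  of \<open>v\<close>, which is zero if \<open>v\<close> has another shape.
\<close>

lemma F_rep_acts:
  assumes mu: "mu \<in> multipartitions l n" and v: "v \<in> Std mu" and \<phi>: "\<phi> \<in> supp_in (Std lam)"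
  shows "seminormal_act q Q (Std lam) (F_rep l n q Q v) \<phi> = (\<lambda>t. \<phi> v * delta v t)"
proof -
  let ?R = "\<lambda>k. residue_set l n q Q k - {residue q Q v k}"
  let ?d = "\<lambda>k t. \<Prod>c\<in>?R k. 1 / (residue q Q v k - c) * (residue q Q t k - c)"
  have "acts_diag gen (Std lam) (F_rep l n q Q v) (\<lambda>t. prod_list (map (\<lambda>k. ?d k t) [1..<Suc n]))"
    unfolding F_rep_def
    using finite_residue_set
    by (intro acts_diag_prod_list acts_diag_set_prod linear_seminormal_gen acts_diag_mult
        acts_diag_diff acts_diag_const acts_diag_jucys_murphy linear_factors_commute) auto
  then have act: "seminormal_act q Q (Std lam) (F_rep l n q Q v) \<phi> =
      (\<lambda>t. prod_list (map (\<lambda>k. ?d k t) [1..<Suc n]) * \<phi> t)"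
    using \<phi> by (rule acts_diagD)
  have eq: "prod_list (map (\<lambda>k. ?d k v) [1..<Suc n]) = 1"
  proof -
    have "?d k v = 1" for k by (intro prod.neutral) auto
    then show ?thesis by (simp only: map_replicate_const prod_list_replicate power_one)
  qed
  have ne: "prod_list (map (\<lambda>k. ?d k t) [1..<Suc n]) = 0" if t: "t \<in> Std lam" and "t \<noteq> v" for t
  proof -
    obtain k where k: "1 \<le> k" "k \<le> n" "residue q Q t k \<noteq> residue q Q v k"
      using Std_eq_of_residues[OF mu t v] \<open>t \<noteq> v\<close> by blast
    have "?d k t = 0"
      using finite_residue_set residue_in_residue_set[OF lam t] k(3)
      by (intro prod_zero bexI[of _ "residue q Q t k"]) auto
    moreover have "k \<in> set [1..<Suc n]" using k by auto
    ultimately have "0 \<in> set (map (\<lambda>k. ?d k t) [1..<Suc n])" by (metis (mono_tags) image_eqI list.set_map)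
    then show ?thesis by (simp only: prod_list_zero_iff)
  qed
  have "prod_list (map (\<lambda>k. ?d k t) [1..<Suc n]) * \<phi> t = \<phi> v * delta v t" for t
  proof (cases "t = v")
    case True
    then show ?thesis by (simp only: eq) (simp add: delta_def)
  next
    case False
    then show ?thesis using ne[of t] supp_inD[OF \<phi>, of t] by (cases "t \<in> Std lam") (auto simp: delta_def)
  qed
  then show ?thesis unfolding act by blast
qed

end

section \<open>Paths of tableaux\<close>

context separated_shape
begin

abbreviation Inv :: "tableau \<Rightarrow> (node \<times> node) set" where
  "Inv t \<equiv> inversions (diagram lam) reads_before t"

lemma finite_Inv: "finite (Inv t)"
  by (rule finite_inversions[OF finite_diagram[OF lam]])

lemma tableau_inj: "is_tableau lam t \<Longrightarrow> inj_on t (diagram lam)"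
  by (simp add: is_tableau_def bij_betw_def)

lemma Inv_ascent:
  assumes t: "is_tableau lam t" and i: "1 \<le> i" "i < n"
    and rb: "reads_before (box t i) (box t (Suc i))"
  shows "Inv (adj_swap i \<circ> t) = insert (box t i, box t (Suc i)) (Inv t)"
    and "(box t i, box t (Suc i)) \<notin> Inv t"
    and "card (Inv (adj_swap i \<circ> t)) = Suc (card (Inv t))"
proof -
  have bx: "box t i \<in> diagram lam" "t (box t i) = i"
      "box t (Suc i) \<in> diagram lam" "t (box t (Suc i)) = Suc i"
    using box_props[OF lam t] i by auto
  show ins: "Inv (adj_swap i \<circ> t) = insert (box t i, box t (Suc i)) (Inv t)"
    and notin: "(box t i, box t (Suc i)) \<notin> Inv t"
    using inversions_adj_swap[OF tableau_inj[OF t] bx rb reads_before_asym[OF rb]] by auto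
  show "card (Inv (adj_swap i \<circ> t)) = Suc (card (Inv t))"
    using ins notin finite_Inv by simp
qed

lemma Inv_descent:
  assumes t: "is_tableau lam t" and i: "1 \<le> i" "i < n"
    and rb: "reads_before (box t (Suc i)) (box t i)"
  shows "card (Inv t) = Suc (card (Inv (adj_swap i \<circ> t)))"
  using Inv_ascent(3)[OF swap_is_tableau[OF lam t i] i] rb
  by (simp add: box_swap adj_swap_simps adj_swap_comp)

lemma box_neighbours_comparable:
  assumes t: "is_tableau lam t" and i: "1 \<le> i" "i < n"
  shows "reads_before (box t i) (box t (Suc i)) \<or> reads_before (box t (Suc i)) (box t i)"
proof -
  have "t (box t i) = i" "t (box t (Suc i)) = Suc i" using box_props[OF lam t] i by auto
  then have "box t i \<noteq> box t (Suc i)" by auto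
  then show ?thesis by (rule reads_before_total)
qed

lemma card_Inv_swap_le:
  assumes t: "is_tableau lam t" and i: "1 \<le> i" "i < n"
  shows "card (Inv (adj_swap i \<circ> t)) \<le> Suc (card (Inv t))" "card (Inv t) \<le> Suc (card (Inv (adj_swap i \<circ> t)))"
  using box_neighbours_comparable[OF t i] Inv_ascent(3)[OF t i] Inv_descent[OF t i] by auto

lemma word_perm_Cons_comp: "word_perm (i # ws) \<circ> t = word_perm ws \<circ> (adj_swap i \<circ> t)"
  by (simp add: comp_assoc)

lemma card_Inv_word_le:
  "set ws \<subseteq> {1..<n} \<Longrightarrow> is_tableau lam t \<Longrightarrow> card (Inv (word_perm ws \<circ> t)) \<le> card (Inv t) + length ws"
proof (induction ws arbitrary: t)
  case (Cons i ws)
  then have i: "1 \<le> i" "i < n" and ws: "set ws \<subseteq> {1..<n}" by auto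
  show ?case
    unfolding word_perm_Cons_comp list.size
    using Cons.IH[OF ws swap_is_tableau[OF lam Cons.prems(2) i]] card_Inv_swap_le(1)[OF Cons.prems(2) i]
    by linarith
qed (simp add: comp_def)

text \<open>
  A word is ascending from \<open>t\<close> if every letter creates an inversion.  These are the words by
  which a standard tableau is reached in the smallest number of steps.
\<close>

definition ascending :: "nat list \<Rightarrow> tableau \<Rightarrow> bool" where
  "ascending ws t \<longleftrightarrow> set ws \<subseteq> {1..<n} \<and> card (Inv (word_perm ws \<circ> t)) = card (Inv t) + length ws"

lemma ascending_Cons:
  assumes t: "is_tableau lam t" and asc: "ascending (i # ws) t"
  shows "1 \<le> i" "i < n" "reads_before (box t i) (box t (Suc i))" "ascending ws (adj_swap i \<circ> t)"
proof -
  show i: "1 \<le> i" "i < n" using asc by (auto simp: ascending_def)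
  have ws: "set ws \<subseteq> {1..<n}" using asc by (auto simp: ascending_def)
  have card: "card (Inv (word_perm ws \<circ> (adj_swap i \<circ> t))) = card (Inv t) + Suc (length ws)"
    using asc unfolding ascending_def word_perm_Cons_comp by simp
  have le: "card (Inv (word_perm ws \<circ> (adj_swap i \<circ> t))) \<le> card (Inv (adj_swap i \<circ> t)) + length ws"
    by (rule card_Inv_word_le[OF ws swap_is_tableau[OF lam t i]])
  then have "\<not> reads_before (box t (Suc i)) (box t i)"
    using Inv_descent[OF t i] card by linarith
  then show rb: "reads_before (box t i) (box t (Suc i))"
    using box_neighbours_comparable[OF t i] by blast
  show "ascending ws (adj_swap i \<circ> t)"
    using Inv_ascent(3)[OF t i rb] card ws by (simp add: ascending_def)
qed

lemma Inv_ascending_mono: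
  "is_tableau lam t \<Longrightarrow> ascending ws t \<Longrightarrow> Inv t \<subseteq> Inv (word_perm ws \<circ> t)"
proof (induction ws arbitrary: t)
  case (Cons i ws)
  note step = ascending_Cons[OF Cons.prems]
  have "Inv t \<subseteq> Inv (adj_swap i \<circ> t)"
    using Inv_ascent(1)[OF Cons.prems(1) step(1-3)] by auto
  also have "\<dots> \<subseteq> Inv (word_perm ws \<circ> (adj_swap i \<circ> t))"
    using step by (intro Cons.IH swap_is_tableau[OF lam Cons.prems(1)])
  finally show ?case unfolding word_perm_Cons_comp .
qed simp

text \<open>
  An inversion that was created never disappears, and a standard tableau has no inversion inside
  a row or a column.
\<close>

lemma ascending_stays_Std:
  assumes t: "t \<in> Std lam" and asc: "ascending (i # ws) t" and v: "word_perm (i # ws) \<circ> t \<in> Std lam"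
  shows "adj_swap i \<circ> t \<in> Std lam"
proof -
  have tab: "is_tableau lam t" using t by (rule Std_is_tableau)
  note step = ascending_Cons[OF tab asc]
  let ?v = "word_perm (i # ws) \<circ> t" and ?a = "box t i" and ?b = "box t (Suc i)"
  have bx: "?a \<in> diagram lam" "t ?a = i" "?b \<in> diagram lam" "t ?b = Suc i"
    using box_props[OF lam tab] step by auto
  have "(?a, ?b) \<in> Inv (adj_swap i \<circ> t)"
    using Inv_ascent(1)[OF tab step(1-3)] by simp
  then have "(?a, ?b) \<in> Inv ?v"
    unfolding word_perm_Cons_comp
    using Inv_ascending_mono[OF swap_is_tableau[OF lam tab step(1,2)] step(4)] by blast
  then have "?v ?b < ?v ?a" by (simp add: inversions_def)
  then have "\<not> linked ?a ?b"
    using linked_less[OF lam t v bx(1,3)] bx(2,4) by force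
  then show ?thesis using swap_Std_iff[OF lam t step(1,2)] by simp
qed

lemma ascending_induct [consumes 4, case_names Nil Cons]:
  assumes "t \<in> Std lam" "v \<in> Std lam" "ascending ws t" "word_perm ws \<circ> t = v"
    and "P [] v"
    and "\<And>i ws t. t \<in> Std lam \<Longrightarrow> adj_swap i \<circ> t \<in> Std lam \<Longrightarrow> 1 \<le> i \<Longrightarrow> i < n \<Longrightarrow>
      reads_before (box t i) (box t (Suc i)) \<Longrightarrow> ascending (i # ws) t \<Longrightarrow> 
      word_perm ws \<circ> (adj_swap i \<circ> t) = v \<Longrightarrow> P ws (adj_swap i \<circ> t) \<Longrightarrow> P (i # ws) t"
  shows "P ws t"
  using assms(1,3,4)
proof (induction ws arbitrary: t)
  case Nil
  then show ?case using assms(5) by simp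
next
  case (Cons i ws)
  note step = ascending_Cons[OF Std_is_tableau[OF Cons.prems(1)] Cons.prems(2)]
  have v: "word_perm ws \<circ> (adj_swap i \<circ> t) = v"
    using Cons.prems(3) unfolding word_perm_Cons_comp .
  have std: "adj_swap i \<circ> t \<in> Std lam"
    using assms(2) unfolding Cons.prems(3)[symmetric] by (rule ascending_stays_Std[OF Cons.prems(1,2)])
  show ?case
    using Cons.IH[OF std step(4) v] assms(6) Cons.prems(1,2) std step v by blast
qed

abbreviation t0 :: tableau where "t0 \<equiv> initial_tableau lam"

lemma Inv_initial: "Inv t0 = {}"
proof -
  have "(a, b) \<notin> Inv t0" for a b
    using initial_tableau_less[OF lam, of a b] unfolding inversions_def by force
  then show ?thesis by (metis equals0I surj_pair)
qed

lemma tab_perm_props: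
  assumes t: "is_tableau lam t"
  shows "tab_perm lam t permutes {1..n}" "tab_perm lam t \<circ> t0 = t"
proof -
  have t0: "bij_betw t0 (diagram lam) {1..n}"
    by (rule tableau_bij[OF lam initial_is_tableau[OF lam]])
  let ?d = "\<lambda>k. if k \<in> {1..n} then t (inv_into (diagram lam) t0 k) else k"
  have inv_t0: "inv_into (diagram lam) t0 (t0 x) = x" if "x \<in> diagram lam" for x
    using bij_betw_inv_into_left[OF t0 that] .
  have "bij_betw (t \<circ> inv_into (diagram lam) t0) {1..n} {1..n}"
    by (rule bij_betw_trans[OF bij_betw_inv_into[OF t0] tableau_bij[OF lam t]])
  moreover have "bij_betw ?d {1..n} {1..n} \<longleftrightarrow> bij_betw (t \<circ> inv_into (diagram lam) t0) {1..n} {1..n}"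
    by (rule bij_betw_cong) simp
  ultimately have "bij_betw ?d {1..n} {1..n}" by blast
  then have perm: "?d permutes {1..n}" by (rule bij_imp_permutes) auto
  have eq: "?d \<circ> t0 = t"
  proof
    fix x show "(?d \<circ> t0) x = t x"
      using inv_t0[of x] bij_betwE[OF t0] tableau_outside[OF t, of x] initial_tableau_outside[of x lam]
      by (cases "x \<in> diagram lam") auto
  qed
  have uniq: "d = ?d" if d: "d permutes {1..n}" "d \<circ> t0 = t" for d
  proof
    fix k show "d k = ?d k"
    proof (cases "k \<in> {1..n}")
      case True
      then obtain x where k: "k = t0 x"
        using bij_betw_imp_surj_on[OF t0] by (metis imageE)
      have "d (t0 x) = t x" "?d (t0 x) = t x"
        using fun_cong[OF d(2), of x] fun_cong[OF eq, of x] unfolding comp_apply by blast+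
      then show ?thesis unfolding k by (simp only:)
    next
      case False
      then show ?thesis using permutes_not_in[OF d(1)] by auto
    qed
  qed
  have "tab_perm lam t = ?d"
    unfolding tab_perm_def card_diagram[OF lam]
    by (rule the_equality) (use perm eq uniq in blast)+
  then show "tab_perm lam t permutes {1..n}" "tab_perm lam t \<circ> t0 = t" using perm eq by simp_all
qed

text \<open>
  Reading off the entries of \<open>t\<close> turns inversions of \<open>t\<close>, which compare it with the initial
  tableau, into inversions of \<open>d(t)\<inverse>\<close>.
\<close>

lemma perm_len_tab_perm:
  assumes t: "is_tableau lam t"
  shows "perm_len n (tab_perm lam t) = card (Inv t)"
proof -
  let ?d = "tab_perm lam t" and ?f = "\<lambda>(a, b). (t b, t a)"
  note d = tab_perm_props[OF t]
  have inv_d: "perm_inv ?d (t x) = t0 x" for x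
    using permutes_inverses(2)[OF d(1), of "t0 x"] fun_cong[OF d(2), of x] by simp
  have tb: "bij_betw t (diagram lam) {1..n}" by (rule tableau_bij[OF lam t])
  have "inversions {1..n} (<) (perm_inv ?d) = ?f ` Inv t"
  proof (intro equalityI subsetI)
    fix x assume x: "x \<in> inversions {1..n} (<) (perm_inv ?d)"
    obtain p r where pr: "x = (p, r)" by (cases x)
    have mem: "p \<in> {1..n}" "r \<in> {1..n}" "p < r" "perm_inv ?d r < perm_inv ?d p"
      using x by (auto simp: pr inversions_def)
    obtain a b where ab: "a \<in> diagram lam" "t a = r" "b \<in> diagram lam" "t b = p"
      using mem(1,2) bij_betw_imp_surj_on[OF tb] by (metis imageE)
    have "t0 a < t0 b" using mem(4) inv_d ab by metis
    then have "(a, b) \<in> Inv t"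
      using ab mem(3) initial_tableau_less_iff[OF lam] by (auto simp: inversions_def)
    then show "x \<in> ?f ` Inv t" by (rule rev_image_eqI) (simp add: pr ab)
  next
    fix x assume "x \<in> ?f ` Inv t"
    then obtain a b where "x = (t b, t a)" "a \<in> diagram lam" "b \<in> diagram lam" "reads_before a b" "t b < t a"
      by (auto simp: inversions_def)
    then show "x \<in> inversions {1..n} (<) (perm_inv ?d)"
      using bij_betwE[OF tb] initial_tableau_less[OF lam, of a b] inv_d by (auto simp: inversions_def)
  qed
  moreover have "inj_on ?f (Inv t)"
    using tableau_inj[OF t] by (auto simp: inj_on_def inversions_def)
  ultimately show ?thesis by (simp add: perm_len_def card_image)
qed

definition tab_word :: "tableau \<Rightarrow> nat list" where
  "tab_word t = (SOME ws. reduced_word n (tab_perm lam t) ws)"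

lemma T_perm_tab_perm: "T_perm n (tab_perm lam t) = mon (tab_word t)"
  by (simp add: T_perm_def tab_word_def)

lemma tab_word:
  assumes "t \<in> Std lam"
  shows "ascending (tab_word t) t0" "word_perm (tab_word t) \<circ> t0 = t"
proof -
  have t: "is_tableau lam t" using assms by (rule Std_is_tableau)
  note d = tab_perm_props[OF t]
  have red: "set (tab_word t) \<subseteq> {1..<n}" "word_perm (tab_word t) = tab_perm lam t"
      "length (tab_word t) = perm_len n (tab_perm lam t)"
    using reduced_word_some[OF d(1)] unfolding reduced_word_iff[OF d(1)] tab_word_def by auto
  show eq: "word_perm (tab_word t) \<circ> t0 = t" using red(2) d(2) by simp
  show "ascending (tab_word t) t0"
    unfolding ascending_def eq using red perm_len_tab_perm[OF t] by (simp add: Inv_initial)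
qed

text \<open>
  Products over inversions of the off-diagonal coefficients met along an ascending path, read
  downwards from the initial tableau and upwards to it.
\<close>

definition down_coeff :: "tableau \<Rightarrow> 'a" where
  "down_coeff t = (\<Prod>(a, b)\<in>Inv t. off_coeff q (node_res q Q a) (node_res q Q b))"

definition up_coeff :: "tableau \<Rightarrow> 'a" where
  "up_coeff t = (\<Prod>(a, b)\<in>Inv t. off_coeff q (node_res q Q b) (node_res q Q a))"

lemma coeff_initial: "down_coeff t0 = 1" "up_coeff t0 = 1"
  by (simp_all add: down_coeff_def up_coeff_def Inv_initial)

text \<open>
  The nodes of an inversion have residues which are distinct and do not differ by a factor \<open>q\<close>.
\<close>

lemma coeff_nonzero:
  assumes t: "t \<in> Std lam"
  shows "down_coeff t \<noteq> 0" "up_coeff t \<noteq> 0"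
proof -
  have "off_coeff q (node_res q Q a) (node_res q Q b) \<noteq> 0 \<and>
      off_coeff q (node_res q Q b) (node_res q Q a) \<noteq> 0"
    if ab: "(a, b) \<in> Inv t" for a b
  proof -
    have "node_res q Q b \<noteq> node_res q Q a" "node_res q Q b \<noteq> q * node_res q Q a"
        "node_res q Q a \<noteq> q * node_res q Q b"
      using node_res_inversion[OF t ab, of 0] node_res_inversion[OF t ab, of 1]
        node_res_inversion[OF t ab, of "-1"] q_nonzero
      by (auto simp: power_int_minus)
    then show ?thesis unfolding off_coeff_def by simp
  qed
  then have "\<forall>(a, b)\<in>Inv t. off_coeff q (node_res q Q a) (node_res q Q b) \<noteq> 0"
      "\<forall>(a, b)\<in>Inv t. off_coeff q (node_res q Q b) (node_res q Q a) \<noteq> 0"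
    by blast+
  then have "\<forall>x\<in>Inv t. (case x of (a, b) \<Rightarrow> off_coeff q (node_res q Q a) (node_res q Q b)) \<noteq> 0"
      "\<forall>x\<in>Inv t. (case x of (a, b) \<Rightarrow> off_coeff q (node_res q Q b) (node_res q Q a)) \<noteq> 0"
    unfolding split_beta by blast+
  then show "down_coeff t \<noteq> 0" "up_coeff t \<noteq> 0"
    unfolding down_coeff_def up_coeff_def prod_zero_iff[OF finite_Inv] by blast+
qed

lemma coeff_ascent:
  assumes t: "is_tableau lam t" and i: "1 \<le> i" "i < n" and rb: "reads_before (box t i) (box t (Suc i))"
  shows "down_coeff (adj_swap i \<circ> t) = off_coeff q (residue q Q t i) (residue q Q t (Suc i)) * down_coeff t"
    and "up_coeff (adj_swap i \<circ> t) = off_coeff q (residue q Q t (Suc i)) (residue q Q t i) * up_coeff t"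
  using Inv_ascent(2)[OF t i rb] finite_Inv
  by (simp_all add: down_coeff_def up_coeff_def Inv_ascent(1)[OF t i rb] residue_eq_node_res)

text \<open>
  Each letter changes the number of inversions by at most one, so short words do not connect
  tableaux whose numbers of inversions are far apart.
\<close>

lemma word_delta_support:
  assumes "set ws \<subseteq> {1..<n}" "is_tableau lam t" "foldr gen ws (delta v) t \<noteq> 0"
  shows "card (Inv v) \<le> card (Inv t) + length ws" "card (Inv t) \<le> card (Inv v) + length ws"
proof -
  have "card (Inv v) \<le> card (Inv t) + length ws \<and> card (Inv t) \<le> card (Inv v) + length ws"
    using assms
  proof (induction ws arbitrary: t)
    case Nil
    then have "t = v" by (auto simp: delta_def split: if_splits)
    then show ?case by simp
  next
    case (Cons i ws)
    then have i: "1 \<le> i" "i < n" and ws: "set ws \<subseteq> {1..<n}" by auto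
    have "foldr gen ws (delta v) t \<noteq> 0 \<or> foldr gen ws (delta v) (adj_swap i \<circ> t) \<noteq> 0"
      using Cons.prems(3) i by (auto simp: seminormal_gen_def[of _ _ _ i _ t] split: if_splits)
    then show ?case
    proof
      assume "foldr gen ws (delta v) t \<noteq> 0"
      then show ?thesis using Cons.IH[OF ws Cons.prems(2)] by simp
    next
      assume "foldr gen ws (delta v) (adj_swap i \<circ> t) \<noteq> 0"
      then show ?thesis
        using Cons.IH[OF ws swap_is_tableau[OF lam Cons.prems(2) i]] card_Inv_swap_le[OF Cons.prems(2) i]
        unfolding list.size by linarith
    qed
  qed
  then show "card (Inv v) \<le> card (Inv t) + length ws" "card (Inv t) \<le> card (Inv v) + length ws" by auto
qed

text \<open>
  Along an ascending word only the path which moves at every letter connects the two ends, so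
  the matrix coefficient is a product of off-diagonal coefficients.
\<close>

lemma word_down_coeff:
  assumes "t \<in> Std lam" "v \<in> Std lam" "ascending ws t" "word_perm ws \<circ> t = v"
  shows "foldr gen ws (delta v) t * down_coeff t = down_coeff v"
  using assms
proof (induction rule: ascending_induct)
  case Nil
  then show ?case by (simp add: delta_def)
next
  case (Cons i ws t)
  have tab: "is_tableau lam t" using Cons.hyps(1) by (rule Std_is_tableau)
  have ws: "set ws \<subseteq> {1..<n}" and card: "card (Inv v) = card (Inv t) + Suc (length ws)"
    using Cons.hyps(6,7) unfolding ascending_def word_perm_Cons_comp by auto
  have "foldr gen ws (delta v) t = 0"
    using word_delta_support(1)[OF ws tab, of v] card by linarith
  then have eq: "foldr gen (i # ws) (delta v) t =
      off_coeff q (residue q Q t i) (residue q Q t (Suc i)) * foldr gen ws (delta v) (adj_swap i \<circ> t)"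
    using Cons.hyps(1,3) by (simp add: seminormal_gen_def[of _ _ _ i _ t])
  show ?case
    using Cons.IH unfolding eq coeff_ascent(1)[OF tab Cons.hyps(3-5)] by (simp only: mult_ac)
qed

lemma gen_delta:
  assumes t: "t \<in> Std lam" "adj_swap i \<circ> t \<in> Std lam" and i: "1 \<le> i" "i < n"
  shows "gen i (delta t) = (\<lambda>u. diag_coeff q (residue q Q t i) (residue q Q t (Suc i)) * delta t u +
    off_coeff q (residue q Q t (Suc i)) (residue q Q t i) * delta (adj_swap i \<circ> t) u)"
proof
  fix u
  have ne: "adj_swap i \<circ> t \<noteq> t"
  proof
    assume "adj_swap i \<circ> t = t"
    then have "(adj_swap i \<circ> t) (box t i) = t (box t i)" by simp
    then show False using Std_box(2)[OF t(1), of i] i by (simp add: adj_swap_simps)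
  qed
  have sw: "adj_swap i \<circ> u = t \<longleftrightarrow> u = adj_swap i \<circ> t"
    by (metis adj_swap_comp(1))
  show "gen i (delta t) u = diag_coeff q (residue q Q t i) (residue q Q t (Suc i)) * delta t u +
    off_coeff q (residue q Q t (Suc i)) (residue q Q t i) * delta (adj_swap i \<circ> t) u"
    using t i ne by (auto simp: seminormal_gen_def delta_def sw residue_swap adj_swap_simps)
qed

lemma word_up_coeff:
  assumes "t \<in> Std lam" "v \<in> Std lam" "ascending ws t" "word_perm ws \<circ> t = v"
  shows "foldr gen (rev ws) (delta t) v * up_coeff t = up_coeff v"
  using assms
proof (induction rule: ascending_induct)
  case Nil
  then show ?case by (simp add: delta_def)
next
  case (Cons i ws t)
  have tab: "is_tableau lam t" using Cons.hyps(1) by (rule Std_is_tableau)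
  have ws: "set (rev ws) \<subseteq> {1..<n}" and card: "card (Inv v) = card (Inv t) + Suc (length ws)"
    using Cons.hyps(6,7) unfolding ascending_def word_perm_Cons_comp by auto
  have lin: "linear_op (foldr gen (rev ws))"
    by (rule linear_op_foldr[OF linear_seminormal_gen])
  have zero: "foldr gen (rev ws) (delta t) v = 0"
    using word_delta_support(2)[OF ws Std_is_tableau[OF assms(2)], of t] card
    by (metis add_le_cancel_left length_rev not_less_eq_eq order_refl)
  have eq: "foldr gen (rev (i # ws)) (delta t) v = foldr gen (rev ws) (gen i (delta t)) v" by simp
  also have "\<dots> = off_coeff q (residue q Q t (Suc i)) (residue q Q t i) *
      foldr gen (rev ws) (delta (adj_swap i \<circ> t)) v"
    unfolding gen_delta[OF Cons.hyps(1-4)] linear_op_add[OF lin] linear_op_scale[OF lin] zero by simp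
  finally show ?case
    using Cons.IH unfolding coeff_ascent(2)[OF tab Cons.hyps(3-5)] by (simp only: mult_ac)
qed

end

section \<open>Dominance and the gamma-coefficients\<close>

text \<open>The nodes whose number the partial sums in the dominance order count.\<close>

definition above :: "nat \<Rightarrow> nat \<Rightarrow> node \<Rightarrow> bool" where
  "above s r = (\<lambda>(i, j, c). c < s \<or> c = s \<and> i \<le> r)"

lemma above_reads_before: "above s r y \<Longrightarrow> reads_before x y \<Longrightarrow> above s r x"
  by (cases x, cases y) (auto simp: above_def)

lemma shape_partial_sum:
  assumes fin: "finite {x. t x \<noteq> 0}" and pos: "\<And>i j c. t (i, j, c) \<noteq> 0 \<Longrightarrow> 1 \<le> i \<and> 1 \<le> c"
  shows "(\<Sum>c=1..<s. psize (shape t c)) + (\<Sum>i=1..r. shape t s i) = card {x. t x \<noteq> 0 \<and> above s r x}"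
proof -
  let ?row = "\<lambda>c i. {j. t (i, j, c) \<noteq> 0}"
  have fin_row: "finite (?row c i)" for c i
    by (rule finite_imageD[of "\<lambda>j. (i, j, c)"]) (auto intro: finite_subset[OF _ fin] simp: inj_on_def)
  have fin_rows: "finite {i. shape t c i \<noteq> 0}" for c
  proof (rule finite_subset)
    show "{i. shape t c i \<noteq> 0} \<subseteq> fst ` {x. t x \<noteq> 0}"
    proof
      fix i assume "i \<in> {i. shape t c i \<noteq> 0}"
      then have "card (?row c i) \<noteq> 0" by (simp add: shape_def)
      then have "\<not> (\<forall>j. t (i, j, c) = 0)" by (intro notI) simp
      then obtain j where "t (i, j, c) \<noteq> 0" by blast
      then show "i \<in> fst ` {x. t x \<noteq> 0}" by (intro image_eqI[of _ _ "(i, j, c)"]) auto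
    qed
  qed (use fin in simp)
  let ?A = "SIGMA c:{1..<s}. SIGMA i:{i. shape t c i \<noteq> 0}. ?row c i"
  let ?B = "SIGMA i:{1..r}. ?row s i"
  have eq: "{x. t x \<noteq> 0 \<and> above s r x} =
      (\<lambda>(c, i, j). (i, j, c)) ` ?A \<union> (\<lambda>(i, j). (i, j, s)) ` ?B" (is "?L = ?R")
  proof (intro equalityI subsetI)
    fix x assume x: "x \<in> ?L"
    obtain i j c where xeq: "x = (i, j, c)" by (cases x)
    have nz: "t (i, j, c) \<noteq> 0" and ab: "c < s \<or> c = s \<and> i \<le> r" using x by (auto simp: xeq above_def)
    have sh: "shape t c i \<noteq> 0"
      using nz fin_row[of i c] by (auto simp: shape_def card_eq_0_iff)
    from ab show "x \<in> ?R"
    proof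
      assume "c < s"
      then have "(c, i, j) \<in> ?A" using nz sh pos[OF nz] by auto
      then show ?thesis by (intro UnI1 rev_image_eqI) (auto simp: xeq)
    next
      assume "c = s \<and> i \<le> r"
      then have "(i, j) \<in> ?B" using nz pos[OF nz] by auto
      then show ?thesis using \<open>c = s \<and> i \<le> r\<close> by (intro UnI2 rev_image_eqI) (auto simp: xeq)
    qed
  qed (auto simp: above_def)
  have "card ((\<lambda>(c, i, j). (i, j, c)) ` ?A) = card ?A"
    by (rule card_image) (auto simp: inj_on_def)
  also have "\<dots> = (\<Sum>c=1..<s. psize (shape t c))"
    using fin_row fin_rows by (simp add: psize_def) (simp add: shape_def)
  finally have A: "card ((\<lambda>(c, i, j). (i, j, c)) ` ?A) = (\<Sum>c=1..<s. psize (shape t c))" .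
  have "card ((\<lambda>(i, j). (i, j, s)) ` ?B) = card ?B"
    by (rule card_image) (auto simp: inj_on_def)
  also have "\<dots> = (\<Sum>i=1..r. shape t s i)"
    using fin_row by (simp add: shape_def)
  finally have B: "card ((\<lambda>(i, j). (i, j, s)) ` ?B) = (\<Sum>i=1..r. shape t s i)" .
  have "finite ?A" "finite ?B" using fin_row fin_rows by auto
  then have "card ?R = card ((\<lambda>(c, i, j). (i, j, c)) ` ?A) + card ((\<lambda>(i, j). (i, j, s)) ` ?B)"
    by (intro card_Un_disjoint) auto
  then show ?thesis unfolding eq A B by simp
qed

context separated_shape
begin

text \<open>
  The shapes of the two restrictions to \<open>1, \<dots>, k\<close> differ only for \<open>k = i\<close>, where one node is
  replaced by another one which is read later.
\<close>

lemma swap_dominates: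
  assumes t: "is_tableau lam t" and i: "1 \<le> i" "i < n" and rb: "reads_before (box t i) (box t (Suc i))"
  shows "tab_dominates l t (adj_swap i \<circ> t)"
proof -
  let ?u = "adj_swap i \<circ> t"
  let ?S = "\<lambda>t k. {x. (t \<down> k) x \<noteq> 0}"
  have S: "?S t k = {x \<in> diagram lam. t x \<le> k}" if "is_tableau lam t" for t k
    using tableau_pos[OF that] by (auto simp: tab_restrict_def)
  have sum: "(\<Sum>c=1..<s. psize (shape (t \<down> k) c)) + (\<Sum>i=1..r. shape (t \<down> k) s i)
      = card {x. (t \<down> k) x \<noteq> 0 \<and> above s r x}" if "is_tableau lam t" for t k s r
  proof (rule shape_partial_sum)
    show "finite (?S t k)" unfolding S[OF that] using finite_diagram[OF lam] by simp
    fix i j c assume "(t \<down> k) (i, j, c) \<noteq> 0"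
    then have "(i, j, c) \<in> ?S t k" by simp
    then show "1 \<le> i \<and> 1 \<le> c" unfolding S[OF that] by (simp add: mem_diagram)
  qed
  have u: "is_tableau lam ?u" by (rule swap_is_tableau[OF lam t i])
  have le: "card {x. (?u \<down> k) x \<noteq> 0 \<and> above s r x} \<le> card {x. (t \<down> k) x \<noteq> 0 \<and> above s r x}" for k s r
  proof (cases "k = i")
    case False
    have "adj_swap i m \<le> k \<longleftrightarrow> m \<le> k" for m
      using False by (auto simp: transpose_def)
    then have "?S ?u k = ?S t k" unfolding S[OF t] S[OF u] by simp
    moreover have "{x. f x \<noteq> 0 \<and> above s r x} = {x. f x \<noteq> 0} \<inter> Collect (above s r)" for f :: tableau
      by blast
    ultimately show ?thesis by (simp only: order_refl)
  next
    case True
    let ?W = "{x \<in> diagram lam. t x < i \<and> above s r x}"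
    have bx: "box t i \<in> diagram lam" "t (box t i) = i"
        "box t (Suc i) \<in> diagram lam" "t (box t (Suc i)) = Suc i"
      using box_props[OF lam t] i by auto
    have fin: "finite ?W" using finite_diagram[OF lam] by simp
    have low: "adj_swap i m \<le> i \<longleftrightarrow> m < i \<or> m = Suc i" for m by (auto simp: transpose_def)
    have insert: "{x \<in> D. (f x < i \<or> f x = f y) \<and> P x} =
        (if P y then insert y {x \<in> D. f x < i \<and> P x} else {x \<in> D. f x < i \<and> P x})"
      if "y \<in> D" "inj_on f D" for f :: "node \<Rightarrow> nat" and y D P
      using that by (auto dest: inj_onD)
    have uS: "{x. (?u \<down> k) x \<noteq> 0 \<and> above s r x} =
        (if above s r (box t (Suc i)) then insert (box t (Suc i)) ?W else ?W)"
    proof -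
      have "{x. (?u \<down> k) x \<noteq> 0 \<and> above s r x} =
          {x \<in> diagram lam. (t x < i \<or> t x = t (box t (Suc i))) \<and> above s r x}"
        using S[OF u, of k] unfolding True set_eq_iff mem_Collect_eq comp_apply low bx(4) by blast
      then show ?thesis unfolding insert[OF bx(3) tableau_inj[OF t]] .
    qed
    have tS: "{x. (t \<down> k) x \<noteq> 0 \<and> above s r x} =
        (if above s r (box t i) then insert (box t i) ?W else ?W)"
    proof -
      have "{x. (t \<down> k) x \<noteq> 0 \<and> above s r x} =
          {x \<in> diagram lam. (t x < i \<or> t x = t (box t i)) \<and> above s r x}"
        using S[OF t, of k] unfolding True set_eq_iff mem_Collect_eq le_less bx(2) by blast
      then show ?thesis unfolding insert[OF bx(1) tableau_inj[OF t]] .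
    qed
    have "box t i \<notin> ?W" "box t (Suc i) \<notin> ?W" using bx by auto
    then show ?thesis
      unfolding uS tS using fin above_reads_before[OF _ rb, of s r] by auto
  qed
  show ?thesis
    unfolding tab_dominates_def shape_dominates_def sum[OF t] sum[OF u] using le by blast
qed

text \<open>
  The quotient prescribed for one swap is the product of the two off-diagonal coefficients of the
  swapped pair, and these are collected along an ascending word.
\<close>

lemma gamma_closed_form:
  assumes \<gamma>: "gamma_coeffs l n q Q \<gamma>" and v: "v \<in> Std lam"
  shows "\<gamma> v = \<gamma> t0 * (up_coeff v * down_coeff v)"
proof -
  have step: "\<gamma> u / \<gamma> t = (q * residue q Q t i - residue q Q u i) *
        (residue q Q t i - q * residue q Q u i) / (residue q Q t i - residue q Q u i)\<^sup>2"
    if "t \<in> Std lam" "u \<in> Std lam" "1 \<le> i" "i < n" "t = adj_swap i \<circ> u" "tab_dominates l t u" "t \<noteq> u"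
    for t u i
  proof -
    have "i \<in> {1..<n}" using that(3,4) by simp
    then show ?thesis using \<gamma> lam that(1,2,5-7) unfolding gamma_coeffs_def by blast
  qed
  have nonzero: "\<gamma> t \<noteq> 0" if "t \<in> Std lam" for t
    using \<gamma> lam that unfolding gamma_coeffs_def by blast
  have "\<gamma> v * (up_coeff t * down_coeff t) = \<gamma> t * (up_coeff v * down_coeff v)"
    if "t \<in> Std lam" "ascending ws t" "word_perm ws \<circ> t = v" for t ws
    using that(1) v that(2,3)
  proof (induction rule: ascending_induct)
    case (Cons i ws t)
    let ?u = "adj_swap i \<circ> t" and ?x = "residue q Q t i" and ?y = "residue q Q t (Suc i)"
    have tab: "is_tableau lam t" using Cons.hyps(1) by (rule Std_is_tableau)
    have xy: "?x \<noteq> ?y" by (rule residue_Suc_ne[OF Cons.hyps(1,3,4)])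
    have "t = adj_swap i \<circ> ?u" by (simp add: adj_swap_comp)
    moreover have "t \<noteq> ?u"
    proof
      assume "t = ?u"
      then have "(adj_swap i \<circ> t) (box t i) = t (box t i)" by simp
      then show False using Std_box(2)[OF Cons.hyps(1), of i] Cons.hyps(3,4) by (simp add: adj_swap_simps)
    qed
    ultimately have "\<gamma> ?u / \<gamma> t = (q * residue q Q t i - residue q Q ?u i) *
        (residue q Q t i - q * residue q Q ?u i) / (residue q Q t i - residue q Q ?u i)\<^sup>2"
      using step[OF Cons.hyps(1,2), of i] Cons.hyps(3,4) swap_dominates[OF tab Cons.hyps(3-5)] by blast
    also have "\<dots> = off_coeff q ?y ?x * off_coeff q ?x ?y"
    proof -
      define d where "d = ?y - ?x"
      have "?y = ?x + d" "d \<noteq> 0" using xy by (simp_all add: d_def)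
      then show ?thesis
        by (simp add: off_coeff_def residue_swap adj_swap_simps power2_eq_square divide_simps)
          (simp add: algebra_simps)
    qed
    finally have ratio: "\<gamma> ?u = \<gamma> t * (off_coeff q ?y ?x * off_coeff q ?x ?y)"
      using nonzero[OF Cons.hyps(1)] by (simp only: divide_eq_eq mult.commute) simp
    have nz: "off_coeff q ?y ?x * off_coeff q ?x ?y \<noteq> 0"
      using nonzero[OF Cons.hyps(2)] unfolding ratio by (metis mult_zero_right)
    have "(off_coeff q ?y ?x * off_coeff q ?x ?y) * (\<gamma> v * (up_coeff t * down_coeff t)) =
        \<gamma> v * (up_coeff ?u * down_coeff ?u)"
      unfolding coeff_ascent[OF tab Cons.hyps(3-5)] by (simp only: mult_ac)
    also have "\<dots> = (off_coeff q ?y ?x * off_coeff q ?x ?y) * (\<gamma> t * (up_coeff v * down_coeff v))"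
      unfolding Cons.IH ratio by (simp only: mult_ac)
    finally show ?case using nz by simp
  qed simp
  from this[OF initial_Std[OF lam] tab_word[OF v]] show ?thesis by (simp add: coeff_initial)
qed

end

definition seminormal_rep ::
    "nat \<Rightarrow> nat \<Rightarrow> 'a::field \<Rightarrow> (nat \<Rightarrow> 'a) \<Rightarrow> mshape \<Rightarrow> tableau \<Rightarrow> tableau \<Rightarrow> 'a free_alg" where
  "seminormal_rep l n q Q lam s t = F_rep l n q Q s * m_rep l n q Q lam s t * F_rep l n q Q t"

section \<open>The Young symmetriser\<close>

context separated_shape
begin

definition row_of :: "nat \<Rightarrow> nat \<times> nat" where
  "row_of k = (case box t0 k of (i, j, c) \<Rightarrow> (i, c))"

lemma t0_box:
  assumes "1 \<le> k" "k \<le> n"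
  shows "box t0 k \<in> diagram lam" "t0 (box t0 k) = k"
  using Std_box[OF initial_Std[OF lam] assms] .

lemma box_t0: "x \<in> diagram lam \<Longrightarrow> box t0 (t0 x) = x"
  by (rule Std_box_entry[OF initial_Std[OF lam]])

lemma t0_range: "x \<in> diagram lam \<Longrightarrow> 1 \<le> t0 x \<and> t0 x \<le> n"
  using Std_entry_range[OF initial_Std[OF lam]] by blast

lemma young_subgroup_eq: "young_subgroup lam = block_perms row_of n"
proof (intro equalityI subsetI)
  fix w assume "w \<in> young_subgroup lam"
  then have w: "w permutes {1..n}"
    and rows: "\<And>i j c. (i, j, c) \<in> diagram lam \<Longrightarrow>
      \<exists>j'. (i, j', c) \<in> diagram lam \<and> w (t0 (i, j, c)) = t0 (i, j', c)"
    by (auto simp: young_subgroup_def card_diagram[OF lam])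
  have "row_of (w k) = row_of k" if k: "k \<in> {1..n}" for k
  proof -
    obtain i j c where b: "box t0 k = (i, j, c)" by (cases "box t0 k")
    then have bd: "(i, j, c) \<in> diagram lam" "t0 (i, j, c) = k" using t0_box[of k] k by auto
    obtain j' where j': "(i, j', c) \<in> diagram lam" "w (t0 (i, j, c)) = t0 (i, j', c)"
      using rows[OF bd(1)] by blast
    then have "box t0 (w k) = (i, j', c)" using box_t0[OF j'(1)] bd(2) by simp
    then show ?thesis using b by (simp add: row_of_def)
  qed
  then show "w \<in> block_perms row_of n" using w by (simp add: block_perms_def)
next
  fix w assume "w \<in> block_perms row_of n"
  then have w: "w permutes {1..n}" and rows: "\<And>k. k \<in> {1..n} \<Longrightarrow> row_of (w k) = row_of k"
    by (auto simp: block_perms_def)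
  have "\<exists>j'. (i, j', c) \<in> diagram lam \<and> w (t0 (i, j, c)) = t0 (i, j', c)"
    if x: "(i, j, c) \<in> diagram lam" for i j c
  proof -
    have k: "t0 (i, j, c) \<in> {1..n}" using t0_range[OF x] by simp
    then have wk: "w (t0 (i, j, c)) \<in> {1..n}" using permutes_in_image[OF w] by blast
    obtain i' j' c' where b: "box t0 (w (t0 (i, j, c))) = (i', j', c')"
      by (cases "box t0 (w (t0 (i, j, c)))")
    have "(i', c') = (i, c)" using rows[OF k] b box_t0[OF x] by (simp add: row_of_def)
    then show ?thesis using t0_box[of "w (t0 (i, j, c))"] wk b by (intro exI[of _ j']) auto
  qed
  then show "w \<in> young_subgroup lam"
    using w by (simp add: young_subgroup_def card_diagram[OF lam])
qed

lemma row_of_interval: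
  assumes "1 \<le> a" "a < b" "b < m" "m \<le> n" "row_of a = row_of m"
  shows "row_of b = row_of m"
proof -
  obtain i j c where a: "box t0 a = (i, j, c)" by (cases "box t0 a")
  obtain i' j' c' where b: "box t0 b = (i', j', c')" by (cases "box t0 b")
  obtain i'' j'' c'' where m: "box t0 m = (i'', j'', c'')" by (cases "box t0 m")
  have "reads_before (box t0 a) (box t0 b)" "reads_before (box t0 b) (box t0 m)"
    using t0_box[of a] t0_box[of b] t0_box[of m] assms
    by (auto simp: initial_tableau_less_iff[OF lam, symmetric])
  then show ?thesis using assms(5) by (auto simp: row_of_def a b m)
qed

lemma card_row_prefix:
  assumes x: "(i, j, c) \<in> diagram lam"
  shows "card {m \<in> {1..t0 (i, j, c)}. row_of m = row_of (t0 (i, j, c))} = j"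
proof -
  have row: "(i, r, c) \<in> diagram lam" if "1 \<le> r" "r \<le> j" for r
    using x that by (auto simp: mem_diagram)
  have "{m \<in> {1..t0 (i, j, c)}. row_of m = row_of (t0 (i, j, c))} = (\<lambda>r. t0 (i, r, c)) ` {1..j}"
  proof (intro equalityI subsetI)
    fix m assume m: "m \<in> {m \<in> {1..t0 (i, j, c)}. row_of m = row_of (t0 (i, j, c))}"
    then have mn: "1 \<le> m" "m \<le> n" using t0_range[OF x] by auto
    obtain r where b: "box t0 m = (i, r, c)"
      using m box_t0[OF x] by (cases "box t0 m") (auto simp: row_of_def)
    then have "(i, r, c) \<in> diagram lam" "t0 (i, r, c) = m" using t0_box[OF mn] by auto
    moreover have "r \<le> j"
      using initial_tableau_less[OF lam x, of "(i, r, c)"] calculation m by force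
    ultimately show "m \<in> (\<lambda>r. t0 (i, r, c)) ` {1..j}" by (auto simp: mem_diagram)
  next
    fix m assume "m \<in> (\<lambda>r. t0 (i, r, c)) ` {1..j}"
    then obtain r where r: "1 \<le> r" "r \<le> j" "m = t0 (i, r, c)" by auto
    then have "m \<le> t0 (i, j, c)"
      using initial_tableau_less[OF lam row[OF r(1,2)] x] by (cases "r = j") auto
    then show "m \<in> {m \<in> {1..t0 (i, j, c)}. row_of m = row_of (t0 (i, j, c))}"
      using r t0_range[OF row[OF r(1,2)]] box_t0[OF row[OF r(1,2)]] box_t0[OF x] by (simp add: row_of_def)
  qed
  moreover have "inj_on (\<lambda>r. t0 (i, r, c)) {1..j}"
  proof (rule inj_onI)
    fix r r' assume r: "r \<in> {1..j}" "r' \<in> {1..j}" and eq: "t0 (i, r, c) = t0 (i, r', c)"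
    have "box t0 (t0 (i, r, c)) = (i, r, c)" "box t0 (t0 (i, r', c)) = (i, r', c)"
      using r by (auto intro!: box_t0 row)
    then show "r = r'" unfolding eq by simp
  qed
  ultimately show ?thesis by (simp add: card_image)
qed

text \<open>
  The block of \<open>k\<close> up to \<open>k\<close> has as many elements as the column index of \<open>k\<close> in the initial
  tableau, so the \<open>q\<close>-integers of one row multiply to a \<open>q\<close>-factorial.
\<close>

lemma sum_young_subgroup: "(\<Sum>w\<in>young_subgroup lam. q ^ perm_len n w) = q_fact_shape l q lam"
proof -
  let ?col = "\<lambda>(i, j, c). j" and ?S = "SIGMA c:{1..l}. SIGMA i:{i. lam c i \<noteq> 0}. {1..lam c i}"
  have "(\<Sum>w\<in>young_subgroup lam. q ^ perm_len n w)
      = (\<Prod>k=1..n. q_int q (card {m \<in> {1..k}. row_of m = row_of k}))"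
    unfolding young_subgroup_eq by (rule sum_perm_len_block_perms[OF row_of_interval])
  also have "\<dots> = (\<Prod>x\<in>diagram lam. q_int q (card {m \<in> {1..t0 x}. row_of m = row_of (t0 x)}))"
    by (rule prod.reindex_bij_betw[OF tableau_bij[OF lam initial_is_tableau[OF lam]], symmetric])
  also have "\<dots> = (\<Prod>(i, j, c)\<in>diagram lam. q_int q j)"
    by (rule prod.cong[OF refl]) (auto simp only: card_row_prefix split: prod.split)
  also have "\<dots> = (\<Prod>(c, i, j)\<in>?S. q_int q j)"
    unfolding diagram_eq_image[OF lam]
    by (subst prod.reindex) (auto simp: inj_on_def intro!: prod.cong)
  also have "\<dots> = q_fact_shape l q lam"
    unfolding q_fact_shape_def q_fact_def
    using psize_finite_support[OF multipartition_row[OF lam]]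
    by (subst prod.Sigma[symmetric]; (intro prod.cong refl)?) (auto simp: prod.Sigma split_beta intro: prod.cong)
  finally show ?thesis .
qed

definition row_letter :: "nat \<Rightarrow> bool" where
  "row_letter i \<longleftrightarrow> 1 \<le> i \<and> i < n \<and> row_of i = row_of (Suc i)"

lemma row_letter_boxes:
  assumes "row_letter i"
  obtains r j c where "box t0 i = (r, j, c)" "box t0 (Suc i) = (r, Suc j, c)"
    "(r, j, c) \<in> diagram lam" "(r, Suc j, c) \<in> diagram lam"
proof -
  have i: "1 \<le> i" "i < n" using assms by (auto simp: row_letter_def)
  obtain r j c where b: "box t0 i = (r, j, c)" by (cases "box t0 i")
  then obtain j' where b': "box t0 (Suc i) = (r, j', c)"
    using assms by (cases "box t0 (Suc i)") (auto simp: row_letter_def row_of_def)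
  have d: "(r, j, c) \<in> diagram lam" "t0 (r, j, c) = i" "(r, j', c) \<in> diagram lam" "t0 (r, j', c) = Suc i"
    using t0_box[of i] t0_box[of "Suc i"] b b' i by auto
  then have "j' = Suc j" by (simp add: initial_tableau_apply)
  then show thesis using that b b' d by blast
qed

lemma gen_row_letter_t0:
  assumes i: "row_letter i"
  shows "gen i \<phi> t0 = q * \<phi> t0"
proof -
  have i': "1 \<le> i" "i < n" using i by (auto simp: row_letter_def)
  obtain r j c where b: "box t0 i = (r, j, c)" "box t0 (Suc i) = (r, Suc j, c)"
    using row_letter_boxes[OF i] by blast
  have y: "residue q Q t0 (Suc i) = q * residue q Q t0 i"
    using b by (rule residue_row_neighbour)
  have "residue q Q t0 i \<noteq> q * residue q Q t0 i"
    using residue_Suc_ne[OF initial_Std[OF lam] i'] y by simp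
  then have "residue q Q t0 i \<noteq> 0" "q \<noteq> 1" by auto
  then show ?thesis
    using i' initial_Std[OF lam] by (simp add: seminormal_gen_def y diag_coeff_row off_coeff_def)
qed

text \<open>
  The first letter of a reduced word is a descent, and an element of the Young subgroup has no
  descent between different rows.
\<close>

lemma young_reduced_word_letters:
  assumes "reduced_word n w ws" "w \<in> young_subgroup lam" "i \<in> set ws"
  shows "row_letter i"
  using assms
proof (induction ws arbitrary: w)
  case (Cons m ws)
  note red = reduced_word_ConsD[OF Cons.prems(1)]
  have w: "w permutes {1..n}" and rows: "\<And>k. k \<in> {1..n} \<Longrightarrow> row_of (w k) = row_of k"
    using Cons.prems(2) by (auto simp: young_subgroup_eq block_perms_def)
  have m: "row_letter m"
  proof (rule ccontr)
    assume "\<not> row_letter m"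
    then have ne: "row_of m \<noteq> row_of (Suc m)" using red by (simp add: row_letter_def)
    have rm: "m \<in> {1..n}" "Suc m \<in> {1..n}" using red by auto
    have wr: "w m \<in> {1..n}" "w (Suc m) \<in> {1..n}"
      using permutes_in_image[OF w] rm by blast+
    have "reads_before (box t0 m) (box t0 (Suc m))" "reads_before (box t0 (w (Suc m))) (box t0 (w m))"
      using t0_box rm wr red(3) by (auto simp: initial_tableau_less_iff[OF lam, symmetric])
    then show False
      using ne rows[OF rm(1)] rows[OF rm(2)]
      by (cases "box t0 m"; cases "box t0 (Suc m)"; cases "box t0 (w m)"; cases "box t0 (w (Suc m))")
        (auto simp: row_of_def)
  qed
  have "row_of (adj_swap m k) = row_of k" for k
    using m by (auto simp: row_letter_def transpose_def)
  moreover have "adj_swap m k \<in> {1..n}" if "k \<in> {1..n}" for k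
    using permutes_in_image[OF adj_swap_permutes[OF red(1,2)]] that by blast
  ultimately have "w \<circ> adj_swap m \<in> young_subgroup lam"
    using adj_swap_comp_permutes[OF w red(1,2)] rows by (simp add: young_subgroup_eq block_perms_def)
  then have "i \<in> set ws \<Longrightarrow> row_letter i" by (rule Cons.IH[OF red(4)])
  then show ?case using Cons.prems(3) m by auto
qed simp

definition perm_word :: "(nat \<Rightarrow> nat) \<Rightarrow> nat list" where
  "perm_word w = (SOME ws. reduced_word n w ws)"

lemma T_perm_eq: "T_perm n w = mon (perm_word w)"
  by (simp add: T_perm_def perm_word_def)

lemma perm_word_reduced: "w permutes {1..n} \<Longrightarrow> reduced_word n w (perm_word w)"
  unfolding perm_word_def by (rule reduced_word_some)

lemma young_permutes: "w \<in> young_subgroup lam \<Longrightarrow> w permutes {1..n}"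
  by (simp add: young_subgroup_eq block_perms_def)

text \<open>
  The action of \<open>x\<^sub>\<lambda>\<close>, the sum of the \<open>T\<^sub>w\<close> over the Young subgroup.
\<close>

definition symmetriser :: "(tableau \<Rightarrow> 'a) \<Rightarrow> tableau \<Rightarrow> 'a" where
  "symmetriser \<phi> t = (\<Sum>w\<in>young_subgroup lam. foldr gen (perm_word w) \<phi> t)"

lemma symmetriser_act:
  "seminormal_act q Q (Std lam) (\<Sum>w\<in>young_subgroup lam. T_perm n w) \<phi> = symmetriser \<phi>"
  by (simp add: fun_eq_iff symmetriser_def free_act_sum T_perm_eq)

lemma symmetriser_supp: "\<phi> \<in> supp_in (Std lam) \<Longrightarrow> symmetriser \<phi> \<in> supp_in (Std lam)"
  using seminormal_word_supp[of \<phi> "Std lam"] by (simp add: supp_in_def symmetriser_def)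

lemma symmetriser_t0: "symmetriser \<phi> t0 = q_fact_shape l q lam * \<phi> t0"
proof -
  have word: "foldr gen ws \<phi> t0 = q ^ length ws * \<phi> t0" if "\<And>i. i \<in> set ws \<Longrightarrow> row_letter i" for ws
    using that by (induction ws) (auto simp: gen_row_letter_t0)
  have "foldr gen (perm_word w) \<phi> t0 = q ^ perm_len n w * \<phi> t0" if w: "w \<in> young_subgroup lam" for w
    using word[of "perm_word w"] young_reduced_word_letters[OF perm_word_reduced[OF young_permutes[OF w]] w]
      perm_word_reduced[OF young_permutes[OF w]] reduced_word_iff[OF young_permutes[OF w]] by auto
  then have "symmetriser \<phi> t0 = (\<Sum>w\<in>young_subgroup lam. q ^ perm_len n w * \<phi> t0)"
    by (simp add: symmetriser_def)
  then show ?thesis by (simp add: sum_distrib_right[symmetric] sum_young_subgroup)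
qed

lemma gen_matsumoto:
  assumes "\<phi> \<in> supp_in (Std lam)" "reduced_word n w us" "reduced_word n w vs"
  shows "foldr gen us \<phi> = foldr gen vs \<phi>"
  using seminormal_gen_supp gen_far gen_braid assms by (intro matsumoto[where V = "supp_in (Std lam)"]) auto

text \<open>
  The summands for \<open>w\<close> and \<open>s\<^sub>i w\<close> span a subspace on which \<open>T\<^sub>i\<close> acts by its quadratic
  relation, and their sum is an eigenvector.
\<close>

lemma gen_symmetriser:
  assumes \<phi>: "\<phi> \<in> supp_in (Std lam)" and i: "row_letter i"
  shows "gen i (symmetriser \<phi>) = (\<lambda>t. q * symmetriser \<phi> t)"
proof
  fix t
  have i': "1 \<le> i" "i < n" using i by (auto simp: row_letter_def)
  let ?Y = "young_subgroup lam" and ?E = "\<lambda>w. foldr gen (perm_word w) \<phi>"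
  let ?U = "{w \<in> ?Y. w i < w (Suc i)}" and ?s = "\<lambda>w. w \<circ> adj_swap i"
  have fin: "finite ?Y" unfolding young_subgroup_eq by (rule finite_block_perms)
  have sY: "?s w \<in> ?Y" if w: "w \<in> ?Y" for w
  proof -
    have "row_of (adj_swap i k) = row_of k" for k
      using i by (auto simp: row_letter_def transpose_def)
    moreover have "adj_swap i k \<in> {1..n}" if "k \<in> {1..n}" for k
      using permutes_in_image[OF adj_swap_permutes[OF i']] that by blast
    ultimately show ?thesis
      using w adj_swap_comp_permutes[OF young_permutes[OF w] i']
      by (simp add: young_subgroup_eq block_perms_def)
  qed
  have ss: "?s (?s w) = w" for w :: "nat \<Rightarrow> nat" by (rule adj_swap_comp(2))
  have "?Y - ?U = ?s ` ?U"
  proof (intro equalityI subsetI)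
    fix w assume w: "w \<in> ?Y - ?U"
    then have wY: "w \<in> ?Y" and "\<not> w i < w (Suc i)" by auto
    then have "(?s w) i < (?s w) (Suc i)"
      using permutes_neq_Suc[OF young_permutes[OF wY], of i] by (simp add: adj_swap_simps)
    then have "?s w \<in> ?U" using sY[OF wY] by blast
    then show "w \<in> ?s ` ?U" by (rule rev_image_eqI) (simp only: ss)
  next
    fix w assume "w \<in> ?s ` ?U"
    then obtain x where x: "x \<in> ?U" "w = ?s x" by blast
    then have "w i = x (Suc i)" "w (Suc i) = x i" by (simp_all add: adj_swap_simps)
    then show "w \<in> ?Y - ?U" using x sY[of x] by auto
  qed
  moreover have "inj_on ?s ?U" using ss by (metis (no_types, lifting) inj_onI)
  ultimately have split: "(\<Sum>w\<in>?Y. f w) = (\<Sum>w\<in>?U. f w + f (?s w))" for f :: "(nat \<Rightarrow> nat) \<Rightarrow> 'a"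
    using sum.subset_diff[of ?U ?Y f] fin by (simp add: sum.reindex sum.distrib add.commute)
  have E: "?E (?s w) = gen i (?E w)" if w: "w \<in> ?U" for w
  proof -
    have wp: "w permutes {1..n}" using w young_permutes by blast
    have "reduced_word n (?s w) (i # perm_word w)"
      using perm_word_reduced[OF wp] adj_swap_comp_permutes[OF wp i'] i' w
      by (intro reduced_word_ConsI) (auto simp only: ss, auto simp: adj_swap_simps)
    then have "?E (?s w) = foldr gen (i # perm_word w) \<phi>"
      by (rule gen_matsumoto[OF \<phi> perm_word_reduced[OF adj_swap_comp_permutes[OF wp i']]])
    then show ?thesis by simp
  qed
  have pair: "gen i (?E w) t + gen i (?E (?s w)) t = q * (?E w t + ?E (?s w) t)" if w: "w \<in> ?U" for w
  proof -
    have "gen i (?E (?s w)) t = (q - 1) * gen i (?E w) t + q * ?E w t"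
      unfolding E[OF w] gen_quadratic[OF seminormal_word_supp[OF \<phi>] i'] ..
    then show ?thesis unfolding E[OF w] by (simp add: algebra_simps)
  qed
  have "symmetriser \<phi> = (\<lambda>t. \<Sum>w\<in>?Y. ?E w t)"
    by (simp add: fun_eq_iff symmetriser_def)
  then have "gen i (symmetriser \<phi>) t = (\<Sum>w\<in>?Y. gen i (?E w) t)"
    by (simp add: linear_op_sum[OF linear_seminormal_gen])
  also have "\<dots> = (\<Sum>w\<in>?U. q * (?E w t + ?E (?s w) t))"
    unfolding split by (intro sum.cong refl pair)
  also have "\<dots> = q * symmetriser \<phi> t"
    unfolding symmetriser_def split by (simp add: sum_distrib_left)
  finally show "gen i (symmetriser \<phi>) t = q * symmetriser \<phi> t" .
qed

section \<open>The component factor\<close>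

text \<open>
  The eigenvalue at \<open>t\<close> of \<open>u\<^sub>\<lambda>\<close>, the product of the factors \<open>L\<^sub>k - Q\<^sub>s\<close>.
\<close>

definition component_factor :: "tableau \<Rightarrow> 'a" where
  "component_factor t = (\<Prod>r=2..l. \<Prod>k=1..component_start lam r. residue q Q t k - Q r)"

lemma component_start_le: "r \<le> l \<Longrightarrow> component_start lam r \<le> n"
proof -
  assume "r \<le> l"
  then have "component_start lam r \<le> component_start lam (Suc l)" by (intro component_start_mono) simp
  also have "\<dots> = n"
    using lam by (simp add: component_start_def multipartitions_def atLeastLessThanSuc_atLeastAtMost)
  finally show ?thesis .
qed

lemma component_factor_act:
  "acts_diag gen (Std lam) (prod_list (map (\<lambda>r. prod_list (map (\<lambda>k. jucys_murphy q k - const (Q r))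
     [1..<Suc (\<Sum>c=1..<r. psize (lam c))])) [2..<Suc l])) component_factor"
proof -
  have "acts_diag gen (Std lam) (prod_list (map (\<lambda>r. prod_list (map (\<lambda>k. jucys_murphy q k - const (Q r))
      [1..<Suc (\<Sum>c=1..<r. psize (lam c))])) [2..<Suc l]))
    (\<lambda>t. prod_list (map (\<lambda>r. prod_list (map (\<lambda>k. residue q Q t k - Q r)
      [1..<Suc (\<Sum>c=1..<r. psize (lam c))])) [2..<Suc l]))"
  proof (intro acts_diag_prod_list linear_seminormal_gen acts_diag_diff acts_diag_const)
    fix r k assume "r \<in> set [2..<Suc l]" "k \<in> set [1..<Suc (\<Sum>c=1..<r. psize (lam c))]"
    then have "1 \<le> k" "k \<le> component_start lam r" "r \<le> l" by (auto simp: component_start_def)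
    then show "acts_diag gen (Std lam) (jucys_murphy q k) (\<lambda>t. residue q Q t k)"
      using component_start_le[of r] by (intro acts_diag_jucys_murphy) auto
  qed
  moreover have "prod_list (map f [a..<Suc b]) = (\<Prod>k=a..b. f k)" for f :: "nat \<Rightarrow> 'a" and a b
    by (subst prod.distinct_set_conv_list[symmetric])
      (simp_all only: distinct_upt set_upt atLeastLessThanSuc_atLeastAtMost)
  ultimately show ?thesis
    by (simp only: component_factor_def[abs_def] component_start_def)
qed

text \<open>
  A row lies in one component, so \<open>i\<close> and \<open>i + 1\<close> both belong to the range of \<open>k\<close> in a factor
  of the product or both do not.
\<close>

lemma component_factor_swap:
  assumes i: "row_letter i"
  shows "component_factor (adj_swap i \<circ> t) = component_factor t"
proof -
  obtain r' j c where b: "box t0 i = (r', j, c)" "box t0 (Suc i) = (r', Suc j, c)"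
      "(r', j, c) \<in> diagram lam" "(r', Suc j, c) \<in> diagram lam"
    using row_letter_boxes[OF i] by blast
  have "t0 (r', j, c) = i" "t0 (r', Suc j, c) = Suc i"
    using t0_box[of i] t0_box[of "Suc i"] b i by (auto simp: row_letter_def)
  then have range: "component_start lam c < i" "Suc i \<le> component_start lam (Suc c)"
    using initial_tableau_range[OF lam b(3)] initial_tableau_range[OF lam b(4)] by auto
  have "(\<Prod>k=1..component_start lam r. residue q Q (adj_swap i \<circ> t) k - Q r)
      = (\<Prod>k=1..component_start lam r. residue q Q t k - Q r)" (is "prod ?f ?A = prod ?g ?A") for r
  proof (cases "Suc i \<le> component_start lam r")
    case True
    have perm: "adj_swap i permutes ?A"
      using True i by (intro permutes_swap_id) (auto simp: row_letter_def)
    have "prod ?f ?A = prod (?g \<circ> adj_swap i) ?A" by (simp add: residue_swap)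
    also have "\<dots> = prod ?g ?A" by (rule prod.permute[OF perm, symmetric])
    finally show ?thesis .
  next
    case False
    have "component_start lam r < i"
    proof (cases "c < r")
      case True
      then have "component_start lam (Suc c) \<le> component_start lam r" by (intro component_start_mono) simp
      then show ?thesis using False range by simp
    next
      case False
      then have "component_start lam r \<le> component_start lam c" by (intro component_start_mono) simp
      then show ?thesis using range by simp
    qed
    then show ?thesis by (intro prod.cong refl) (simp add: residue_swap adj_swap_simps)
  qed
  then show ?thesis by (simp add: component_factor_def)
qed

lemma gen_component_factor:
  assumes i: "row_letter i"
  shows "gen i (\<lambda>t. component_factor t * \<phi> t) = (\<lambda>t. component_factor t * gen i \<phi> t)"
  using component_factor_swap[OF i] i
  by (auto simp: fun_eq_iff seminormal_gen_def row_letter_def algebra_simps)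

lemma symmetriser_component_factor:
  "symmetriser (\<lambda>t. component_factor t * \<phi> t) = (\<lambda>t. component_factor t * symmetriser \<phi> t)"
proof
  fix t
  have "foldr gen ws (\<lambda>t. component_factor t * \<phi> t) = (\<lambda>t. component_factor t * foldr gen ws \<phi> t)"
    if "\<And>i. i \<in> set ws \<Longrightarrow> row_letter i" for ws
    using that by (induction ws) (auto simp: gen_component_factor)
  then have "foldr gen (perm_word w) (\<lambda>t. component_factor t * \<phi> t) t =
      component_factor t * foldr gen (perm_word w) \<phi> t" if "w \<in> young_subgroup lam" for w
    using young_reduced_word_letters[OF perm_word_reduced[OF young_permutes[OF that]] that] by simp
  then show "symmetriser (\<lambda>t. component_factor t * \<phi> t) t = component_factor t * symmetriser \<phi> t"
    by (simp add: symmetriser_def sum_distrib_left)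
qed

text \<open>
  The only tableau in the support of a vector which is invariant under the Young subgroup and
  divisible by the component factor is the initial one.  The places of \<open>1, 2, \<dots>\<close> are forced one
  after the other: inside a row, invariance and the recursion for the Jucys--Murphy elements
  multiply the residue by \<open>q\<close> at every step, and a row that begins at the wrong place
  begins in a later component, where the component factor vanishes.
\<close>

lemma invariant_support:
  assumes \<psi>: "\<psi> \<in> supp_in (Std lam)"
    and inv: "\<And>i. row_letter i \<Longrightarrow> gen i \<psi> = (\<lambda>t. q * \<psi> t)"
    and factor: "\<And>a. \<psi> a \<noteq> 0 \<Longrightarrow> component_factor a \<noteq> 0"
    and a: "\<psi> a \<noteq> 0"
  shows "a = t0"
proof -
  have std: "a \<in> Std lam" if "\<psi> a \<noteq> 0" for a using supp_inD[OF \<psi>, of a] that by blast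
  have t0: "t0 \<in> Std lam" by (rule initial_Std[OF lam])
  have "\<forall>a. \<psi> a \<noteq> 0 \<longrightarrow> box a k = box t0 k" if "1 \<le> k" "k \<le> n" for k
    using that
  proof (induction k rule: less_induct)
    case (less k)
    have agree: "box a m = box t0 m" if "\<psi> a \<noteq> 0" "1 \<le> m" "m < k" for a m
      using less.IH[of m] less.prems that by auto
    show ?case
    proof (cases "\<exists>i. k = Suc i \<and> row_letter i")
      case True
      \<comment> \<open>The entry \<open>k\<close> continues a row of the initial tableau.\<close>
      then obtain i where i: "k = Suc i" "row_letter i" by blast
      have i': "1 \<le> i" "i < n" using i(2) by (auto simp: row_letter_def)
      let ?x = "residue q Q t0 i"
      have "residue q Q t i * (q * \<psi> t) = q * ?x * \<psi> t" for t
        using agree[of t i] i' i(1) by (cases "\<psi> t = 0") (auto simp: residue_eq_node_res)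
      then have scalar: "(\<lambda>t. residue q Q t i * (q * \<psi> t)) = (\<lambda>t. q * ?x * \<psi> t)" by (rule ext)
      have "gen i (\<lambda>t. q * ?x * \<psi> t) = (\<lambda>t. q * residue q Q t k * \<psi> t)"
        using gen_residue_gen[OF \<psi> i'] unfolding inv[OF i(2)] i(1) scalar .
      then have eq: "q * ?x * (q * \<psi> t) = q * residue q Q t k * \<psi> t" for t
        using linear_op_scale[OF linear_seminormal_gen, of q Q "Std lam" i "q * ?x" \<psi>] inv[OF i(2)]
        by (metis (no_types))
      obtain r j c where "box t0 i = (r, j, c)" "box t0 (Suc i) = (r, Suc j, c)"
        using row_letter_boxes[OF i(2)] by blast
      then have "residue q Q t0 k = q * ?x" unfolding i(1) by (rule residue_row_neighbour)
      then have res: "residue q Q a k = residue q Q t0 k" if "\<psi> a \<noteq> 0" for a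
        using eq[of a] q_nonzero that by (simp add: algebra_simps)
      show ?thesis
        using box_determined_by_residue[OF lam std t0 less.prems agree res] by blast
    next
      case False
      \<comment> \<open>The entry \<open>k\<close> begins a row of the initial tableau.\<close>
      obtain i j c where b0: "box t0 k = (i, j, c)" by (cases "box t0 k")
      have b0d: "(i, j, c) \<in> diagram lam" "t0 (i, j, c) = k" using t0_box[OF less.prems] b0 by auto
      have "j = 1"
      proof (rule ccontr)
        assume "j \<noteq> 1"
        then obtain j' where j': "j = Suc j'" "1 \<le> j'" using b0d(1) by (cases j) (auto simp: mem_diagram)
        then have x: "(i, j', c) \<in> diagram lam" using b0d(1) by (auto simp: mem_diagram)
        have "Suc (t0 (i, j', c)) = k"
          using b0d x j' by (simp add: initial_tableau_apply)
        moreover have "row_of (t0 (i, j', c)) = row_of k"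
          using box_t0[OF x] b0 by (simp add: row_of_def)
        ultimately show False
          using False t0_range[OF x] less.prems unfolding row_letter_def by (metis Suc_le_eq)
      qed
      have "box a k = box t0 k" if nz: "\<psi> a \<noteq> 0" for a
      proof (rule ccontr)
        assume ne: "box a k \<noteq> box t0 k"
        have aS: "a \<in> Std lam" using std[OF nz] .
        obtain i' j' c' where b: "box a k = (i', j', c')" by (cases "box a k")
        have bd: "(i', j', c') \<in> diagram lam" "a (i', j', c') = k"
          using Std_box[OF aS less.prems] b by auto
        have low: "t0 x < k" if "x \<in> diagram lam" "a x < k" for x
          using agree[OF nz Std_entry_range(1)[OF aS that(1)] that(2)] Std_box_entry[OF aS that(1)]
            t0_box[of "a x"] Std_entry_range[OF aS that(1)] that(2) by simp
        have "\<not> t0 (i', j', c') < k"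
        proof
          assume less_k: "t0 (i', j', c') < k"
          have "box a (t0 (i', j', c')) = (i', j', c')"
            using agree[OF nz _ less_k] t0_range[OF bd(1)] box_t0[OF bd(1)] by simp
          then show False
            using Std_box(2)[OF aS, of "t0 (i', j', c')"] t0_range[OF bd(1)] bd(2) less_k by simp
        qed
        then have "\<not> reads_before (i', j', c') (i, j, c)"
          using initial_tableau_less[OF lam bd(1) b0d(1)] b0d(2) by auto
        moreover have "(i', j', c') \<noteq> (i, j, c)" using ne b b0 by simp
        ultimately have rb: "reads_before (i, 1, c) (i', j', c')"
          using reads_before_total \<open>j = 1\<close> by blast
        show False
        proof (cases "c = c'")
          case True
          have "a (i, j, c) < k"
            using Std_nw_less[OF lam aS b0d(1) bd(1)] bd rb True \<open>j = 1\<close> ne b b0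
            by (auto simp: mem_diagram)
          then show False using low[OF b0d(1)] b0d(2) by simp
        next
          case False
          then have cc: "c < c'" using rb by auto
          have corner: "(1, 1, c') \<in> diagram lam"
            using diagram_nw_closed[OF lam bd(1), of 1 1 c'] bd(1) by (auto simp: mem_diagram)
          have "(i', j', c') = (1, 1, c')"
          proof (rule ccontr)
            assume "(i', j', c') \<noteq> (1, 1, c')"
            then have "a (1, 1, c') < k"
              using Std_nw_less[OF lam aS corner bd(1)] bd by (auto simp: mem_diagram)
            then have "t0 (1, 1, c') < t0 (i, j, c)" using low[OF corner] b0d(2) by simp
            moreover have "t0 (i, j, c) < t0 (1, 1, c')"
              using initial_tableau_less[OF lam b0d(1) corner] cc by simp
            ultimately show False by simp
          qed
          then have res: "residue q Q a k = Q c'" using b by (simp add: residue_eq_node_res)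
          have c'l: "c' \<in> {2..l}"
            using cc multipartition_component[OF lam bd(1)] b0d(1) by (auto simp: mem_diagram)
          have "component_start lam (Suc c) \<le> component_start lam c'"
            using cc by (intro component_start_mono) simp
          then have "k \<in> {1..component_start lam c'}"
            using initial_tableau_range(2)[OF lam b0d(1)] b0d(2) less.prems by auto
          then have "(\<Prod>m=1..component_start lam c'. residue q Q a m - Q c') = 0"
            using res by (intro prod_zero) auto
          then have "component_factor a = 0"
            unfolding component_factor_def using c'l by (intro prod_zero) auto
          then show False using factor[OF nz] by simp
        qed
      qed
      then show ?thesis by blast
    qed
  qed
  then show ?thesis using Std_eq_of_boxes[OF lam std[OF a] t0] a by blast
qed

text \<open>
  The scalar \<open>C\<^sub>\<lambda>\<close>.
\<close>

definition initial_scalar :: 'a where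
  "initial_scalar = q_fact_shape l q lam * component_factor t0"

lemma symmetriser_times_factor:
  assumes \<phi>: "\<phi> \<in> supp_in (Std lam)"
  shows "symmetriser (\<lambda>t. component_factor t * \<phi> t) = (\<lambda>t. initial_scalar * \<phi> t0 * delta t0 t)"
proof
  fix t
  let ?\<psi> = "symmetriser (\<lambda>t. component_factor t * \<phi> t)"
  have supp: "(\<lambda>t. component_factor t * \<phi> t) \<in> supp_in (Std lam)"
    using \<phi> by (rule residue_scaled_supp)
  show "?\<psi> t = initial_scalar * \<phi> t0 * delta t0 t"
  proof (cases "t = t0")
    case True
    then show ?thesis by (simp add: symmetriser_t0 initial_scalar_def delta_def)
  next
    case False
    have "?\<psi> t = 0"
    proof (rule ccontr)
      assume nz: "?\<psi> t \<noteq> 0"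
      have "component_factor a \<noteq> 0" if "?\<psi> a \<noteq> 0" for a
        using that by (auto simp: symmetriser_component_factor)
      then have "t = t0"
        using invariant_support[OF symmetriser_supp[OF supp] gen_symmetriser[OF supp]] nz by blast
      with False show False by simp
    qed
    then show ?thesis using False by (simp add: delta_def)
  qed
qed

text \<open>
  In the initial tableau the entries up to the start of component \<open>r\<close> fill the components before
  \<open>r\<close>.
\<close>

lemma component_factor_t0:
  "component_factor t0 = (\<Prod>(s, t)\<in>{(s, t). 1 \<le> s \<and> s < t \<and> t \<le> l}.
     \<Prod>(i, j)\<in>{(i, j). 1 \<le> i \<and> 1 \<le> j \<and> j \<le> lam s i}. q powi (int j - int i) * Q s - Q t)"
proof -
  let ?IJ = "\<lambda>s. {(i, j). 1 \<le> i \<and> 1 \<le> j \<and> j \<le> lam s i}"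
  let ?h = "\<lambda>t s. \<Prod>(i, j)\<in>?IJ s. q powi (int j - int i) * Q s - Q t"
  have finIJ: "finite (?IJ s)" if "1 \<le> s" for s
  proof (rule finite_imageD)
    show "inj_on (\<lambda>(i, j). (i, j, s)) (?IJ s)" by (auto simp: inj_on_def)
    show "finite ((\<lambda>(i, j). (i, j, s)) ` ?IJ s)"
      by (rule finite_subset[OF _ finite_diagram[OF lam]]) (use that in \<open>auto simp: mem_diagram\<close>)
  qed
  have inner: "(\<Prod>k=1..component_start lam r. residue q Q t0 k - Q r) = (\<Prod>s=1..<r. ?h r s)"
    if r: "r \<in> {2..l}" for r
  proof -
    let ?D = "{x \<in> diagram lam. snd (snd x) < r}" and ?S = "SIGMA s:{1..<r}. ?IJ s"
    have D: "?D = (\<lambda>(s, i, j). (i, j, s)) ` ?S"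
      by (force simp: mem_diagram image_iff)
    have "t0 ` ?D = {1..component_start lam r}"
    proof (intro equalityI subsetI)
      fix k assume "k \<in> t0 ` ?D"
      then obtain i j c where x: "(i, j, c) \<in> diagram lam" "c < r" "k = t0 (i, j, c)" by force
      then have "component_start lam (Suc c) \<le> component_start lam r" by (intro component_start_mono) simp
      then show "k \<in> {1..component_start lam r}"
        using initial_tableau_range[OF lam x(1)] x(3) by auto
    next
      fix k assume k: "k \<in> {1..component_start lam r}"
      then have kn: "1 \<le> k" "k \<le> n" using component_start_le[of r] r by auto
      obtain i j c where b: "box t0 k = (i, j, c)" by (cases "box t0 k")
      have bd: "(i, j, c) \<in> diagram lam" "t0 (i, j, c) = k" using t0_box[OF kn] b by auto
      have "c < r"
      proof (rule ccontr)
        assume "\<not> c < r"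
        then have "component_start lam r \<le> component_start lam c" by (intro component_start_mono) simp
        then show False using initial_tableau_range(1)[OF lam bd(1)] bd(2) k by simp
      qed
      then show "k \<in> t0 ` ?D" using bd by (intro image_eqI[of _ _ "(i, j, c)"]) auto
    qed
    moreover have "inj_on t0 ?D"
      using tableau_inj[OF initial_is_tableau[OF lam]] by (rule inj_on_subset) auto
    ultimately have "(\<Prod>k=1..component_start lam r. residue q Q t0 k - Q r)
        = (\<Prod>x\<in>?D. residue q Q t0 (t0 x) - Q r)"
      using prod.reindex[of t0 ?D "\<lambda>k. residue q Q t0 k - Q r"] by (simp add: comp_def)
    also have "\<dots> = (\<Prod>x\<in>?D. node_res q Q x - Q r)"
      by (intro prod.cong refl) (auto simp: residue_eq_node_res box_t0)
    also have "\<dots> = (\<Prod>(s, i, j)\<in>?S. q powi (int j - int i) * Q s - Q r)"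
      unfolding D by (subst prod.reindex) (auto simp: inj_on_def intro!: prod.cong)
    also have "\<dots> = (\<Prod>s=1..<r. ?h r s)"
      using finIJ by (subst prod.Sigma) auto
    finally show ?thesis .
  qed
  have "component_factor t0 = (\<Prod>r=2..l. \<Prod>s=1..<r. ?h r s)"
    unfolding component_factor_def by (intro prod.cong refl inner)
  also have "\<dots> = (\<Prod>(r, s)\<in>(SIGMA r:{2..l}. {1..<r}). ?h r s)"
    by (subst prod.Sigma) auto
  also have "\<dots> = (\<Prod>(s, t)\<in>{(s, t). 1 \<le> s \<and> s < t \<and> t \<le> l}. ?h t s)"
    by (rule prod.reindex_bij_witness[of _ "\<lambda>(s, t). (t, s)" "\<lambda>(s, t). (t, s)"]) auto
  finally show ?thesis .
qed

lemma gamma_initial: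
  assumes "gamma_coeffs l n q Q \<gamma>"
  shows "\<gamma> t0 = initial_scalar"
  using assms lam unfolding gamma_coeffs_def initial_scalar_def component_factor_t0 by blast

section \<open>Seminormal basis elements are matrix units\<close>

lemma star_mon: "star (mon w) = mon (rev w)"
  by (simp add: star_def mon_def)

lemma m_rep_act:
  assumes \<phi>: "\<phi> \<in> supp_in (Std lam)"
  shows "seminormal_act q Q (Std lam) (m_rep l n q Q lam s t) \<phi> = 
    (\<lambda>b. initial_scalar * foldr gen (tab_word t) \<phi> t0 * foldr gen (rev (tab_word s)) (delta t0) b)"
proof -
  let ?\<phi> = "foldr gen (tab_word t) \<phi>"
  have supp: "?\<phi> \<in> supp_in (Std lam)" using \<phi> by (rule seminormal_word_supp)
  have lin: "linear_op (foldr gen (rev (tab_word s)))"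
    by (rule linear_op_foldr[OF linear_seminormal_gen])
  have "seminormal_act q Q (Std lam) (m_rep l n q Q lam s t) \<phi> =
      foldr gen (rev (tab_word s)) (symmetriser (\<lambda>t. component_factor t * ?\<phi> t))"
    unfolding m_rep_def seminormal_act_mult symmetriser_act T_perm_tab_perm star_mon free_act_mon
      acts_diagD[OF component_factor_act supp] ..
  also have "\<dots> = (\<lambda>b. initial_scalar * ?\<phi> t0 * foldr gen (rev (tab_word s)) (delta t0) b)"
    unfolding symmetriser_times_factor[OF supp] by (rule linear_op_scale[OF lin])
  finally show ?thesis .
qed

text \<open>
  Only the coefficient of the initial tableau survives between the two words, and \<open>F\<^sub>s\<close> then
  picks the coefficient at \<open>s\<close>.
\<close>

lemma seminormal_rep_act_self:
  assumes s: "s \<in> Std lam" and t: "t \<in> Std lam"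
  shows "seminormal_act q Q (Std lam) (seminormal_rep l n q Q lam s t) (delta t) =
    (\<lambda>b. initial_scalar * up_coeff s * down_coeff t * delta s b)"
proof -
  let ?c = "initial_scalar * down_coeff t"
  have t0: "t0 \<in> Std lam" by (rule initial_Std[OF lam])
  have "seminormal_act q Q (Std lam) (F_rep l n q Q t) (delta t) = delta t"
    unfolding F_rep_acts[OF lam t delta_supp[OF t]] by (simp add: delta_def)
  moreover have "foldr gen (tab_word t) (delta t) t0 = down_coeff t"
    using word_down_coeff[OF t0 t tab_word[OF t]] by (simp add: coeff_initial)
  ultimately have "seminormal_act q Q (Std lam) (seminormal_rep l n q Q lam s t) (delta t) =
      seminormal_act q Q (Std lam) (F_rep l n q Q s) (\<lambda>b. ?c * foldr gen (rev (tab_word s)) (delta t0) b)"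
    by (simp add: seminormal_rep_def seminormal_act_mult m_rep_act[OF delta_supp[OF t]])
  also have "\<dots> = (\<lambda>b. ?c * foldr gen (rev (tab_word s)) (delta t0) s * delta s b)"
    by (rule F_rep_acts[OF lam s])
      (intro residue_scaled_supp seminormal_word_supp delta_supp[OF t0])
  also have "foldr gen (rev (tab_word s)) (delta t0) s = up_coeff s"
    using word_up_coeff[OF t0 s tab_word[OF s]] by (simp add: coeff_initial)
  finally show ?thesis by (simp add: mult_ac)
qed

lemma seminormal_rep_act_other:
  assumes mu: "mu \<in> multipartitions l n" and t: "t \<in> Std mu" and v: "v \<in> Std lam" "v \<noteq> t"
  shows "seminormal_act q Q (Std lam) (seminormal_rep l n q Q mu s t) (delta v) = (\<lambda>b. 0)"
proof -
  have "seminormal_act q Q (Std lam) (F_rep l n q Q t) (delta v) = (\<lambda>b. 0)"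
    unfolding F_rep_acts[OF mu t delta_supp[OF v(1)]] using v(2) by (simp add: delta_def)
  then show ?thesis
    by (simp add: seminormal_rep_def seminormal_act_mult
        linear_op_zero[OF linear_op_free_act[OF linear_seminormal_gen]])
qed

end

section \<open>Separation of the parameters\<close>

definition row_shape :: "nat \<Rightarrow> nat \<Rightarrow> mshape" where
  "row_shape n c = (\<lambda>c' i. if c' = c \<and> i = 1 then n else 0)"

definition col_shape :: "nat \<Rightarrow> nat \<Rightarrow> mshape" where
  "col_shape n c = (\<lambda>c' i. if c' = c \<and> 1 \<le> i \<and> i \<le> n then 1 else 0)"

lemma row_shape_multipartition:
  assumes "c \<in> {1..l}"
  shows "row_shape n c \<in> multipartitions l n"
proof -
  have "psize (row_shape n c c') = (if c' = c then n else 0)" for c'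
  proof -
    have "psize (row_shape n c c') = (\<Sum>i\<in>{1}. row_shape n c c' i)"
      unfolding psize_def by (rule sum.mono_neutral_left) (auto simp: row_shape_def)
    then show ?thesis by (simp add: row_shape_def)
  qed
  moreover have "finite {i. row_shape n c c' i \<noteq> 0}" for c'
    by (rule finite_subset[of _ "{1}"]) (auto simp: row_shape_def)
  ultimately show ?thesis
    using assms by (auto simp: multipartitions_def is_partition_def row_shape_def fun_eq_iff)
qed

lemma col_shape_multipartition:
  assumes "c \<in> {1..l}"
  shows "col_shape n c \<in> multipartitions l n"
proof -
  have "psize (col_shape n c c') = (if c' = c then n else 0)" for c'
  proof -
    have "psize (col_shape n c c') = (\<Sum>i\<in>{1..n}. col_shape n c c' i)"
      unfolding psize_def by (rule sum.mono_neutral_left) (auto simp: col_shape_def)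
    then show ?thesis by (simp add: col_shape_def)
  qed
  moreover have "finite {i. col_shape n c c' i \<noteq> 0}" for c'
    by (rule finite_subset[of _ "{1..n}"]) (auto simp: col_shape_def)
  ultimately show ?thesis
    using assms by (auto simp: multipartitions_def is_partition_def col_shape_def fun_eq_iff)
qed

lemma gamma_initial_factors:
  assumes \<gamma>: "gamma_coeffs l n q Q \<gamma>" and lam: "lam \<in> multipartitions l n"
  shows "q_fact_shape l q lam \<noteq> 0"
    and "1 \<le> c \<Longrightarrow> c < d \<Longrightarrow> d \<le> l \<Longrightarrow> (i, j, c) \<in> diagram lam \<Longrightarrow>
      q powi (int j - int i) * Q c \<noteq> Q d"
proof -
  let ?IJ = "\<lambda>s. {(i, j). 1 \<le> i \<and> 1 \<le> j \<and> j \<le> lam s i}"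
  let ?P = "\<Prod>(s, t)\<in>{(s, t). 1 \<le> s \<and> s < t \<and> t \<le> l}. \<Prod>(i, j)\<in>?IJ s. q powi (int j - int i) * Q s - Q t"
  have "\<gamma> (initial_tableau lam) = q_fact_shape l q lam * ?P" "\<gamma> (initial_tableau lam) \<noteq> 0"
    using \<gamma> lam initial_Std[OF lam] unfolding gamma_coeffs_def by blast+
  then have nz: "q_fact_shape l q lam \<noteq> 0" "?P \<noteq> 0" by auto
  then show "q_fact_shape l q lam \<noteq> 0" by simp
  assume c: "1 \<le> c" "c < d" "d \<le> l" and x: "(i, j, c) \<in> diagram lam"
  have "finite ((\<lambda>(i, j). (i, j, c)) ` ?IJ c)"
    by (rule finite_subset[OF _ finite_diagram[OF lam]]) (use c in \<open>auto simp: mem_diagram\<close>)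
  then have fin: "finite (?IJ c)" by (rule finite_imageD) (auto simp: inj_on_def)
  have fin2: "finite {(s, t). 1 \<le> s \<and> s < t \<and> t \<le> l}"
    by (rule finite_subset[of _ "{1..l} \<times> {1..l}"]) auto
  show "q powi (int j - int i) * Q c \<noteq> Q d"
  proof
    assume eq: "q powi (int j - int i) * Q c = Q d"
    have "(\<Prod>(i, j)\<in>?IJ c. q powi (int j - int i) * Q c - Q d) = 0"
      using x eq fin by (intro prod_zero bexI[of _ "(i, j)"]) (auto simp: mem_diagram)
    then have "?P = 0"
      using c fin2 by (intro prod_zero bexI[of _ "(c, d)"]) auto
    with nz(2) show False by simp
  qed
qed

text \<open>
  The value of \<open>\<gamma>\<close> at the initial tableau of one row of length \<open>n\<close> contains the \<open>q\<close>-factorial of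
  \<open>n\<close> and the differences \<open>q\<^sup>e Q\<^sub>c - Q\<^sub>d\<close> with \<open>e \<ge> 0\<close>; one column gives those with \<open>e \<le> 0\<close>.
\<close>

lemma separated_of_gamma:
  assumes \<gamma>: "gamma_coeffs l n q Q \<gamma>" and l: "l \<ge> 1" and q: "q \<noteq> 0" "q \<noteq> 1"
    and Q: "n \<ge> 2 \<Longrightarrow> \<forall>c\<in>{1..l}. Q c \<noteq> 0"
  shows "separated l n q Q"
proof -
  have "q ^ k \<noteq> 1" if k: "k \<in> {1..n}" for k
  proof
    assume "q ^ k = 1"
    then have "(q - 1) * q_int q k = 0"
      using power_diff_1_eq[of q k] by (simp add: q_int_def)
    moreover have "q_int q k \<noteq> 0"
    proof
      assume "q_int q k = 0"
      then have "q_fact q n = 0" unfolding q_fact_def using k by (intro prod_zero) auto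
      then have "(\<Prod>i | row_shape n 1 1 i \<noteq> 0. q_fact q (row_shape n 1 1 i)) = 0"
        using k by (intro prod_zero bexI[of _ 1])
          (auto simp: row_shape_def intro: finite_subset[of _ "{1}"])
      then have "q_fact_shape l q (row_shape n 1) = 0"
        unfolding q_fact_shape_def using l by (intro prod_zero) auto
      then show False
        using gamma_initial_factors(1)[OF \<gamma> row_shape_multipartition[of 1 l n]] l by simp
    qed
    ultimately show False using q(2) by simp
  qed
  moreover have "q powi e * Q c \<noteq> Q d" if cd: "1 \<le> c" "c < d" "d \<le> l" and e: "\<bar>e\<bar> < int n" for c d e
  proof (cases "0 \<le> e")
    case True
    have "(1, Suc (nat e), c) \<in> diagram (row_shape n c)"
      using cd e True by (auto simp: mem_diagram row_shape_def)
    from gamma_initial_factors(2)[OF \<gamma> row_shape_multipartition cd this] show ?thesis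
      using cd True by simp
  next
    case False
    have "(Suc (nat (- e)), 1, c) \<in> diagram (col_shape n c)"
      using cd e False by (auto simp: mem_diagram col_shape_def)
    from gamma_initial_factors(2)[OF \<gamma> col_shape_multipartition cd this] show ?thesis
      using cd False by simp
  qed
  ultimately show ?thesis using q Q by (simp add: separated_def)
qed

section \<open>Restriction to rank \<open>n - 1\<close>\<close>

text \<open>
  The node of \<open>n\<close> ends its row and its column, since an entry beyond it would be larger.
\<close>

lemma restrict_tableau:
  assumes lam: "lam \<in> multipartitions l n" and n: "1 \<le> n" and b: "b \<in> Std lam"
  obtains mu where "mu \<in> multipartitions l (n - 1)" "b \<down> (n - 1) \<in> Std mu"
    "diagram mu = diagram lam - {box b n}"
proof -
  have tab: "is_tableau lam b" using b by (rule Std_is_tableau)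
  obtain i j c where x: "box b n = (i, j, c)" by (cases "box b n")
  have xd: "(i, j, c) \<in> diagram lam" "b (i, j, c) = n" using box_props[OF lam tab, of n] n x by auto
  have top: "b y \<le> n" if "y \<in> diagram lam" for y
    using bij_betwE[OF tableau_bij[OF lam tab]] that by auto
  have "(i, Suc j, c) \<notin> diagram lam"
    using Std_nw_less[OF lam b xd(1), of "(i, Suc j, c)"] top[of "(i, Suc j, c)"] xd(2) by auto
  then have j: "j = lam c i" using xd(1) by (auto simp: mem_diagram)
  have "(Suc i, j, c) \<notin> diagram lam"
    using Std_nw_less[OF lam b xd(1), of "(Suc i, j, c)"] top[of "(Suc i, j, c)"] xd(2) by auto
  then have next_row: "lam c (Suc i) \<le> lam c i - 1" using xd(1) j by (auto simp: mem_diagram)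
  define mu where "mu = lam(c := (lam c)(i := lam c i - 1))"
  have mu_apply: "mu c' i' = (if c' = c \<and> i' = i then lam c i - 1 else lam c' i')" for c' i'
    by (simp add: mu_def)
  have part: "is_partition (mu c')" for c'
  proof -
    have p: "is_partition (lam c')" using multipartition_row[OF lam] .
    have "finite {k. mu c' k \<noteq> 0}"
      by (rule finite_subset[OF _ psize_finite_support[OF p]]) (auto simp: mu_apply split: if_splits)
    moreover have "mu c' (Suc k) \<le> mu c' k" if "k \<ge> 1" for k
    proof -
      have "lam c' (Suc k) \<le> lam c' k" using p that by (simp add: is_partition_def)
      then show ?thesis using next_row by (auto simp: mu_apply)
    qed
    moreover have "mu c' 0 = 0" using p xd(1) by (auto simp: mu_apply is_partition_def mem_diagram)
    ultimately show ?thesis by (simp add: is_partition_def)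
  qed
  \<comment> \<open>The number of nodes of \<open>\<mu>\<close> will identify this as \<open>n - 1\<close>.\<close>
  define m where "m = (\<Sum>c=1..l. psize (mu c))"
  have "mu c' = (\<lambda>_. 0)" if "c' \<notin> {1..l}" for c'
    using that lam multipartition_component[OF lam xd(1)]
    by (auto simp: mu_apply fun_eq_iff multipartitions_def)
  then have mu_m: "mu \<in> multipartitions l m" using part by (simp add: multipartitions_def m_def)
  have diag: "diagram mu = diagram lam - {(i, j, c)}"
  proof -
    have "(i', j', c') \<in> diagram mu \<longleftrightarrow> (i', j', c') \<in> diagram lam - {(i, j, c)}" for i' j' c'
      using xd(1) j by (auto simp: mem_diagram mu_apply)
    then show ?thesis by (auto simp: set_eq_iff)
  qed
  have "m = n - 1"
    using card_diagram[OF mu_m] card_diagram[OF lam] xd(1) finite_diagram[OF lam] by (simp add: diag)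
  then have mu: "mu \<in> multipartitions l (n - 1)" using mu_m by simp
  have inj: "inj_on b (diagram lam)"
    using tableau_bij[OF lam tab] by (simp add: bij_betw_def)
  have low: "b y \<le> n - 1" if "y \<in> diagram mu" for y
  proof -
    have "y \<in> diagram lam" "y \<noteq> (i, j, c)" using that diag by auto
    then have "b y \<noteq> n" using inj xd by (auto dest: inj_onD)
    then show ?thesis using top[OF \<open>y \<in> diagram lam\<close>] by simp
  qed
  have agree: "(b \<down> (n - 1)) y = b y" if "y \<in> diagram mu" for y
    using low[OF that] by (simp add: tab_restrict_def)
  have outside: "(b \<down> (n - 1)) y = 0" if "y \<notin> diagram mu" for y
    using that tableau_outside[OF tab, of y] xd n by (cases "y \<in> diagram lam") (auto simp: diag tab_restrict_def)
  have "bij_betw b (diagram lam - {(i, j, c)}) ({1..n} - {n})"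
    using xd n by (intro bij_betw_DiffI[OF tableau_bij[OF lam tab]]) (auto simp: bij_betw_def)
  moreover have "{1..n} - {n} = {1..n - 1}" by auto
  ultimately have "bij_betw (b \<down> (n - 1)) (diagram mu) {1..n - 1}"
    using bij_betw_cong[of "diagram mu" "b \<down> (n - 1)" b] agree by (simp add: diag)
  then have "is_tableau mu (b \<down> (n - 1))"
    using outside by (simp add: is_tableau_def card_diagram[OF mu])
  then have "b \<down> (n - 1) \<in> Std mu"
    using b agree unfolding Std_def mem_Collect_eq by (simp add: diag)
  then show thesis using that mu diag x by simp
qed

lemma restrict_eq_iff: "1 \<le> k \<Longrightarrow> k \<le> m \<Longrightarrow> (b \<down> m) x = k \<longleftrightarrow> b x = k"
  by (auto simp: tab_restrict_def)

lemma box_restrict: "1 \<le> k \<Longrightarrow> k \<le> m \<Longrightarrow> box (b \<down> m) k = box b k"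
  by (simp add: box_def restrict_eq_iff)

lemma residue_restrict: "1 \<le> k \<Longrightarrow> k \<le> m \<Longrightarrow> residue q Q (b \<down> m) k = residue q Q b k"
  by (simp add: residue_eq_node_res box_restrict)

lemma swap_restrict:
  assumes "1 \<le> i" "i < m"
  shows "(adj_swap i \<circ> b) \<down> m = adj_swap i \<circ> (b \<down> m)"
  using assms by (auto simp: fun_eq_iff tab_restrict_def transpose_def)

lemma restrict_inject:
  assumes lam: "lam \<in> multipartitions l n" and n: "1 \<le> n" and b: "b \<in> Std lam" "v \<in> Std lam"
    and eq: "b \<down> (n - 1) = v \<down> (n - 1)"
  shows "b = v"
proof
  fix x
  have ran: "b x \<in> {1..n} \<and> v x \<in> {1..n}" if "x \<in> diagram lam"
    using bij_betwE[OF tableau_bij[OF lam Std_is_tableau[OF b(1)]]]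
      bij_betwE[OF tableau_bij[OF lam Std_is_tableau[OF b(2)]]] that by blast
  have "(if b x \<le> n - 1 then b x else 0) = (if v x \<le> n - 1 then v x else 0)"
    using fun_cong[OF eq, of x] by (simp add: tab_restrict_def)
  then show "b x = v x"
    using ran tableau_outside[OF Std_is_tableau[OF b(1)], of x] tableau_outside[OF Std_is_tableau[OF b(2)], of x]
    by (cases "x \<in> diagram lam") (auto split: if_splits)
qed

definition extend_vec :: "nat \<Rightarrow> tableau set \<Rightarrow> (tableau \<Rightarrow> 'a::field) \<Rightarrow> tableau \<Rightarrow> 'a" where
  "extend_vec n S \<phi> b = (if b \<in> S then \<phi> (b \<down> (n - 1)) else 0)"

text \<open>
  A vector of the representation of shape \<open>\<mu>\<close> extends to the tableaux of shape \<open>\<lambda>\<close> which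
  restrict to shape \<open>\<mu>\<close>; this commutes with the generators of rank \<open>n - 1\<close>, which do not move
  the entry \<open>n\<close>.
\<close>

lemma gen_extend_vec:
  assumes lam: "lam \<in> multipartitions l n" and mu: "mu \<in> multipartitions l (n - 1)"
    and \<phi>: "\<phi> \<in> supp_in (Std mu)" and i: "i < n - 1"
  shows "seminormal_gen q Q (Std lam) i (extend_vec n (Std lam) \<phi>)
    = extend_vec n (Std lam) (seminormal_gen q Q (Std mu) i \<phi>)"
proof
  fix b
  let ?r = "b \<down> (n - 1)"
  show "seminormal_gen q Q (Std lam) i (extend_vec n (Std lam) \<phi>) b
    = extend_vec n (Std lam) (seminormal_gen q Q (Std mu) i \<phi>) b"
  proof (cases "b \<in> Std lam")
    case b: True
    obtain nu where nu: "nu \<in> multipartitions l (n - 1)" "?r \<in> Std nu"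
    proof -
      have "1 \<le> n" using i by simp
      then show thesis using restrict_tableau[OF lam _ b] that by blast
    qed
    show ?thesis
    proof (cases "i = 0")
      case True
      then show ?thesis
        using b i supp_inD[OF \<phi>, of ?r]
        by (simp add: seminormal_gen_def extend_vec_def residue_restrict)
    next
      case False
      then have i1: "1 \<le> i" by simp
      have same_shape: "?r \<in> Std mu" if m: "adj_swap i \<circ> ?r \<in> Std mu"
      proof -
        have "is_tableau mu (adj_swap i \<circ> (adj_swap i \<circ> ?r))"
          using swap_is_tableau[OF mu Std_is_tableau[OF m] i1 i] .
        then have "is_tableau mu ?r" by (simp only: adj_swap_comp)
        then have "diagram mu = diagram nu"
          using tableau_pos[of mu ?r] tableau_pos[OF Std_is_tableau[OF nu(2)]] by blast
        then have "mu = nu" by (rule diagram_inject[OF mu nu(1)])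
        then show ?thesis using nu(2) by simp
      qed
      have off: "extend_vec n (Std lam) \<phi> (adj_swap i \<circ> b) = \<phi> (adj_swap i \<circ> ?r)"
      proof (cases "adj_swap i \<circ> b \<in> Std lam")
        case True
        then show ?thesis using swap_restrict[OF i1 i] by (simp add: extend_vec_def)
      next
        case False
        then have linked: "linked (box b i) (box b (Suc i))"
          using swap_Std_iff[OF lam b i1] i by simp
        have "adj_swap i \<circ> ?r \<notin> Std mu"
        proof
          assume m: "adj_swap i \<circ> ?r \<in> Std mu"
          then have "\<not> linked (box ?r i) (box ?r (Suc i))"
            using swap_Std_iff[OF mu same_shape[OF m] i1 i] by blast
          then show False using linked i1 i by (simp add: box_restrict)
        qed
        then show ?thesis using False supp_inD[OF \<phi>] by (simp add: extend_vec_def)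
      qed
      show ?thesis
      proof (cases "?r \<in> Std mu")
        case True
        then show ?thesis
          using b i i1 off by (simp add: seminormal_gen_def)
            (simp add: extend_vec_def seminormal_gen_def residue_restrict)
      next
        case False
        then have "adj_swap i \<circ> ?r \<notin> Std mu" using same_shape by blast
        then have "\<phi> (adj_swap i \<circ> ?r) = 0" "\<phi> ?r = 0" using supp_inD[OF \<phi>] False by auto
        then show ?thesis
          using b i1 False off by (simp add: seminormal_gen_def)
            (simp add: extend_vec_def seminormal_gen_def)
      qed
    qed
  qed (simp add: seminormal_gen_def extend_vec_def)
qed

lemma act_extend_vec:
  assumes lam: "lam \<in> multipartitions l n" and mu: "mu \<in> multipartitions l (n - 1)"
    and x: "x \<in> carrier (free_algebra (n - 1))" and \<phi>: "\<phi> \<in> supp_in (Std mu)"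
  shows "seminormal_act q Q (Std lam) x (extend_vec n (Std lam) \<phi>)
    = extend_vec n (Std lam) (seminormal_act q Q (Std mu) x \<phi>)"
proof -
  have word: "foldr (seminormal_gen q Q (Std lam)) w (extend_vec n (Std lam) \<phi>)
      = extend_vec n (Std lam) (foldr (seminormal_gen q Q (Std mu)) w \<phi>)" if "set w \<subseteq> {..<n - 1}" for w
    using that
  proof (induction w)
    case (Cons i w)
    then show ?case
      using gen_extend_vec[OF lam mu seminormal_word_supp[OF \<phi>, where q = q and Q = Q and w = w], of i q Q]
      by simp
  qed simp
  show ?thesis
  proof
    fix b
    show "seminormal_act q Q (Std lam) x (extend_vec n (Std lam) \<phi>) b
      = extend_vec n (Std lam) (seminormal_act q Q (Std mu) x \<phi>) b"
      using x word by (simp add: free_act_def mem_free_algebra) (simp add: extend_vec_def free_act_def)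
  qed
qed

lemma extend_vec_delta:
  assumes lam: "lam \<in> multipartitions l n" and n: "1 \<le> n" and v: "v \<in> Std lam"
  shows "extend_vec n (Std lam) (delta (v \<down> (n - 1))) = delta v"
proof
  fix b
  have "b \<down> (n - 1) = v \<down> (n - 1) \<longleftrightarrow> b = v" if "b \<in> Std lam"
    using restrict_inject[OF lam n that v] by blast
  then show "extend_vec n (Std lam) (delta (v \<down> (n - 1))) b = delta v b"
    using v unfolding extend_vec_def delta_def by (cases "b \<in> Std lam") auto
qed

section \<open>The branching coefficients\<close>

lemma free_algebra_set_prod:
  assumes "\<And>k. k \<in> A \<Longrightarrow> x k \<in> carrier (free_algebra n)"
    and comm: "\<And>k m. x k * x m = x m * x k"
  shows "set_prod x A \<in> carrier (free_algebra n)"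
proof -
  interpret comp_fun_commute "\<lambda>k y. x k * y"
    using comm by unfold_locales (auto simp: fun_eq_iff mult.assoc[symmetric])
  show ?thesis
    using assms(1)
    by (induction A rule: infinite_finite_induct)
      (auto simp: set_prod_def free_algebra_one free_algebra_mult_closed)
qed

lemma jucys_murphy_closed: "1 \<le> k \<Longrightarrow> k \<le> n \<Longrightarrow> jucys_murphy q k \<in> carrier (free_algebra n)"
  unfolding jucys_murphy_def
  by (intro free_algebra_mult_closed free_algebra_const free_algebra_mon) auto

lemma F_rep_closed: "F_rep l n q Q t \<in> carrier (free_algebra n)"
  unfolding F_rep_def
proof (intro free_algebra_prod_list, clarsimp simp del: upt_Suc)
  fix k assume "Suc 0 \<le> k" "k < Suc n"
  then show "set_prod (\<lambda>c. const (1 / (residue q Q t k - c)) * (jucys_murphy q k - const c))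
      (residue_set l n q Q k - {residue q Q t k}) \<in> carrier (free_algebra n)"
    by (intro free_algebra_set_prod linear_factors_commute free_algebra_mult_closed free_algebra_const
        free_algebra_diff_closed jucys_murphy_closed) auto
qed

context separated_shape
begin

lemma m_rep_closed:
  assumes s: "s \<in> Std lam" and t: "t \<in> Std lam"
  shows "m_rep l n q Q lam s t \<in> carrier (free_algebra n)"
proof -
  have words: "set (tab_word u) \<subseteq> {..<n}" if "u \<in> Std lam" for u
    using tab_word(1)[OF that] by (auto simp: ascending_def)
  have "T_perm n w \<in> carrier (free_algebra n)" if "w \<in> young_subgroup lam" for w
    using perm_word_reduced[OF young_permutes[OF that]] unfolding T_perm_eq
    by (intro free_algebra_mon) (auto simp: reduced_word_def)
  moreover have "jucys_murphy q k - const (Q r) \<in> carrier (free_algebra n)"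
    if "r \<in> set [2..<Suc l]" "k \<in> set [1..<Suc (\<Sum>c=1..<r. psize (lam c))]" for r k
  proof -
    have "1 \<le> k" "k \<le> component_start lam r" "r \<le> l" using that by (auto simp: component_start_def)
    then show ?thesis
      using component_start_le[of r]
      by (intro free_algebra_diff_closed jucys_murphy_closed free_algebra_const) auto
  qed
  then have "prod_list (map (\<lambda>r. prod_list (map (\<lambda>k. jucys_murphy q k - const (Q r))
      [1..<Suc (\<Sum>c=1..<r. psize (lam c))])) [2..<Suc l]) \<in> carrier (free_algebra n)"
    by (intro free_algebra_prod_list) (auto simp del: upt_Suc set_upt intro!: free_algebra_prod_list)
  ultimately show ?thesis
    unfolding m_rep_def T_perm_tab_perm star_mon
    using words[OF s] words[OF t]
    by (intro free_algebra_mult_closed free_algebra_sum free_algebra_mon) auto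
qed

lemma seminormal_rep_closed:
  "s \<in> Std lam \<Longrightarrow> t \<in> Std lam \<Longrightarrow> seminormal_rep l n q Q lam s t \<in> carrier (free_algebra n)"
  unfolding seminormal_rep_def
  by (intro free_algebra_mult_closed F_rep_closed m_rep_closed)

text \<open>
  Restriction removes exactly the inversions which the last node forms with all nodes
  read after it, so the products over inversions change by factors that depend only on the two
  shapes.
\<close>

lemma coeff_restrict:
  assumes mu: "mu \<in> multipartitions l (n - 1)" and x: "x \<in> diagram lam"
    and diag: "diagram mu = diagram lam - {x}"
    and u: "u \<in> Std lam" and r: "u \<down> (n - 1) \<in> Std mu"
  shows "down_coeff u = separated_shape.down_coeff q Q mu (u \<down> (n - 1)) *
      (\<Prod>b\<in>{b \<in> diagram lam. reads_before x b}. off_coeff q (node_res q Q x) (node_res q Q b))"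
    and "up_coeff u = separated_shape.up_coeff q Q mu (u \<down> (n - 1)) *
      (\<Prod>b\<in>{b \<in> diagram lam. reads_before x b}. off_coeff q (node_res q Q b) (node_res q Q x))"
proof -
  interpret mu: separated_shape l "n - 1" q Q mu
    using separated_mono[OF sep, of "n - 1"] mu by unfold_locales auto
  let ?r = "u \<down> (n - 1)" and ?B = "{b \<in> diagram lam. reads_before x b}"
  have tab: "is_tableau lam u" using u by (rule Std_is_tableau)
  have agree: "?r y = u y \<and> u y \<le> n - 1" if "y \<in> diagram mu" for y
    using tableau_pos[OF Std_is_tableau[OF r], of y] that by (auto simp: tab_restrict_def split: if_splits)
  have "?r x = 0" using tableau_outside[OF Std_is_tableau[OF r], of x] diag by simp
  then have ux: "u x = n"
    using Std_entry_range[OF u x] by (auto simp: tab_restrict_def split: if_splits)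
  have below: "u y < n" if "y \<in> diagram lam" "y \<noteq> x" for y
  proof -
    have "y \<in> diagram mu" using diag that by blast
    then have "u y \<le> n - 1" using agree by blast
    then show ?thesis using ux Std_entry_range(1)[OF u x] by simp
  qed
  have Inv: "Inv u = mu.Inv ?r \<union> Pair x ` ?B"
  proof -
    have pair: "(a, b) \<in> Inv u \<longleftrightarrow> (a, b) \<in> mu.Inv ?r \<union> Pair x ` ?B" for a b
    proof -
      consider "a = x" "b = x" | "a = x" "b \<noteq> x" | "a \<noteq> x" "b = x" | "a \<noteq> x" "b \<noteq> x" by blast
      then show ?thesis
      proof cases
        case 1
        then show ?thesis using reads_before_asym[of x x] by (auto simp: inversions_def)
      next
        case 2
        then have "(a, b) \<in> Inv u \<longleftrightarrow> b \<in> ?B"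
          using below[of b] ux x unfolding inversions_def by blast
        moreover have "(a, b) \<notin> mu.Inv ?r" using diag 2 unfolding inversions_def by blast
        ultimately show ?thesis using 2 by blast
      next
        case 3
        then have "(a, b) \<notin> Inv u"
          using below[of a] ux unfolding inversions_def by force
        moreover have "(a, b) \<notin> mu.Inv ?r" using diag 3 unfolding inversions_def by blast
        ultimately show ?thesis using 3 by blast
      next
        case 4
        have "(a, b) \<in> Inv u \<longleftrightarrow> (a, b) \<in> mu.Inv ?r"
        proof (cases "a \<in> diagram mu \<and> b \<in> diagram mu")
          case True
          then show ?thesis using agree[of a] agree[of b] diag 4 unfolding inversions_def by simp
        next
          case False
          then show ?thesis using diag 4 unfolding inversions_def by blast
        qed
        then show ?thesis using 4 by blast
      qed
    qed
    show ?thesis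
    proof (rule Set.set_eqI)
      fix z :: "node \<times> node"
      obtain a b where z: "z = (a, b)" by (rule prod.exhaust)
      show "z \<in> Inv u \<longleftrightarrow> z \<in> mu.Inv ?r \<union> Pair x ` ?B" unfolding z by (rule pair)
    qed
  qed
  have disj: "mu.Inv ?r \<inter> Pair x ` ?B = {}" using diag by (auto simp: inversions_def)
  have fin: "finite (mu.Inv ?r)" "finite (Pair x ` ?B)"
    using mu.finite_Inv finite_diagram[OF lam] by auto
  show "down_coeff u = mu.down_coeff ?r * (\<Prod>b\<in>?B. off_coeff q (node_res q Q x) (node_res q Q b))"
    unfolding down_coeff_def mu.down_coeff_def Inv prod.union_disjoint[OF fin disj]
    by (subst prod.reindex) (auto simp: inj_on_def)
  show "up_coeff u = mu.up_coeff ?r * (\<Prod>b\<in>?B. off_coeff q (node_res q Q b) (node_res q Q x))"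
    unfolding up_coeff_def mu.up_coeff_def Inv prod.union_disjoint[OF fin disj]
    by (subst prod.reindex) (auto simp: inj_on_def)
qed

text \<open>
  The matrix coefficient at \<open>u\<close>, \<open>v\<close> picks out one term of the expansion, because the
  elements of the basis act as multiples of distinct matrix units.
\<close>

lemma matrix_coefficient_of_expansion:
  assumes u: "u \<in> Std lam" and v: "v \<in> Std lam"
  shows "seminormal_act q Q (Std lam) (\<Sum>lam'\<in>multipartitions l n. \<Sum>u'\<in>Std lam'. \<Sum>v'\<in>Std lam'.
      const (\<beta> u' v') * seminormal_rep l n q Q lam' u' v') (delta v) u
    = \<beta> u v * (initial_scalar * up_coeff u * down_coeff v)"
proof -
  let ?a = "\<lambda>lam' u' v'. \<beta> u' v' * seminormal_act q Q (Std lam) (seminormal_rep l n q Q lam' u' v') (delta v) u"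
  have other: "?a lam' u' v' = 0" if "lam' \<in> multipartitions l n" "v' \<in> Std lam'" "v' \<noteq> v" for lam' u' v'
    using seminormal_rep_act_other[OF that(1,2) v] that(3) by simp
  have self: "?a lam u' v = (if u' = u then \<beta> u v * (initial_scalar * up_coeff u * down_coeff v) else 0)"
    if "u' \<in> Std lam" for u'
    using seminormal_rep_act_self[OF that v] by (auto simp: delta_def)
  have row: "(\<Sum>u'\<in>Std lam'. \<Sum>v'\<in>Std lam'. ?a lam' u' v') =
      (if lam' = lam then \<beta> u v * (initial_scalar * up_coeff u * down_coeff v) else 0)"
    if lam': "lam' \<in> multipartitions l n" for lam'
  proof (cases "lam' = lam")
    case True
    have "(\<Sum>v'\<in>Std lam. ?a lam u' v') = ?a lam u' v" for u'
    proof -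
      have "(\<Sum>v'\<in>Std lam. ?a lam u' v') = (\<Sum>v'\<in>{v}. ?a lam u' v')"
        using v other[OF lam] finite_Std[OF lam] by (intro sum.mono_neutral_right) auto
      then show ?thesis by simp
    qed
    then have "(\<Sum>u'\<in>Std lam'. \<Sum>v'\<in>Std lam'. ?a lam' u' v') = (\<Sum>u'\<in>Std lam. ?a lam u' v)"
      using True by simp
    also have "\<dots> = (\<Sum>u'\<in>Std lam. if u' = u then \<beta> u v * (initial_scalar * up_coeff u * down_coeff v) else 0)"
      by (intro sum.cong refl self)
    finally show ?thesis using True u finite_Std[OF lam] by simp
  next
    case False
    have "v' \<noteq> v" if "v' \<in> Std lam'" for v'
      using Std_shape_unique[OF lam' lam] that v False by blast
    then show ?thesis using other[OF lam'] False by (simp add: sum.neutral)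
  qed
  have "seminormal_act q Q (Std lam) (\<Sum>lam'\<in>multipartitions l n. \<Sum>u'\<in>Std lam'. \<Sum>v'\<in>Std lam'.
      const (\<beta> u' v') * seminormal_rep l n q Q lam' u' v') (delta v) u
    = (\<Sum>lam'\<in>multipartitions l n. \<Sum>u'\<in>Std lam'. \<Sum>v'\<in>Std lam'. ?a lam' u' v')"
    by (simp add: free_act_sum seminormal_act_mult free_act_const)
  also have "\<dots> = (\<Sum>lam'\<in>multipartitions l n.
      if lam' = lam then \<beta> u v * (initial_scalar * up_coeff u * down_coeff v) else 0)"
    by (intro sum.cong refl row)
  finally show ?thesis using lam finite_multipartitions by simp
qed

end

theorem theorem1p3:
  fixes l n :: nat
    and q :: "'a::field"
    and Q :: "nat \<Rightarrow> 'a"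
    and mu lam :: mshape
    and s t u v :: tableau
    and \<beta> :: "tableau \<Rightarrow> tableau \<Rightarrow> 'a"
    and \<gamma>' \<gamma> :: "tableau \<Rightarrow> 'a"
  assumes "l \<ge> 1" and "n \<ge> 1"
    and "q \<noteq> 0" and "q \<noteq> 1"
    and "n \<ge> 2 \<Longrightarrow> \<forall>c\<in>{1..l}. Q c \<noteq> 0"
    and "semisimple_ring (hecke l n q Q)"
    and "mu \<in> multipartitions l (n - 1)" and "lam \<in> multipartitions l n"
    and "s \<in> Std mu" and "t \<in> Std mu"
    and "u \<in> Std lam" and "v \<in> Std lam"
    and "gamma_coeffs l (n - 1) q Q \<gamma>'" and "gamma_coeffs l n q Q \<gamma>"
    and "hecke_embed l n q Q (seminormal l (n - 1) q Q mu s t) =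
           (\<Oplus>\<^bsub>hecke l n q Q\<^esub>lam'\<in>multipartitions l n.
              \<Oplus>\<^bsub>hecke l n q Q\<^esub>u'\<in>Std lam'. \<Oplus>\<^bsub>hecke l n q Q\<^esub>v'\<in>Std lam'.
                hecke_smult l n q Q (\<beta> u' v') (seminormal l n q Q lam' u' v'))"
  shows "(\<beta> u v \<noteq> 0 \<longleftrightarrow> u \<down> (n - 1) = s \<and> v \<down> (n - 1) = t) \<and>
         (\<beta> u v \<noteq> 0 \<longrightarrow> \<beta> u v = \<gamma>' s / \<gamma> u \<and> \<gamma>' s / \<gamma> u = \<gamma>' t / \<gamma> v)"
proof -
  note l = assms(1) and n = assms(2) and mu = assms(7) and lam = assms(8)
  note s = assms(9) and t = assms(10) and u = assms(11) and v = assms(12)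
  note \<gamma>' = assms(13) and \<gamma> = assms(14)
  have sep: "separated l n q Q"
    using \<gamma> l assms(3,4,5) by (rule separated_of_gamma)
  have sep': "separated l (n - 1) q Q" using separated_mono[OF sep] by simp
  interpret L: separated_shape l n q Q lam using sep lam by unfold_locales
  interpret M: separated_shape l "n - 1" q Q mu using sep' mu by unfold_locales
  let ?x = "seminormal_rep l (n - 1) q Q mu s t"
  let ?y = "\<Sum>lam'\<in>multipartitions l n. \<Sum>u'\<in>Std lam'. \<Sum>v'\<in>Std lam'.
      const (\<beta> u' v') * seminormal_rep l n q Q lam' u' v'"
  have x': "?x \<in> carrier (free_algebra (n - 1))" by (rule M.seminormal_rep_closed[OF s t])
  then have x: "?x \<in> carrier (free_algebra n)" by (fastforce simp: mem_free_algebra)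
  have term_closed: "const (\<beta> u' v') * seminormal_rep l n q Q lam' u' v' \<in> carrier (free_algebra n)"
    if "lam' \<in> multipartitions l n" "u' \<in> Std lam'" "v' \<in> Std lam'" for lam' u' v'
  proof -
    interpret separated_shape l n q Q lam' using sep that(1) by unfold_locales
    show ?thesis using that by (intro free_algebra_mult_closed free_algebra_const seminormal_rep_closed)
  qed
  have term_proj: "hecke_smult l n q Q (\<beta> u' v') (seminormal l n q Q lam' u' v') =
      hecke_proj l n q Q (const (\<beta> u' v') * seminormal_rep l n q Q lam' u' v')"
    if "lam' \<in> multipartitions l n" "u' \<in> Std lam'" "v' \<in> Std lam'" for lam' u' v'
  proof -
    interpret separated_shape l n q Q lam' using sep that(1) by unfold_locales
    show ?thesis
      using hecke_smult_proj[OF seminormal_rep_closed[OF that(2,3)]]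
      by (simp add: seminormal_def seminormal_rep_def)
  qed
  have y: "?y \<in> carrier (free_algebra n)" by (intro free_algebra_sum term_closed)
  have "hecke_proj l n q Q ?x = hecke_embed l n q Q (seminormal l (n - 1) q Q mu s t)"
    using hecke_embed_proj[OF x'] by (simp add: seminormal_def seminormal_rep_def)
  also have "\<dots> = hecke_proj l n q Q ?y"
    unfolding assms(15)
    by (intro finsum_hecke_proj free_algebra_sum term_closed term_proj)
  finally have ideal: "?x - ?y \<in> hecke_ideal l n q Q" using hecke_proj_eq_iff[OF x y] by blast
  have "seminormal_act q Q (Std lam) ?x (delta v) u = seminormal_act q Q (Std lam) ?y (delta v) u"
    using fun_cong[OF L.hecke_ideal_seminormal_act[OF ideal delta_supp[OF v]], of u]
    by (simp add: free_act_diff)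
  then have main: "seminormal_act q Q (Std lam) ?x (delta v) u =
      \<beta> u v * (L.initial_scalar * L.up_coeff u * L.down_coeff v)"
    unfolding L.matrix_coefficient_of_expansion[OF u v] .
  obtain nu where nu: "nu \<in> multipartitions l (n - 1)" "v \<down> (n - 1) \<in> Std nu"
      "diagram nu = diagram lam - {box v n}"
    using restrict_tableau[OF lam n v] by blast
  interpret N: separated_shape l "n - 1" q Q nu using sep' nu(1) by unfold_locales
  let ?ur = "u \<down> (n - 1)" and ?vr = "v \<down> (n - 1)"
  have "seminormal_act q Q (Std lam) ?x (delta v) u =
      extend_vec n (Std lam) (seminormal_act q Q (Std nu) ?x (delta ?vr)) u"
    using fun_cong[OF act_extend_vec[OF lam nu(1) x' delta_supp[OF nu(2)], of q Q], of u]
    unfolding extend_vec_delta[OF lam n v] .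
  also have "\<dots> = seminormal_act q Q (Std nu) ?x (delta ?vr) ?ur"
    using u by (simp add: extend_vec_def)
  also have "\<dots> = (if ?ur = s \<and> ?vr = t then M.initial_scalar * M.up_coeff s * M.down_coeff t else 0)"
  proof (cases "?vr = t")
    case True
    then have "nu = mu" using Std_shape_unique[OF nu(1) mu nu(2)] t by simp
    then show ?thesis using M.seminormal_rep_act_self[OF s t] True by (simp add: delta_def)
  next
    case False
    then show ?thesis using N.seminormal_rep_act_other[OF mu t nu(2)] by simp
  qed
  finally have eq: "\<beta> u v * (L.initial_scalar * L.up_coeff u * L.down_coeff v) =
      (if ?ur = s \<and> ?vr = t then M.initial_scalar * M.up_coeff s * M.down_coeff t else 0)"
    using main by simp
  have scalars: "L.initial_scalar \<noteq> 0" "M.initial_scalar \<noteq> 0"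
    using L.gamma_initial[OF \<gamma>] M.gamma_initial[OF \<gamma>'] \<gamma> \<gamma>' lam mu initial_Std[OF lam] initial_Std[OF mu]
    unfolding gamma_coeffs_def by metis+
  note nonzero = scalars L.coeff_nonzero[OF u] L.coeff_nonzero[OF v] M.coeff_nonzero[OF s] M.coeff_nonzero[OF t]
  have iff: "\<beta> u v \<noteq> 0 \<longleftrightarrow> ?ur = s \<and> ?vr = t"
    using eq nonzero by (auto split: if_splits)
  moreover have "\<beta> u v = \<gamma>' s / \<gamma> u \<and> \<gamma>' s / \<gamma> u = \<gamma>' t / \<gamma> v" if "?ur = s" "?vr = t"
  proof -
    have shape: "nu = mu" using Std_shape_unique[OF nu(1) mu nu(2)] t that(2) by simp
    have xd: "box v n \<in> diagram lam" using L.Std_box(1)[OF v n] by simp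
    note diag = nu(3)[unfolded shape]
    let ?B = "{b \<in> diagram lam. reads_before (box v n) b}"
    let ?d = "\<Prod>b\<in>?B. off_coeff q (node_res q Q (box v n)) (node_res q Q b)"
    let ?e = "\<Prod>b\<in>?B. off_coeff q (node_res q Q b) (node_res q Q (box v n))"
    have cu: "L.down_coeff u = M.down_coeff s * ?d" "L.up_coeff u = M.up_coeff s * ?e"
      using L.coeff_restrict[OF mu xd diag u] s that(1) by auto
    have cv: "L.down_coeff v = M.down_coeff t * ?d" "L.up_coeff v = M.up_coeff t * ?e"
      using L.coeff_restrict[OF mu xd diag v] t that(2) by auto
    have "?d \<noteq> 0" "?e \<noteq> 0" using nonzero cu by auto
    have "\<gamma>' s / \<gamma> u = M.initial_scalar / (L.initial_scalar * ?d * ?e)"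
      using nonzero \<open>?d \<noteq> 0\<close> \<open>?e \<noteq> 0\<close>
      by (simp add: L.gamma_closed_form[OF \<gamma> u] M.gamma_closed_form[OF \<gamma>' s]
          L.gamma_initial[OF \<gamma>] M.gamma_initial[OF \<gamma>'] cu field_simps)
    moreover have "\<gamma>' t / \<gamma> v = M.initial_scalar / (L.initial_scalar * ?d * ?e)"
      using nonzero \<open>?d \<noteq> 0\<close> \<open>?e \<noteq> 0\<close>
      by (simp add: L.gamma_closed_form[OF \<gamma> v] M.gamma_closed_form[OF \<gamma>' t]
          L.gamma_initial[OF \<gamma>] M.gamma_initial[OF \<gamma>'] cv field_simps)
    moreover have "\<beta> u v = M.initial_scalar / (L.initial_scalar * ?d * ?e)"
      using eq that nonzero \<open>?d \<noteq> 0\<close> \<open>?e \<noteq> 0\<close> by (simp add: cu cv field_simps)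
    ultimately show ?thesis by simp
  qed
  ultimately show ?thesis by blast
qed

end
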